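(* For every recursive function $f:\mathbb{N}\to\mathbb{N}$ there exists a finitely presented residually finite semigroup $S$ such that $\rho_S(n)>f(n)$ for all $n$. In addition, we can assume that the word problem in $S$ is as hard as the membership problem for any prescribed recursive set $Z$ of natural numbers.
   Context: For a residually finite semigroup $S$ generated by a finite set $X$, the depth function $\rho_S(n)$ is the smallest number such that for every two different elements $z,z'$ of $S$ represented by words over $X$ of length at most $n$ there exists a homomorphism $\phi$ from $S$ onto a finite semigroup of cardinality at most $\rho_S(n)$ with $\phi(z)\ne\phi(z')$. It does not depend on the choice of $X$ up to the natural equivalence; the claim means that the inequality holds for all $n\ge 1$ with respect to a suitable finite generating set of $S$. The word problem in $S$ is the problem of deciding, given two words over a fixed finite generating set, whether they are equal in $S$; it is "as hard as the membership problem for $Z$" if the membership problem in $Z$, with natural numbers written in unary, reduces to the word problem in $S$ by a polynomial-time many-one reduction. *)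

theory Defs
  imports "HOL-Computational_Algebra.Polynomial"
begin

section \<open>Semigroups\<close>

record 'a sgrp =
  carrier :: "'a set"
  mult :: "'a \<Rightarrow> 'a \<Rightarrow> 'a"

definition is_semigroup :: "'a sgrp \<Rightarrow> bool" where
  "is_semigroup S \<longleftrightarrow>
     (\<forall>x\<in>carrier S. \<forall>y\<in>carrier S. mult S x y \<in> carrier S) \<and>
     (\<forall>x\<in>carrier S. \<forall>y\<in>carrier S. \<forall>z\<in>carrier S.
        mult S (mult S x y) z = mult S x (mult S y z))"

definition sgrp_hom :: "'a sgrp \<Rightarrow> 'b sgrp \<Rightarrow> ('a \<Rightarrow> 'b) set" where
  "sgrp_hom S T = {h. h ` carrier S \<subseteq> carrier T \<and>
     (\<forall>x\<in>carrier S. \<forall>y\<in>carrier S. h (mult S x y) = mult T (h x) (h y))}"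

definition sgrp_epi :: "'a sgrp \<Rightarrow> 'b sgrp \<Rightarrow> ('a \<Rightarrow> 'b) set" where
  "sgrp_epi S T = {h \<in> sgrp_hom S T. h ` carrier S = carrier T}"

definition sgrp_iso :: "'a sgrp \<Rightarrow> 'b sgrp \<Rightarrow> ('a \<Rightarrow> 'b) set" where
  "sgrp_iso S T = {h \<in> sgrp_hom S T. bij_betw h (carrier S) (carrier T)}"

definition words :: "'a set \<Rightarrow> 'a list set" where
  "words X = {w \<in> lists X. w \<noteq> []}"

text \<open>The value in \<open>S\<close> of a nonempty word; the empty word has no value in a semigroup.\<close>

fun word_val :: "'a sgrp \<Rightarrow> 'a list \<Rightarrow> 'a" where
  "word_val S [] = undefined"
| "word_val S [x] = x"
| "word_val S (x # y # ys) = mult S x (word_val S (y # ys))"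

definition generates :: "'a sgrp \<Rightarrow> 'a set \<Rightarrow> bool" where
  "generates S X \<longleftrightarrow> X \<subseteq> carrier S \<and> word_val S ` words X = carrier S"

text \<open>The least congruence on the free semigroup \<open>words X\<close> (under concatenation) that
  contains \<open>R\<close>, for \<open>R \<subseteq> words X \<times> words X\<close>.\<close>

inductive pres_cong :: "'g set \<Rightarrow> ('g list \<times> 'g list) set \<Rightarrow> 'g list \<Rightarrow> 'g list \<Rightarrow> bool"
  for X R where
  rel: "(u, v) \<in> R \<Longrightarrow> pres_cong X R u v"
| refl: "u \<in> words X \<Longrightarrow> pres_cong X R u u"
| sym: "pres_cong X R u v \<Longrightarrow> pres_cong X R v u"
| trans: "pres_cong X R u v \<Longrightarrow> pres_cong X R v w \<Longrightarrow> pres_cong X R u w"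
| mult: "pres_cong X R u v \<Longrightarrow> pres_cong X R u' v' \<Longrightarrow> pres_cong X R (u @ u') (v @ v')"

definition presented :: "'g set \<Rightarrow> ('g list \<times> 'g list) set \<Rightarrow> 'g list set sgrp" where
  "presented X R =
     \<lparr>carrier = words X // {(u, v). pres_cong X R u v},
      mult = (\<lambda>A B. {w. \<exists>u\<in>A. \<exists>v\<in>B. pres_cong X R (u @ v) w})\<rparr>"

text \<open>Any finite set of generators can be renamed to natural numbers.\<close>

definition finitely_presented :: "'a sgrp \<Rightarrow> bool" where
  "finitely_presented S \<longleftrightarrow> is_semigroup S \<and>
     (\<exists>(X :: nat set) R. finite X \<and> finite R \<and> R \<subseteq> words X \<times> words X \<and>
        sgrp_iso (presented X R) S \<noteq> {})"

text \<open>Every finite semigroup has an isomorphic copy whose carrier is a set of natural numbers,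
  so quantifying over such copies loses nothing.\<close>

definition finite_image :: "'a sgrp \<Rightarrow> nat sgrp \<Rightarrow> ('a \<Rightarrow> nat) \<Rightarrow> bool" where
  "finite_image S T \<phi> \<longleftrightarrow> is_semigroup T \<and> finite (carrier T) \<and> \<phi> \<in> sgrp_epi S T"

definition residually_finite :: "'a sgrp \<Rightarrow> bool" where
  "residually_finite S \<longleftrightarrow>
     (\<forall>x\<in>carrier S. \<forall>y\<in>carrier S. x \<noteq> y \<longrightarrow> (\<exists>T \<phi>. finite_image S T \<phi> \<and> \<phi> x \<noteq> \<phi> y))"

text \<open>The depth function with respect to \<open>X\<close>. The minimum is over a nonempty set whenever \<open>S\<close> is
  residually finite and \<open>X\<close> is a finite subset of \<open>S\<close>.\<close>

definition depth :: "'a sgrp \<Rightarrow> 'a set \<Rightarrow> nat \<Rightarrow> nat" where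
  "depth S X n = (LEAST k. \<forall>u\<in>words X. \<forall>v\<in>words X.
     length u \<le> n \<and> length v \<le> n \<and> word_val S u \<noteq> word_val S v \<longrightarrow>
     (\<exists>T \<phi>. finite_image S T \<phi> \<and> card (carrier T) \<le> k \<and>
        \<phi> (word_val S u) \<noteq> \<phi> (word_val S v)))"


section \<open>Recursive functions and sets\<close>

datatype recf =
    Zero
  | Succ
  | Proj nat
  | Comp recf "recf list"
  | PrimRec recf recf
  | Mu recf

text \<open>\<open>rec_eval r xs y\<close>: the partial recursive function denoted by \<open>r\<close> is defined at \<open>xs\<close>
  and has value \<open>y\<close> there. The recursion and minimization variable is the first argument.\<close>

inductive rec_eval :: "recf \<Rightarrow> nat list \<Rightarrow> nat \<Rightarrow> bool" where
  zero: "rec_eval Zero xs 0"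
| succ: "rec_eval Succ [x] (Suc x)"
| proj: "i < length xs \<Longrightarrow> rec_eval (Proj i) xs (xs ! i)"
| comp: "list_all2 (\<lambda>g y. rec_eval g xs y) gs ys \<Longrightarrow> rec_eval h ys z \<Longrightarrow>
    rec_eval (Comp h gs) xs z"
| primrec_0: "rec_eval f xs y \<Longrightarrow> rec_eval (PrimRec f g) (0 # xs) y"
| primrec_Suc: "rec_eval (PrimRec f g) (n # xs) y \<Longrightarrow> rec_eval g (n # y # xs) z \<Longrightarrow>
    rec_eval (PrimRec f g) (Suc n # xs) z"
| mu: "rec_eval f (n # xs) 0 \<Longrightarrow> (\<forall>m<n. \<exists>y. rec_eval f (m # xs) (Suc y)) \<Longrightarrow>
    rec_eval (Mu f) xs n"

definition recursive_fun :: "(nat \<Rightarrow> nat) \<Rightarrow> bool" where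
  "recursive_fun f \<longleftrightarrow> (\<exists>r. \<forall>n y. rec_eval r [n] y \<longleftrightarrow> y = f n)"

definition recursive_set :: "nat set \<Rightarrow> bool" where
  "recursive_set Z \<longleftrightarrow> recursive_fun (\<lambda>n. if n \<in> Z then 1 else 0)"


section \<open>Polynomial-time many-one reductions\<close>

text \<open>Deterministic Turing machines with finitely many two-way infinite tapes. The tape alphabet is
  \<open>{..<symbols M}\<close>, with \<open>0\<close> as the blank. The start state is \<open>0\<close>, the working states
  are \<open>{..<states M}\<close>, and \<open>states M\<close> itself is the halting state. The input is on the first
  tape and the output on the last one.\<close>

datatype move = Left | Stay | Right

record tm =
  tapes :: nat
  states :: nat
  symbols :: nat
  delta :: "nat \<Rightarrow> nat list \<Rightarrow> nat \<times> (nat \<times> move) list"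

definition wf_tm :: "tm \<Rightarrow> bool" where
  "wf_tm M \<longleftrightarrow> tapes M \<ge> 1 \<and> symbols M \<ge> 2 \<and>
     (\<forall>q<states M. \<forall>ss. length ss = tapes M \<and> set ss \<subseteq> {..<symbols M} \<longrightarrow>
        fst (delta M q ss) \<le> states M \<and> length (snd (delta M q ss)) = tapes M \<and>
        fst ` set (snd (delta M q ss)) \<subseteq> {..<symbols M})"

text \<open>A tape consists of its contents and its head position.\<close>

type_synonym tape = "(int \<Rightarrow> nat) \<times> int"

fun tape_read :: "tape \<Rightarrow> nat" where
  "tape_read (c, i) = c i"

fun tape_act :: "tape \<Rightarrow> nat \<times> move \<Rightarrow> tape" where
  "tape_act (c, i) (s, m) =
     (c(i := s), case m of Left \<Rightarrow> i - 1 | Stay \<Rightarrow> i | Right \<Rightarrow> i + 1)"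

fun tm_step :: "tm \<Rightarrow> nat \<times> tape list \<Rightarrow> nat \<times> tape list" where
  "tm_step M (q, ts) =
     (if q < states M
      then (case delta M q (map tape_read ts) of (q', as) \<Rightarrow> (q', map2 tape_act ts as))
      else (q, ts))"

definition tape_contents :: "nat list \<Rightarrow> int \<Rightarrow> nat" where
  "tape_contents w = (\<lambda>i. if 0 \<le> i \<and> i < int (length w) then w ! nat i else 0)"

definition tm_init :: "tm \<Rightarrow> nat list \<Rightarrow> nat \<times> tape list" where
  "tm_init M w =
     (0, (tape_contents w, 0) # replicate (tapes M - 1) (tape_contents [], 0))"

definition tm_computes :: "tm \<Rightarrow> nat list \<Rightarrow> nat list \<Rightarrow> nat \<Rightarrow> bool" where
  "tm_computes M w v t \<longleftrightarrow> 0 \<notin> set v \<and>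
     (\<exists>ts. (tm_step M ^^ t) (tm_init M w) = (states M, ts) \<and> fst (last ts) = tape_contents v)"

definition polytime_computable ::
    "'i set \<Rightarrow> ('i \<Rightarrow> nat list) \<Rightarrow> ('j \<Rightarrow> nat list) \<Rightarrow> ('i \<Rightarrow> 'j) \<Rightarrow> bool" where
  "polytime_computable I enc enc' g \<longleftrightarrow>
     (\<exists>M (p :: nat poly). wf_tm M \<and>
        (\<forall>x\<in>I. set (enc x) \<subseteq> {1..<symbols M} \<and>
           (\<exists>t \<le> poly p (length (enc x)). tm_computes M (enc x) (enc' (g x)) t)))"

record 'i decision_problem =
  instances :: "'i set"
  yes_instances :: "'i set"
  encoding :: "'i \<Rightarrow> nat list"

definition polytime_reducible :: "'i decision_problem \<Rightarrow> 'j decision_problem \<Rightarrow> bool" where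
  "polytime_reducible P Q \<longleftrightarrow>
     (\<exists>g. (\<forall>x\<in>instances P. g x \<in> instances Q \<and> (x \<in> yes_instances P \<longleftrightarrow> g x \<in> yes_instances Q)) \<and>
          polytime_computable (instances P) (encoding P) (encoding Q) g)"

definition unary_membership :: "nat set \<Rightarrow> nat decision_problem" where
  "unary_membership Z =
     \<lparr>instances = UNIV, yes_instances = Z, encoding = (\<lambda>n. replicate n 1)\<rparr>"

text \<open>The word problem over an enumerated generating set \<open>xs\<close>: the letter \<open>i\<close> stands for
  \<open>xs ! i\<close> and is written on the tape as the symbol \<open>i + 2\<close>; the symbol \<open>1\<close> separates
  the two words.\<close>

definition word_problem :: "'a sgrp \<Rightarrow> 'a list \<Rightarrow> (nat list \<times> nat list) decision_problem" where
  "word_problem S xs =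
     \<lparr>instances = words {..<length xs} \<times> words {..<length xs},
      yes_instances = {(u, v) \<in> words {..<length xs} \<times> words {..<length xs}.
        word_val S (map ((!) xs) u) = word_val S (map ((!) xs) v)},
      encoding = (\<lambda>(u, v). map (\<lambda>i. i + 2) u @ [1] @ map (\<lambda>i. i + 2) v)\<rparr>"

text \<open>Up to polynomial-time equivalence the word problem does not depend on the finite generating
  set or on its enumeration, so the condition is imposed for all of them.\<close>

definition word_problem_as_hard_as :: "'a sgrp \<Rightarrow> nat set \<Rightarrow> bool" where
  "word_problem_as_hard_as S Z \<longleftrightarrow>
     (\<forall>xs. distinct xs \<and> generates S (set xs) \<longrightarrow>
        polytime_reducible (unary_membership Z) (word_problem S xs))"

end

theory Submission
  imports Defs
begin

text \<open>
The semigroup simulates a program, and its elements are either zero or have finite congruence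
classes of words.  Such a semigroup is residually finite for a trivial reason: if \<open>x\<close> is nonzero,
only finitely many elements divide \<open>x\<close>, the non-divisors of \<open>x\<close> form an ideal, and the Rees quotient
by that ideal is finite and separates \<open>x\<close> from every other element
(\<open>residually_finite_presented\<close>).

Depth is forced up by pumping.  Suppose a short word equals \<open>u b^m v\<close> with \<open>m > f n\<close>, is nonzero, but
\<open>u b^k v = 0\<close> for every \<open>k > m\<close>.  In a finite quotient with fewer than \<open>m\<close> elements the powers of
\<open>b\<close> repeat up to exponent \<open>m\<close>, so \<open>b^m\<close> equals a higher power of \<open>b\<close> there and the image of the word
is zero (\<open>finite_image_pump\<close>).  A program that computes \<open>f n\<close>, writes \<open>f n + 1\<close> in unary into two
registers and dies unless the first is at most the second produces such words.  Likewise a program that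
computes the characteristic function of \<open>Z\<close> and dies exactly on members makes a word of length
linear in \<open>n\<close> zero exactly when \<open>n \<in> Z\<close>; this yields the reduction, since a Turing machine writes
down that word in linear time over any generating set.

The rewriting rules act on words \<open>g^k q w\<close>: garbage letters, one control letter, and a word of
register letters in which letters of different registers commute, so that \<open>w\<close> is a tuple of
stacks.  Adjacent letters that do not fit this shape give zero.  A decrement turns the consumed letter
into garbage, so no rule with a nonzero right-hand side shortens a word.  The rules are
deterministic, hence confluent up to commutation; if every computation halts, each nonzero class
therefore consists of words no longer than its terminal configuration, and is finite
(\<open>finite_nonzero_class\<close>).

Every computation must halt, and this includes computations started from arbitrary garbage
configurations, although general recursive functions need unbounded search.  The remedy
is Kleene's normal form: for \<open>t = 1, 2, \<dots>\<close> the program evaluates \<open>f n\<close> from scratch with each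
minimization cut off at \<open>t\<close>, and stops as soon as an evaluation succeeds.  Bounded evaluation uses only
loops whose number of iterations is fixed on entry, so it ends from any register contents; and
since \<open>f\<close> is total, whatever value the input register has by then, large enough \<open>t\<close> succeed
(\<open>search_terminates\<close>).
\<close>

section \<open>Words and presentations\<close>

lemma words_iff: "w \<in> words X \<longleftrightarrow> w \<noteq> [] \<and> set w \<subseteq> X"
  by (auto simp: words_def)

lemma words_append: "u \<in> words X \<Longrightarrow> v \<in> words X \<Longrightarrow> u @ v \<in> words X"
  by (auto simp: words_def)

lemma pres_cong_words:
  assumes "R \<subseteq> words X \<times> words X" "pres_cong X R u v"
  shows "u \<in> words X" "v \<in> words X"
proof -
  from assms(2) have "u \<in> words X \<and> v \<in> words X"
    by induction (use assms(1) words_append in auto)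
  then show "u \<in> words X" "v \<in> words X" by auto
qed

lemma pres_cong_context:
  assumes "pres_cong X R u v" "set x \<subseteq> X" "set y \<subseteq> X"
  shows "pres_cong X R (x @ u @ y) (x @ v @ y)"
proof -
  have r: "a = [] \<or> pres_cong X R a a" if "set a \<subseteq> X" for a
    using that by (auto simp: words_def intro!: pres_cong.refl)
  have "pres_cong X R (u @ y) (v @ y)"
    using r[OF assms(3)] assms(1) by (metis append_Nil2 pres_cong.mult)
  then show ?thesis using r[OF assms(2)] by (metis append_Nil pres_cong.mult)
qed

lemma pres_cong_map:
  assumes "pres_cong X R u v"
  shows "pres_cong (e ` X) (map_prod (map e) (map e) ` R) (map e u) (map e v)"
  using assms
proof induction
  case (rel u v)
  then show ?case by (intro pres_cong.rel) force
next
  case (refl u)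
  then show ?case by (intro pres_cong.refl) (auto simp: words_def)
next
  case (mult u v u' v')
  then show ?case by (simp add: pres_cong.mult)
qed (blast intro: pres_cong.sym pres_cong.trans)+

definition word_class :: "'g set \<Rightarrow> ('g list \<times> 'g list) set \<Rightarrow> 'g list \<Rightarrow> 'g list set" where
  "word_class X R w = {v. pres_cong X R w v}"

lemma carrier_presented: "carrier (presented X R) = word_class X R ` words X"
  by (auto simp: presented_def word_class_def quotient_def)

lemma word_class_eq_iff:
  assumes "u \<in> words X"
  shows "word_class X R u = word_class X R v \<longleftrightarrow> pres_cong X R u v"
  using assms unfolding word_class_def
  by (auto intro: pres_cong.refl pres_cong.sym pres_cong.trans)

lemma mult_presented:
  assumes "u \<in> words X" "v \<in> words X"
  shows "sgrp.mult (presented X R) (word_class X R u) (word_class X R v) = word_class X R (u @ v)"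
  using assms unfolding presented_def word_class_def
  by (auto intro: pres_cong.intros)

lemma is_semigroup_presented: "is_semigroup (presented X R)"
  unfolding is_semigroup_def carrier_presented
  by (auto simp: mult_presented words_append)

lemma word_val_presented:
  assumes "ws \<noteq> []" "set ws \<subseteq> words X"
  shows "word_val (presented X R) (map (word_class X R) ws) = word_class X R (concat ws) \<and> concat ws \<in> words X"
  using assms
proof (induction ws rule: list_nonempty_induct)
  case (single x)
  then show ?case by simp
next
  case (cons x xs)
  then obtain y ys where "xs = y # ys" by (cases xs) auto
  with cons show ?case
    by (auto simp: mult_presented words_append)
qed

lemma word_val_in_carrier:
  assumes "is_semigroup S" "w \<noteq> []" "set w \<subseteq> carrier S"
  shows "word_val S w \<in> carrier S"
  using assms(2,3)
proof (induction w rule: list_nonempty_induct)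
  case (cons x xs)
  then obtain y ys where "xs = y # ys" by (cases xs) auto
  with cons assms(1) show ?case by (auto simp: is_semigroup_def)
qed auto

lemma word_val_append:
  assumes S: "is_semigroup S" and "u \<noteq> []" "v \<noteq> []" "set u \<subseteq> carrier S" "set v \<subseteq> carrier S"
  shows "word_val S (u @ v) = sgrp.mult S (word_val S u) (word_val S v)"
  using assms(2,4)
proof (induction u rule: list_nonempty_induct)
  case (single x)
  obtain y ys where "v = y # ys" using assms(3) by (cases v) auto
  then show ?case by simp
next
  case (cons x xs)
  then obtain y ys where "xs = y # ys" by (cases xs) auto
  moreover have "word_val S xs \<in> carrier S" "word_val S v \<in> carrier S"
    using cons assms by (auto intro!: word_val_in_carrier)
  ultimately show ?case using cons S by (auto simp: is_semigroup_def)
qed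

lemma word_val_hom:
  assumes "is_semigroup S" "h \<in> sgrp_hom S T" "w \<noteq> []" "set w \<subseteq> carrier S"
  shows "h (word_val S w) = word_val T (map h w)"
  using assms(3,4)
proof (induction w rule: list_nonempty_induct)
  case (cons x xs)
  then obtain y ys where "xs = y # ys" by (cases xs) auto
  with cons assms(1,2) word_val_in_carrier[OF assms(1), of xs] show ?case
    by (auto simp: sgrp_hom_def)
qed auto

lemma finitely_presented_presented:
  fixes X :: "nat set"
  assumes "finite X" "finite R" "R \<subseteq> words X \<times> words X"
  shows "finitely_presented (presented X R)"
proof -
  have "id \<in> sgrp_iso (presented X R) (presented X R)"
    by (simp add: sgrp_iso_def sgrp_hom_def)
  then show ?thesis unfolding finitely_presented_def
    using is_semigroup_presented assms by blast
qed

text \<open>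
A map into the natural numbers whose kernel is a congruence carries the multiplication to
its range; this avoids building quotients as sets of classes.
\<close>

section \<open>Residual finiteness and depth\<close>

lemma finite_image_of_kernel:
  fixes \<phi> :: "'a \<Rightarrow> nat"
  assumes S: "is_semigroup S"
    and fin: "finite (\<phi> ` carrier S)"
    and ker: "\<And>x x' y y'. \<lbrakk>x \<in> carrier S; x' \<in> carrier S; y \<in> carrier S; y' \<in> carrier S;
       \<phi> x = \<phi> x'; \<phi> y = \<phi> y'\<rbrakk> \<Longrightarrow> \<phi> (sgrp.mult S x y) = \<phi> (sgrp.mult S x' y')"
  shows "\<exists>T. finite_image S T \<phi>"
proof -
  define rep where "rep = inv_into (carrier S) \<phi>"
  define T where "T = \<lparr>carrier = \<phi> ` carrier S, mult = (\<lambda>i j. \<phi> (sgrp.mult S (rep i) (rep j)))\<rparr>"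
  have rep: "rep (\<phi> x) \<in> carrier S" "\<phi> (rep (\<phi> x)) = \<phi> x" if "x \<in> carrier S" for x
    using that unfolding rep_def by (auto intro: inv_into_into f_inv_into_f)
  have clo: "sgrp.mult S x y \<in> carrier S" if "x \<in> carrier S" "y \<in> carrier S" for x y
    using S that by (auto simp: is_semigroup_def)
  have hom: "sgrp.mult T (\<phi> x) (\<phi> y) = \<phi> (sgrp.mult S x y)" if "x \<in> carrier S" "y \<in> carrier S" for x y
    using that rep by (auto simp: T_def intro!: ker)
  have cT: "carrier T = \<phi> ` carrier S" by (simp add: T_def)
  have "is_semigroup T"
    unfolding is_semigroup_def cT
    using S by (auto simp: hom clo is_semigroup_def)
  moreover have "\<phi> \<in> sgrp_epi S T"
    by (auto simp: sgrp_epi_def sgrp_hom_def cT hom)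
  ultimately show ?thesis
    using fin by (auto simp: finite_image_def cT)
qed

text \<open>
Divisors of \<open>w\<close> in the semigroup are the classes of factors of words congruent to \<open>w\<close>, so there are
finitely many of them.  Their complement is an ideal; collapsing it to a point gives a finite quotient in
which the class of \<open>w\<close> stays alone.  Of two distinct elements at least one is not the class of
\<open>z\<close>, and it plays the role of \<open>w\<close>.
\<close>

lemma residually_finite_presented:
  fixes X :: "'g set"
  assumes "R \<subseteq> words X \<times> words X"
    and fin: "\<And>w. w \<in> words X \<Longrightarrow> \<not> pres_cong X R w z \<Longrightarrow> finite {v. pres_cong X R w v}"
  shows "residually_finite (presented X R)"
proof -
  let ?S = "presented X R" and ?c = "word_class X R"
  have sep: "\<exists>T \<phi>. finite_image ?S T \<phi> \<and> \<phi> (?c w) \<noteq> \<phi> y"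
    if w: "w \<in> words X" "\<not> pres_cong X R w z" and y: "?c w \<noteq> y" for w y
  proof -
    define D where "D = {?c u |u. u \<in> words X \<and> (\<exists>x y. pres_cong X R w (x @ u @ y))}"
    have "D \<subseteq> ?c ` (\<Union>v \<in> {v. pres_cong X R w v}. {u. set u \<subseteq> set v \<and> length u \<le> length v})"
      by (fastforce simp: D_def)
    moreover have "finite (\<Union>v \<in> {v. pres_cong X R w v}. {u. set u \<subseteq> set v \<and> length u \<le> length v})"
      using fin[OF w] by (intro finite_UN_I finite_lists_length_le) auto
    ultimately have "finite D" using finite_surj by blast
    then obtain e :: "'g list set \<Rightarrow> nat" where e: "inj_on e D"
      using finite_imp_inj_to_nat_seg by metis
    define \<phi> where "\<phi> A = (if A \<in> D then Suc (e A) else 0)" for A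
    have wD: "?c w \<in> D"
    proof -
      have "pres_cong X R w ([] @ w @ [])" using w by (simp add: pres_cong.refl)
      then show ?thesis using w unfolding D_def by blast
    qed
    \<comment> \<open>The complement of \<open>D\<close> is an ideal.\<close>
    have factor: "?c u \<in> D \<and> ?c v \<in> D"
      if uv: "u \<in> words X" "v \<in> words X" "?c (u @ v) \<in> D" for u v
    proof -
      from uv(3) obtain p x y where p: "?c (u @ v) = ?c p" "pres_cong X R w (x @ p @ y)" "p \<in> words X"
        by (auto simp: D_def)
      then have pc: "pres_cong X R p (u @ v)" using word_class_eq_iff by metis
      have "set x \<subseteq> X" "set y \<subseteq> X"
        using pres_cong_words(2)[OF assms(1) p(2)] by (auto simp: words_def)
      then have "pres_cong X R w (x @ (u @ v) @ y)"
        by (rule pres_cong.trans[OF p(2) pres_cong_context[OF pc]])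
      then have "pres_cong X R w (x @ u @ (v @ y))" "pres_cong X R w ((x @ u) @ v @ y)" by simp_all
      then show ?thesis using uv(1,2) unfolding D_def by blast
    qed
    have "\<exists>T. finite_image ?S T \<phi>"
    proof (rule finite_image_of_kernel[OF is_semigroup_presented])
      have "\<phi> ` carrier ?S \<subseteq> insert 0 (Suc ` e ` D)" by (auto simp: \<phi>_def)
      then show "finite (\<phi> ` carrier ?S)" using \<open>finite D\<close> finite_subset by blast
    next
      fix x x' y y' assume A: "x \<in> carrier ?S" "x' \<in> carrier ?S" "y \<in> carrier ?S" "y' \<in> carrier ?S"
        and eq: "\<phi> x = \<phi> x'" "\<phi> y = \<phi> y'"
      have eqD: "a = b \<or> a \<notin> D \<and> b \<notin> D" if "\<phi> a = \<phi> b" for a b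
        using that e by (auto simp: \<phi>_def split: if_splits dest: inj_onD)
      have nD: "sgrp.mult ?S a b \<notin> D" if "a \<in> carrier ?S" "b \<in> carrier ?S" "a \<notin> D \<or> b \<notin> D" for a b
        using that factor unfolding carrier_presented by (auto simp: mult_presented)
      show "\<phi> (sgrp.mult ?S x y) = \<phi> (sgrp.mult ?S x' y')"
      proof (cases "x = x' \<and> y = y'")
        case False
        with eqD[OF eq(1)] eqD[OF eq(2)] A nD have "sgrp.mult ?S x y \<notin> D" "sgrp.mult ?S x' y' \<notin> D"
          by blast+
        then show ?thesis by (simp add: \<phi>_def)
      qed auto
    qed
    moreover have "\<phi> (?c w) \<noteq> \<phi> y"
      using wD y e by (auto simp: \<phi>_def dest: inj_onD)
    ultimately show ?thesis by blast
  qed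
  show ?thesis
    unfolding residually_finite_def carrier_presented
  proof (intro ballI impI; elim imageE; hypsubst)
    fix u v assume uv: "?c u \<noteq> ?c v" "u \<in> words X" "v \<in> words X" 
    then have "\<not> pres_cong X R u z \<or> \<not> pres_cong X R v z"
      by (meson word_class_eq_iff pres_cong.sym pres_cong.trans)
    then show "\<exists>T \<phi>. finite_image ?S T \<phi> \<and> \<phi> (?c u) \<noteq> \<phi> (?c v)"
      using sep[of u "?c v"] sep[of v "?c u"] uv by metis
  qed
qed

text \<open>
Pigeonhole on \<open>b, b^2, \<dots>, b^m\<close>: a coincidence \<open>b^i = b^j\<close> with \<open>i < j \<le> m\<close> can be multiplied by
\<open>b^(m - i)\<close>.
\<close>

lemma pow_pump:
  assumes T: "is_semigroup T" "finite (carrier T)" and b: "b \<in> carrier T" and m: "card (carrier T) < m"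
  shows "\<exists>m'>m. word_val T (replicate m' b) = word_val T (replicate m b)"
proof -
  let ?p = "\<lambda>i. word_val T (replicate i b)"
  have c: "?p i \<in> carrier T" if "i > 0" for i
    using word_val_in_carrier[OF T(1), of "replicate i b"] that b by auto
  have S: "?p (Suc i) = sgrp.mult T b (?p i)" if "i > 0" for i
    using that by (cases i) auto
  have "\<not> inj_on ?p {1..m}"
    using card_inj_on_le[of ?p "{1..m}" "carrier T"] c T(2) m by fastforce
  then obtain i j where ij: "i < j" "0 < i" "j \<le> m" "?p i = ?p j"
    by (auto simp: inj_on_def) (metis linorder_neqE_nat less_eq_Suc_le)
  have "?p (i + k) = ?p (j + k)" for k
    by (induction k) (use ij S in auto)
  from this[of "m - i"] ij have "?p (m + (j - i)) = ?p m"
    by (simp add: algebra_simps)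
  then show ?thesis using ij by (intro exI[of _ "m + (j - i)"]) auto
qed

text \<open>
The minimum in the definition of the depth is over a nonempty set: only finitely many
pairs of words have to be separated, and each has a separating finite image.
\<close>

lemma depth_bound_attained:
  assumes S: "is_semigroup S" "residually_finite S" and Y: "finite Y" "Y \<subseteq> carrier S"
  shows "\<forall>u\<in>words Y. \<forall>v\<in>words Y.
     length u \<le> n \<and> length v \<le> n \<and> word_val S u \<noteq> word_val S v \<longrightarrow>
     (\<exists>T \<phi>. finite_image S T \<phi> \<and> card (carrier T) \<le> depth S Y n \<and>
        \<phi> (word_val S u) \<noteq> \<phi> (word_val S v))"
proof -
  let ?sep = "\<lambda>u v T \<phi>. finite_image S T \<phi> \<and> \<phi> (word_val S u) \<noteq> \<phi> (word_val S v)"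
  let ?W = "{u \<in> words Y. length u \<le> n}"
  have "?W \<subseteq> {u. set u \<subseteq> Y \<and> length u \<le> n}" by (auto simp: words_def)
  then have W: "finite ?W"
    using finite_lists_length_le[OF Y(1)] finite_subset by blast
  have "\<exists>k. \<forall>u v. p = (u, v) \<longrightarrow> u \<in> words Y \<longrightarrow> v \<in> words Y \<longrightarrow> word_val S u \<noteq> word_val S v \<longrightarrow>
      (\<exists>T \<phi>. ?sep u v T \<phi> \<and> card (carrier T) \<le> k)" for p
  proof -
    obtain u v where p: "p = (u, v)" by fastforce
    show ?thesis
    proof (cases "u \<in> words Y \<and> v \<in> words Y \<and> word_val S u \<noteq> word_val S v")
      case True
      then have "word_val S u \<in> carrier S" "word_val S v \<in> carrier S"
        using Y(2) by (auto simp: words_def intro!: word_val_in_carrier[OF S(1)])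
      then show ?thesis using S(2) True p unfolding residually_finite_def by blast
    qed (use p in blast)
  qed
  then obtain N where N: "\<exists>T \<phi>. ?sep u v T \<phi> \<and> card (carrier T) \<le> N (u, v)"
    if "u \<in> words Y" "v \<in> words Y" "word_val S u \<noteq> word_val S v" for u v
    by metis
  define k where "k = Max (insert 0 (N ` (?W \<times> ?W)))"
  have k: "N (u, v) \<le> k" if "u \<in> ?W" "v \<in> ?W" for u v
    unfolding k_def using that W by (intro Max_ge) auto
  have "\<forall>u\<in>words Y. \<forall>v\<in>words Y.
     length u \<le> n \<and> length v \<le> n \<and> word_val S u \<noteq> word_val S v \<longrightarrow>
     (\<exists>T \<phi>. finite_image S T \<phi> \<and> card (carrier T) \<le> k \<and>
        \<phi> (word_val S u) \<noteq> \<phi> (word_val S v))"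
  proof (intro ballI impI)
    fix u v assume uv: "u \<in> words Y" "v \<in> words Y"
      "length u \<le> n \<and> length v \<le> n \<and> word_val S u \<noteq> word_val S v"
    with N obtain T \<phi> where "?sep u v T \<phi>" "card (carrier T) \<le> N (u, v)" by blast
    moreover have "N (u, v) \<le> k" using k uv by simp
    ultimately show "\<exists>T \<phi>. finite_image S T \<phi> \<and> card (carrier T) \<le> k \<and>
        \<phi> (word_val S u) \<noteq> \<phi> (word_val S v)" by (meson le_trans)
  qed
  from LeastI[where P = "\<lambda>k. \<forall>u\<in>words Y. \<forall>v\<in>words Y.
     length u \<le> n \<and> length v \<le> n \<and> word_val S u \<noteq> word_val S v \<longrightarrow>
     (\<exists>T \<phi>. finite_image S T \<phi> \<and> card (carrier T) \<le> k \<and>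
        \<phi> (word_val S u) \<noteq> \<phi> (word_val S v))", OF this]
  show ?thesis unfolding depth_def .
qed

text \<open>
A transducer from \<open>1^n\<close> to \<open>pre @ blk^n @ post\<close>.  States below \<open>length pre\<close> write \<open>pre\<close>; state \<open>a\<close>
inspects the input, and on \<open>1\<close> advances it and writes the first letter of \<open>blk\<close>; the states
strictly between \<open>a\<close> and \<open>a + b\<close> write the rest of \<open>blk\<close> and return to \<open>a\<close>; the remaining states
write \<open>post\<close>.  This layout presupposes \<open>blk \<noteq> []\<close>.
\<close>

section \<open>Reductions from unary membership\<close>

definition block_tm :: "nat \<Rightarrow> nat list \<Rightarrow> nat list \<Rightarrow> nat list \<Rightarrow> tm" where
  "block_tm k pre blk post = (let a = length pre; b = length blk in
     \<lparr>tapes = 2, states = a + b + length post, symbols = k,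
      delta = (\<lambda>q ss.
        if q < a then (Suc q, [(ss ! 0, Stay), (pre ! q, Right)])
        else if q = a \<and> ss ! 0 \<noteq> 1 then (a + b, [(ss ! 0, Stay), (ss ! 1, Stay)])
        else if q < a + b then
          (if Suc q = a + b then a else Suc q,
           [(ss ! 0, if q = a then Right else Stay), (blk ! (q - a), Right)])
        else (Suc q, [(ss ! 0, Stay), (post ! (q - a - b), Right)]))\<rparr>)"

lemma wf_block_tm:
  assumes "k \<ge> 2" "blk \<noteq> []" "set pre \<union> set blk \<union> set post \<subseteq> {1..<k}"
  shows "wf_tm (block_tm k pre blk post)"
proof -
  have "ss ! 0 < k \<and> ss ! Suc 0 < k" if "length ss = 2" "set ss \<subseteq> {..<k}" for ss :: "nat list"
    using that by (metis lessThan_iff less_2_cases_iff nth_mem subsetD One_nat_def)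
  moreover have "xs ! i < k" if "set xs \<subseteq> {1..<k}" "i < length xs" for xs i
    using that nth_mem by fastforce
  ultimately show ?thesis
    using assms by (auto simp: wf_tm_def block_tm_def Let_def Suc_le_eq)
qed

lemma tape_contents_snoc: "(tape_contents v)(int (length v) := s) = tape_contents (v @ [s])"
  by (auto simp: tape_contents_def nth_append fun_eq_iff nat_eq_iff)

text \<open>
One step per written letter, plus the step that recognizes the end of the input.
\<close>

lemma block_tm_computes:
  fixes k n :: nat and pre blk post :: "nat list"
  assumes pos: "set pre \<union> set blk \<union> set post \<subseteq> {1..<k}" and blk: "blk \<noteq> []"
  shows "tm_computes (block_tm k pre blk post) (replicate n 1)
    (pre @ concat (replicate n blk) @ post) (length pre + n * length blk + 1 + length post)"
proof -
  define M where "M = block_tm k pre blk post"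
  define a b c where "a = length pre" and "b = length blk" and "c = length post"
  define cfg :: "nat \<Rightarrow> nat \<Rightarrow> nat list \<Rightarrow> nat \<times> tape list" where
    "cfg q i v = (q, [(tape_contents (replicate n 1), int i), (tape_contents v, int (length v))])" for q i v
  have b: "b > 0" using blk by (simp add: b_def)
  have st: "states M = a + b + c" by (simp add: M_def block_tm_def Let_def a_def b_def c_def)
  have upd: "(tape_contents w)(x := tape_contents w x) = tape_contents w" for w x by simp
  have d: "delta M q ss =
      (if q < a then (Suc q, [(ss ! 0, Stay), (pre ! q, Right)])
        else if q = a \<and> ss ! 0 \<noteq> 1 then (a + b, [(ss ! 0, Stay), (ss ! 1, Stay)])
        else if q < a + b then
          (if Suc q = a + b then a else Suc q,
           [(ss ! 0, if q = a then Right else Stay), (blk ! (q - a), Right)])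
        else (Suc q, [(ss ! 0, Stay), (post ! (q - a - b), Right)]))" for q ss
    by (simp add: M_def block_tm_def Let_def a_def b_def)
  have one: "tape_contents (replicate n 1) (int i) = (if i < n then 1 else 0)" for i
    by (simp add: tape_contents_def)
  have s_pre: "tm_step M (cfg q i v) = cfg (Suc q) i (v @ [pre ! q])" if "q < a" for q i v
    using that by (simp add: cfg_def st d tape_contents_snoc)
  have s_blk: "tm_step M (cfg (a + j) i v) =
      cfg (if Suc j = b then a else a + Suc j) (if j = 0 then Suc i else i) (v @ [blk ! j])"
    if "j < b" "j = 0 \<Longrightarrow> i < n" for j i v
    using that by (auto simp: cfg_def st d tape_contents_snoc one[simplified])
  have s_end: "tm_step M (cfg a n v) = cfg (a + b) n v" for v
    using b by (simp add: cfg_def st d one[simplified] fun_upd_idem)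
  have s_post: "tm_step M (cfg (a + b + j) i v) = cfg (a + b + Suc j) i (v @ [post ! j])"
    if "j < c" for j i v
    using that b by (simp add: cfg_def st d tape_contents_snoc)
  have r_pre: "(tm_step M ^^ j) (cfg 0 0 []) = cfg j 0 (take j pre)" if "j \<le> a" for j
    using that by (induction j) (auto simp: s_pre take_Suc_conv_app_nth a_def)
  have r_blk: "(tm_step M ^^ Suc j) (cfg a i v) =
      cfg (if Suc j = b then a else a + Suc j) (Suc i) (v @ take (Suc j) blk)"
    if "j < b" "i < n" for j i v
    using that(1)
  proof (induction j)
    case 0
    then show ?case using s_blk[of 0 i v] that(2) by (auto simp: take_Suc_conv_app_nth b_def)
  next
    case (Suc j)
    then show ?case using s_blk[of "Suc j"]
      by (simp add: take_Suc_conv_app_nth b_def)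
  qed
  have r_blk': "(tm_step M ^^ b) (cfg a i v) = cfg a (Suc i) (v @ blk)" if "i < n" for i v
    using r_blk[of "b - 1" i v] b that by (simp add: b_def del: funpow.simps)
  have r_all: "(tm_step M ^^ (i * b)) (cfg a 0 v) = cfg a i (v @ concat (replicate i blk))" if "i \<le> n" for i v
    using that
  proof (induction i)
    case (Suc i)
    have "(tm_step M ^^ (Suc i * b)) (cfg a 0 v) = (tm_step M ^^ b) ((tm_step M ^^ (i * b)) (cfg a 0 v))"
      by (simp add: funpow_add)
    also have "\<dots> = cfg a (Suc i) (v @ concat (replicate i blk) @ blk)"
      using Suc r_blk' by simp
    also have "concat (replicate i blk) @ blk = concat (replicate (Suc i) blk)"
      by (induction i) auto
    finally show ?case .
  qed simp
  have r_post: "(tm_step M ^^ j) (cfg (a + b) i v) = cfg (a + b + j) i (v @ take j post)" if "j \<le> c" for j i v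
    using that by (induction j) (auto simp: s_post take_Suc_conv_app_nth c_def)
  have init: "tm_init M (replicate n 1) = cfg 0 0 []"
    by (simp add: tm_init_def cfg_def M_def block_tm_def Let_def)
  have time: "a + n * b + 1 + c = c + Suc (n * b + a)" by simp
  have "(tm_step M ^^ (a + n * b + 1 + c)) (cfg 0 0 []) =
      (tm_step M ^^ c) (tm_step M ((tm_step M ^^ (n * b)) ((tm_step M ^^ a) (cfg 0 0 []))))"
    unfolding time by (simp only: funpow_add funpow.simps comp_apply)
  also have "\<dots> = cfg (states M) n (pre @ concat (replicate n blk) @ post)"
    by (simp add: r_pre r_all s_end r_post st) (simp add: a_def c_def)
  finally have "(tm_step M ^^ (a + n * b + 1 + c)) (tm_init M (replicate n 1)) =
      cfg (states M) n (pre @ concat (replicate n blk) @ post)"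
    using init by simp
  moreover have "0 \<notin> set (pre @ concat (replicate n blk) @ post)"
    using pos by (auto simp: subset_iff)
  ultimately show ?thesis
    unfolding tm_computes_def M_def[symmetric] a_def[symmetric] b_def[symmetric] c_def[symmetric]
    by (auto simp: cfg_def)
qed

text \<open>
Over any generating set the fixed elements \<open>A, B, C, D\<close> have fixed representing words \<open>a, b, c, d\<close>, and
\<open>n\<close> is sent to the pair \<open>(a b^n c, d)\<close>.
\<close>

lemma word_problem_as_hard_asI:
  assumes S: "is_semigroup S"
    and ps: "\<And>p. p \<in> {A, B, C, D} \<Longrightarrow> p \<in> carrier S"
    and Z: "\<And>n. n \<in> Z \<longleftrightarrow> word_val S (A # replicate n B @ [C]) = D"
  shows "word_problem_as_hard_as S Z"
  unfolding word_problem_as_hard_as_def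
proof (intro allI impI)
  fix xs assume xs: "distinct xs \<and> generates S (set xs)"
  let ?v = "\<lambda>u. word_val S (map ((!) xs) u)" and ?I = "words {..<length xs}"
  have xsS: "set xs \<subseteq> carrier S" using xs by (simp add: generates_def)
  have ex: "\<exists>u\<in>?I. ?v u = p" if p: "p \<in> carrier S" for p
  proof -
    from p xs obtain w where w: "w \<in> words (set xs)" "word_val S w = p"
      unfolding generates_def by (metis imageE)
    have "\<exists>u. set u \<subseteq> {..<length xs} \<and> map ((!) xs) u = w" if "set w \<subseteq> set xs" for w
      using that
    proof (induction w)
      case (Cons x w)
      then obtain u i where "set u \<subseteq> {..<length xs}" "map ((!) xs) u = w" "i < length xs" "xs ! i = x"
        by (auto simp: in_set_conv_nth)
      then show ?case by (intro exI[of _ "i # u"]) auto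
    qed simp
    then show ?thesis using w by (fastforce simp: words_def)
  qed
  obtain a b c d where abcd: "a \<in> ?I" "b \<in> ?I" "c \<in> ?I" "d \<in> ?I"
    and v: "?v a = A" "?v b = B" "?v c = C" "?v d = D"
    using ex ps by (metis insertCI)
  have in_S: "set (map ((!) xs) u) \<subseteq> carrier S" if "u \<in> ?I" for u
    using that xsS nth_mem[of _ xs] by (fastforce simp: words_def)
  have app: "?v (u @ u') = sgrp.mult S (?v u) (?v u')" if "u \<in> ?I" "u' \<in> ?I" for u u'
    using word_val_append[OF S _ _ in_S[OF that(1)] in_S[OF that(2)]] that by (simp add: words_def)
  have word: "a @ concat (replicate n b) @ c \<in> ?I" for n
  proof -
    have "set (concat (replicate n b)) \<subseteq> set b" by (induction n) auto
    then show ?thesis using abcd by (auto simp: words_def)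
  qed
  have val: "?v (a @ concat (replicate n b) @ c) = word_val S (A # replicate n B @ [C])" for n
  proof -
    have "concat (replicate n b) @ c \<in> ?I \<and> ?v (concat (replicate n b) @ c) = word_val S (replicate n B @ [C])" for n
    proof (induction n)
      case (Suc n)
      obtain y ys where "replicate n B @ [C] = y # ys" by (cases "replicate n B @ [C]") auto
      with Suc show ?case
        using app[of b "concat (replicate n b) @ c"] abcd v by (auto simp: words_append)
    qed (use abcd v in auto)
    note this[of n]
    moreover obtain y ys where "replicate n B @ [C] = y # ys" by (cases "replicate n B @ [C]") auto
    ultimately show ?thesis using app[OF abcd(1), of "concat (replicate n b) @ c"] v by simp
  qed
  define g where "g n = (a @ concat (replicate n b) @ c, d)" for n
  define k where "k = length xs + 2"
  let ?s = "map (\<lambda>i. i + 2 :: nat)"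
  define M where "M = block_tm k (?s a) (?s b) (?s c @ [1] @ ?s d)"
  have sets: "set (?s a) \<union> set (?s b) \<union> set (?s c @ [1] @ ?s d) \<subseteq> {1..<k}"
    using abcd by (auto simp: k_def words_def)
  have "polytime_computable UNIV (\<lambda>n. replicate n 1) (encoding (word_problem S xs)) g"
    unfolding polytime_computable_def
  proof (intro exI conjI ballI)
    show "wf_tm M" unfolding M_def using abcd(2) by (intro wf_block_tm[OF _ _ sets]) (auto simp: k_def words_def)
    fix n :: nat
    show "set (replicate n 1) \<subseteq> {1..<symbols M}"
      by (auto simp: M_def block_tm_def k_def Let_def)
    let ?l = "length (?s a) + n * length (?s b) + 1 + length (?s c @ [1] @ ?s d)"
    show "?l \<le> poly [:length a + length c + length d + 2, length b:] (length (replicate n (1::nat)))"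
      by (simp add: algebra_simps)
    have "encoding (word_problem S xs) (g n) = ?s a @ concat (replicate n (?s b)) @ ?s c @ [1] @ ?s d"
      by (simp add: word_problem_def g_def map_concat)
    then show "tm_computes M (replicate n 1) (encoding (word_problem S xs) (g n)) ?l"
      unfolding M_def using block_tm_computes[OF sets] abcd(2) by (simp add: words_def)
  qed
  moreover have "fst (g n) \<in> ?I" "snd (g n) \<in> ?I" "n \<in> Z \<longleftrightarrow> ?v (fst (g n)) = ?v (snd (g n))" for n
    using word abcd val Z v by (auto simp: g_def)
  ultimately show "polytime_reducible (unary_membership Z) (word_problem S xs)"
    unfolding polytime_reducible_def
    by (intro exI[of _ g]) (auto simp: unary_membership_def word_problem_def split_beta mem_Times_iff)
qed

section \<open>Hard semigroups from presentations with zero\<close>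

lemma finite_image_pump:
  assumes S: "is_semigroup S" "finite_image S T \<phi>" "card (carrier T) < m"
    and ubv: "{u, b, v} \<subseteq> carrier S"
  shows "\<exists>m'>m. \<phi> (word_val S (u # replicate m' b @ [v])) = \<phi> (word_val S (u # replicate m b @ [v]))"
proof -
  have T: "is_semigroup T" "finite (carrier T)" and hom: "\<phi> \<in> sgrp_hom S T"
    using S(2) by (auto simp: finite_image_def sgrp_epi_def)
  have c: "\<phi> u \<in> carrier T" "\<phi> b \<in> carrier T" "\<phi> v \<in> carrier T"
    using hom ubv by (auto simp: sgrp_hom_def)
  have val: "\<phi> (word_val S (u # replicate k b @ [v])) =
      sgrp.mult T (\<phi> u) (sgrp.mult T (word_val T (replicate k (\<phi> b))) (\<phi> v))" if "k > 0" for k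
  proof -
    have "\<phi> (word_val S (u # replicate k b @ [v])) = word_val T ([\<phi> u] @ replicate k (\<phi> b) @ [\<phi> v])"
      using ubv by (subst word_val_hom[OF S(1) hom]) (auto simp: set_replicate_conv_if)
    then show ?thesis
      using c that by (simp add: word_val_append[OF T(1)] set_replicate_conv_if del: append_Cons)
  qed
  obtain m' where "m' > m" "word_val T (replicate m' (\<phi> b)) = word_val T (replicate m (\<phi> b))"
    using pow_pump[OF T c(2) S(3)] by blast
  then show ?thesis using val[of m] val[of m'] S(3) by (intro exI[of _ m']) auto
qed

text \<open>
The word \<open>P a^n Q\<close> is longer than \<open>n\<close>, while the depth at \<open>n\<close> sees only words of length at
most \<open>n\<close>.  With the elements \<open>a\<close>, \<open>P a\<close>, \<open>a Q\<close> and \<open>P a Q\<close> among the generators, it has length at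
most \<open>n\<close> for every \<open>n \<ge> 1\<close>.
\<close>

lemma hard_semigroup_of_nat_presentation:
  fixes X :: "nat set"
  assumes fX: "finite X" and fR: "finite R" and RX: "R \<subseteq> words X \<times> words X"
    and z: "z \<in> X"
    and fin: "\<And>w. w \<in> words X \<Longrightarrow> \<not> pres_cong X R w [z] \<Longrightarrow> finite {v. pres_cong X R w v}"
    and ws: "{P, a, Q, P', a', Q'} \<subseteq> words X"
    and nz: "\<And>n. \<not> pres_cong X R (P @ concat (replicate n a) @ Q) [z]"
    and pump: "\<And>n. \<exists>u b v m. {u, b, v} \<subseteq> words X \<and> m > f n \<and>
       pres_cong X R (P @ concat (replicate n a) @ Q) (u @ concat (replicate m b) @ v) \<and>
       (\<forall>m'>m. pres_cong X R (u @ concat (replicate m' b) @ v) [z])"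
    and mem: "\<And>n. n \<in> Z \<longleftrightarrow> pres_cong X R (P' @ concat (replicate n a') @ Q') [z]"
  shows "\<exists>S :: nat list set sgrp.
           finitely_presented S \<and> residually_finite S \<and>
           (\<exists>X. finite X \<and> generates S X \<and> (\<forall>n\<ge>1. depth S X n > f n)) \<and>
           word_problem_as_hard_as S Z"
proof (intro exI conjI)
  let ?S = "presented X R" and ?c = "word_class X R"
  let ?W = "(\<lambda>x. [x]) ` X \<union> {P @ a, a, a @ Q, P @ a @ Q}"
  let ?Y = "?c ` ?W"
  have S: "is_semigroup ?S" by (rule is_semigroup_presented)
  show "finitely_presented ?S" by (rule finitely_presented_presented[OF fX fR RX])
  show rf: "residually_finite ?S" by (rule residually_finite_presented[OF RX fin])
  show fY: "finite ?Y" using fX by simp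
  have zX: "[z] \<in> words X" using z by (simp add: words_def)
  have val: "word_val ?S (?c u # replicate n (?c b) @ [?c v]) = ?c (u @ concat (replicate n b) @ v)"
    and in_words: "u @ concat (replicate n b) @ v \<in> words X"
    if "{u, b, v} \<subseteq> words X" for u b v n
    using word_val_presented[of "u # replicate n b @ [v]" X R] that
    by (auto simp: set_replicate_conv_if split: if_splits)
  have W: "?W \<subseteq> words X" using ws by (auto simp: words_append) (simp add: words_def)
  then have YS: "?Y \<subseteq> carrier ?S" by (auto simp: carrier_presented)
  show "generates ?S ?Y"
    unfolding generates_def
  proof (intro conjI YS set_eqI iffI)
    fix y assume "y \<in> word_val ?S ` words ?Y"
    then obtain w where w: "y = word_val ?S w" "w \<in> words ?Y" by blast
    from w(2) have "w \<noteq> [] \<and> set w \<subseteq> ?Y" by (rule words_iff[THEN iffD1])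
    then have "w \<noteq> []" "set w \<subseteq> carrier ?S" using subset_trans[OF _ YS] by blast+
    then show "y \<in> carrier ?S" unfolding w(1) by (rule word_val_in_carrier[OF S])
  next
    fix y assume "y \<in> carrier ?S"
    then obtain w where w: "y = ?c w" "w \<in> words X" by (auto simp: carrier_presented)
    let ?w = "map (\<lambda>x. [x]) w"
    have "concat ?w = w" by (induction w) auto
    moreover have "?w \<noteq> []" "set ?w \<subseteq> words X" using w by (auto simp: words_def)
    ultimately have "word_val ?S (map ?c ?w) = y"
      using word_val_presented[of ?w X R] w by simp
    moreover have "map ?c ?w \<in> words ?Y" using w by (auto simp: words_def)
    ultimately show "y \<in> word_val ?S ` words ?Y" by blast
  qed
  show "\<forall>n\<ge>1. depth ?S ?Y n > f n"
  proof (intro allI impI)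
    fix n :: nat assume n: "n \<ge> 1"
    let ?x = "P @ concat (replicate n a) @ Q"
    have "\<exists>w\<in>words ?Y. length w \<le> n \<and> word_val ?S w = ?c ?x"
    proof (cases "n = 1")
      case True
      then show ?thesis by (intro bexI[of _ "[?c (P @ a @ Q)]"]) (auto simp: words_def)
    next
      case False
      then obtain k where k: "n = Suc (Suc k)" using n by (metis One_nat_def not0_implies_Suc not_one_le_zero)
      let ?w = "?c (P @ a) # replicate k (?c a) @ [?c (a @ Q)]"
      have "concat (replicate k a) @ a = a @ concat (replicate k a)"
        by (induction k) auto
      then have comm: "concat (replicate k a) @ a @ w = a @ concat (replicate k a) @ w" for w
        by (metis append.assoc)
      have "word_val ?S ?w = ?c ?x"
        using val[of "P @ a" a "a @ Q" k] ws k by (simp add: words_append comm)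
      moreover have "?w \<in> words ?Y"
        unfolding words_iff by (simp add: set_replicate_conv_if)
      ultimately show ?thesis using k by (intro bexI[of _ ?w]) auto
    qed
    then obtain w where w: "w \<in> words ?Y" "length w \<le> n" "word_val ?S w = ?c ?x" by blast
    have zY: "[?c [z]] \<in> words ?Y" using z by (auto simp: words_def)
    have xX: "?x \<in> words X" using in_words ws by simp
    have ne: "?c ?x \<noteq> ?c [z]" using nz word_class_eq_iff[OF xX] by metis
    have "\<exists>T \<phi>. finite_image ?S T \<phi> \<and> card (carrier T) \<le> depth ?S ?Y n \<and>
        \<phi> (?c ?x) \<noteq> \<phi> (?c [z])"
      using depth_bound_attained[OF S rf fY YS, of n] w zY ne n by fastforce
    then obtain T \<phi> where T: "finite_image ?S T \<phi>" "card (carrier T) \<le> depth ?S ?Y n"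
        "\<phi> (?c ?x) \<noteq> \<phi> (?c [z])" by blast
    obtain u b v m where ubv: "{u, b, v} \<subseteq> words X" and m: "m > f n"
      and eq: "pres_cong X R ?x (u @ concat (replicate m b) @ v)"
      and zero: "\<And>m'. m' > m \<Longrightarrow> pres_cong X R (u @ concat (replicate m' b) @ v) [z]"
      using pump by blast
    have "m \<le> card (carrier T)"
    proof (rule ccontr)
      assume "\<not> m \<le> card (carrier T)"
      then obtain m' where "m' > m" "\<phi> (word_val ?S (?c u # replicate m' (?c b) @ [?c v])) =
          \<phi> (word_val ?S (?c u # replicate m (?c b) @ [?c v]))"
        using finite_image_pump[OF S T(1), of m "?c u" "?c b" "?c v"] ubv
        by (auto simp: carrier_presented)
      moreover have "?c (u @ concat (replicate m' b) @ v) = ?c [z]"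
        using zero[OF \<open>m' > m\<close>] word_class_eq_iff[OF in_words[OF ubv]] by metis
      moreover have "?c (u @ concat (replicate m b) @ v) = ?c ?x"
        using eq word_class_eq_iff[OF xX] by metis
      ultimately show False using T(3) val[OF ubv] by simp
    qed
    then show "f n < depth ?S ?Y n" using T(2) m by linarith
  qed
  show "word_problem_as_hard_as ?S Z"
  proof (rule word_problem_as_hard_asI[OF S])
    show "p \<in> carrier ?S" if "p \<in> {?c P', ?c a', ?c Q', ?c [z]}" for p
      using that ws zX by (auto simp: carrier_presented)
    show "n \<in> Z \<longleftrightarrow> word_val ?S (?c P' # replicate n (?c a') @ [?c Q']) = ?c [z]" for n
      using val[of P' a' Q' n] in_words[of P' a' Q' n] ws mem word_class_eq_iff by (metis insert_subset)
  qed
qed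

text \<open>
Letters of an arbitrary type are renamed to natural numbers along an injection.
\<close>

lemma hard_semigroup_of_presentation:
  fixes X :: "'g set"
  assumes fX: "finite X" and fR: "finite R" and RX: "R \<subseteq> words X \<times> words X"
    and z: "z \<in> X"
    and fin: "\<And>w. w \<in> words X \<Longrightarrow> \<not> pres_cong X R w [z] \<Longrightarrow> finite {v. pres_cong X R w v}"
    and ws: "{P, a, Q, P', a', Q'} \<subseteq> words X"
    and nz: "\<And>n. \<not> pres_cong X R (P @ concat (replicate n a) @ Q) [z]"
    and pump: "\<And>n. \<exists>u b v m. {u, b, v} \<subseteq> words X \<and> m > f n \<and>
       pres_cong X R (P @ concat (replicate n a) @ Q) (u @ concat (replicate m b) @ v) \<and>
       (\<forall>m'>m. pres_cong X R (u @ concat (replicate m' b) @ v) [z])"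
    and mem: "\<And>n. n \<in> Z \<longleftrightarrow> pres_cong X R (P' @ concat (replicate n a') @ Q') [z]"
  shows "\<exists>S :: nat list set sgrp.
           finitely_presented S \<and> residually_finite S \<and>
           (\<exists>X. finite X \<and> generates S X \<and> (\<forall>n\<ge>1. depth S X n > f n)) \<and>
           word_problem_as_hard_as S Z"
proof -
  obtain e :: "'g \<Rightarrow> nat" where e: "inj_on e X"
    using finite_imp_inj_to_nat_seg[OF fX] by metis
  let ?e = "map e"
  let ?X = "e ` X" and ?R = "map_prod ?e ?e ` R"
  define e' where "e' = inv_into X e"
  have inv: "map e' (?e w) = w" if "w \<in> words X" for w
    using that e by (auto simp: words_def e'_def intro!: map_idI)
  have invX: "e' ` ?X = X" using e by (simp add: e'_def)
  have "map_prod (map e') (map e') ` ?R = (\<lambda>x. x) ` R"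
    unfolding image_image by (rule image_cong[OF HOL.refl]) (use RX inv in auto)
  then have invR: "map_prod (map e') (map e') ` ?R = R" by simp
  have eX: "?e w \<in> words ?X" if "w \<in> words X" for w
    using that by (auto simp: words_def)
  have surj: "\<exists>w\<in>words X. v = ?e w" if "v \<in> words ?X" for v
  proof (intro bexI)
    show "map e' v \<in> words X" using that by (auto simp: words_def e'_def intro!: inv_into_into)
    show "v = ?e (map e' v)"
      using that by (auto simp: words_def e'_def f_inv_into_f intro!: map_idI[symmetric])
  qed
  have RX': "?R \<subseteq> words ?X \<times> words ?X" using RX eX by fastforce
  have pc: "pres_cong ?X ?R (?e u) (?e v) \<longleftrightarrow> pres_cong X R u v" if "u \<in> words X" "v \<in> words X" for u v
    using pres_cong_map[of X R u v e] pres_cong_map[of ?X ?R "?e u" "?e v" e'] that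
    by (auto simp: inv invX invR simp del: map_map)
  have cc: "?e (u @ concat (replicate n b) @ v) = ?e u @ concat (replicate n (?e b)) @ ?e v" for u b v n
    by (simp add: map_concat)
  have cw: "u @ concat (replicate n b) @ v \<in> words X" if "{u, b, v} \<subseteq> words X" for u b v n
    using word_val_presented[of "u # replicate n b @ [v]" X R] that
    by (auto simp: set_replicate_conv_if split: if_splits)
  have zX: "[z] \<in> words X" using z by (simp add: words_def)
  have pcz: "pres_cong ?X ?R (?e u @ concat (replicate n (?e b)) @ ?e v) [e z] \<longleftrightarrow>
      pres_cong X R (u @ concat (replicate n b) @ v) [z]" if "{u, b, v} \<subseteq> words X" for u b v n
    using pc[OF cw[OF that] zX] unfolding cc by simp
  show ?thesis
  proof (rule hard_semigroup_of_nat_presentation[of ?X ?R "e z" "?e P" "?e a" "?e Q" "?e P'" "?e a'" "?e Q'" f Z])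
    show "finite ?X" "finite ?R" "?R \<subseteq> words ?X \<times> words ?X" "e z \<in> ?X"
      using fX fR RX' z by auto
    show "{?e P, ?e a, ?e Q, ?e P', ?e a', ?e Q'} \<subseteq> words ?X" using ws eX by auto
    fix w assume w: "w \<in> words ?X" "\<not> pres_cong ?X ?R w [e z]"
    then obtain w' where w': "w' \<in> words X" "w = ?e w'" using surj by blast
    then have "finite {v. pres_cong X R w' v}" using fin pc[OF w'(1) zX] w by simp
    moreover have "{v. pres_cong ?X ?R w v} \<subseteq> ?e ` {v. pres_cong X R w' v}"
    proof
      fix v assume "v \<in> {v. pres_cong ?X ?R w v}"
      then have v: "pres_cong ?X ?R w v" by simp
      then obtain v' where "v' \<in> words X" "v = ?e v'"
        using surj pres_cong_words(2)[OF RX'] by blast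
      then show "v \<in> ?e ` {v. pres_cong X R w' v}" using v w' pc by auto
    qed
    ultimately show "finite {v. pres_cong ?X ?R w v}" using finite_subset by blast
  next
    fix n
    show "\<not> pres_cong ?X ?R (?e P @ concat (replicate n (?e a)) @ ?e Q) [e z]"
      using pcz nz ws by simp
    show "n \<in> Z \<longleftrightarrow> pres_cong ?X ?R (?e P' @ concat (replicate n (?e a')) @ ?e Q') [e z]"
      using pcz mem ws by simp
    obtain u b v m where ubv: "{u, b, v} \<subseteq> words X" "m > f n"
       "pres_cong X R (P @ concat (replicate n a) @ Q) (u @ concat (replicate m b) @ v)"
       "\<forall>m'>m. pres_cong X R (u @ concat (replicate m' b) @ v) [z]" using pump by blast
    have "pres_cong ?X ?R (?e P @ concat (replicate n (?e a)) @ ?e Q) (?e u @ concat (replicate m (?e b)) @ ?e v)"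
      using pres_cong_map[OF ubv(3), of e] unfolding cc .
    moreover have "\<forall>m'>m. pres_cong ?X ?R (?e u @ concat (replicate m' (?e b)) @ ?e v) [e z]"
      using ubv(1,4) pcz by blast
    moreover have "{?e u, ?e b, ?e v} \<subseteq> words ?X" using ubv(1) eX by auto
    ultimately show "\<exists>u b v m. {u, b, v} \<subseteq> words ?X \<and> m > f n \<and>
       pres_cong ?X ?R (?e P @ concat (replicate n (?e a)) @ ?e Q) (u @ concat (replicate m b) @ v) \<and>
       (\<forall>m'>m. pres_cong ?X ?R (u @ concat (replicate m' b) @ v) [e z])"
      using ubv(2) by blast
  qed
qed

text \<open>
\<open>Dec i\<close> is fatal when register \<open>i\<close> is zero.  While \<open>i\<close> is nonzero, \<open>Loop i c\<close> decrements
\<open>i\<close> and runs \<open>c\<close>; it is a bounded loop when \<open>c\<close> does not mention \<open>i\<close>, and a general while loop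
otherwise.
\<close>

section \<open>Counter programs as rewriting systems\<close>

datatype cmd = Inc nat | Dec nat | Loop nat "cmd list"

text \<open>
The control letter \<open>St ks\<close> carries the list of commands still to be executed.  \<open>Sym i True\<close> is one
unit of register \<open>i\<close> and \<open>Sym i False\<close> marks the bottom of its stack, which makes zero
detectable.  \<open>Gar\<close> is the garbage left by decrements.
\<close>

datatype letter = Zer | Gar | St "cmd list" | Sym nat bool

definition letters :: "nat \<Rightarrow> cmd list set \<Rightarrow> letter set" where
  "letters K Q = {Zer, Gar} \<union> St ` Q \<union> (\<lambda>(i, b). Sym i b) ` ({..<K} \<times> UNIV)"

text \<open>
The control letter sits to the left of the register letters, next to the top of every stack by virtue
of commutation.  Except for rules with right-hand side \<open>Zer\<close>, no rule shortens a word.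
\<close>

inductive_set rules :: "nat \<Rightarrow> cmd list set \<Rightarrow> (letter list \<times> letter list) set" for K Q where
  zero_left: "x \<in> letters K Q \<Longrightarrow> ([Zer, x], [Zer]) \<in> rules K Q"
| zero_right: "x \<in> letters K Q \<Longrightarrow> ([x, Zer], [Zer]) \<in> rules K Q"
| bad_gar: "x \<in> letters K Q \<Longrightarrow> x \<noteq> Gar \<Longrightarrow> ([x, Gar], [Zer]) \<in> rules K Q"
| bad_st: "x \<in> letters K Q \<Longrightarrow> x \<noteq> Gar \<Longrightarrow> ks \<in> Q \<Longrightarrow> ([x, St ks], [Zer]) \<in> rules K Q"
| commute: "i < K \<Longrightarrow> j < K \<Longrightarrow> i \<noteq> j \<Longrightarrow> ([Sym i a, Sym j b], [Sym j b, Sym i a]) \<in> rules K Q"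
| inc: "Inc i # ks \<in> Q \<Longrightarrow> ([St (Inc i # ks)], [St ks, Sym i True]) \<in> rules K Q"
| dec: "Dec i # ks \<in> Q \<Longrightarrow> ([St (Dec i # ks), Sym i True], [Gar, St ks]) \<in> rules K Q"
| die: "Dec i # ks \<in> Q \<Longrightarrow> ([St (Dec i # ks), Sym i False], [Zer]) \<in> rules K Q"
| loop: "Loop i c # ks \<in> Q \<Longrightarrow>
    ([St (Loop i c # ks), Sym i True], [Gar, St (c @ Loop i c # ks)]) \<in> rules K Q"
| exit: "Loop i c # ks \<in> Q \<Longrightarrow>
    ([St (Loop i c # ks), Sym i False], [St ks, Sym i False]) \<in> rules K Q"

text \<open>
Amount of garbage, control list if there is a control letter, and the stacks with their tops
first.  The dead configuration is represented by \<open>None\<close>.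
\<close>

type_synonym conf = "nat \<times> cmd list option \<times> (nat \<Rightarrow> bool list)"

inductive step :: "conf option \<Rightarrow> conf option \<Rightarrow> bool" where
  inc: "step (Some (k, Some (Inc i # ks), \<sigma>)) (Some (k, Some ks, \<sigma>(i := True # \<sigma> i)))"
| dec: "\<sigma> i = True # r \<Longrightarrow> step (Some (k, Some (Dec i # ks), \<sigma>)) (Some (Suc k, Some ks, \<sigma>(i := r)))"
| die: "\<sigma> i = False # r \<Longrightarrow> step (Some (k, Some (Dec i # ks), \<sigma>)) None"
| loop: "\<sigma> i = True # r \<Longrightarrow>
    step (Some (k, Some (Loop i c # ks), \<sigma>)) (Some (Suc k, Some (c @ Loop i c # ks), \<sigma>(i := r)))"
| exit: "\<sigma> i = False # r \<Longrightarrow> step (Some (k, Some (Loop i c # ks), \<sigma>)) (Some (k, Some ks, \<sigma>))"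

definition terminal :: "conf option \<Rightarrow> bool" where
  "terminal c \<longleftrightarrow> (\<nexists>d. step c d)"

lemma step_deterministic: "step c d \<Longrightarrow> step c e \<Longrightarrow> d = e"
  by (erule step.cases; erule step.cases; auto)

lemma terminal_None: "terminal None"
  by (auto simp: terminal_def elim: step.cases)

lemma terminal_stuck: "terminal (Some (k, None, \<sigma>))" "terminal (Some (k, Some [], \<sigma>))"
  by (auto simp: terminal_def elim: step.cases)

lemma terminal_rtranclp: "terminal c \<Longrightarrow> step\<^sup>*\<^sup>* c d \<Longrightarrow> d = c"
  by (metis terminal_def converse_rtranclpE)

lemma steps_equivclp: "step\<^sup>*\<^sup>* c d \<Longrightarrow> equivclp step c d"
  by (induction rule: rtranclp_induct) (auto intro: r_into_equivclp equivclp_trans)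

text \<open>
Determinism makes the reachability of a terminal configuration invariant under steps in both
directions.
\<close>

lemma equivclp_step_terminal:
  assumes "equivclp step c d" "terminal d"
  shows "step\<^sup>*\<^sup>* c d"
proof -
  have "step\<^sup>*\<^sup>* c d \<longleftrightarrow> step\<^sup>*\<^sup>* c' d" if "step c c'" for c c'
    using that assms(2) step_deterministic
    by (metis terminal_def converse_rtranclpE converse_rtranclp_into_rtranclp)
  with assms(1) show ?thesis
    by (induction rule: converse_equivclp_induct) auto
qed

text \<open>
The effect on the configuration of putting a letter in front of a word; folding it over a
word reads the word from right to left.
\<close>

fun prep :: "letter \<Rightarrow> conf option \<Rightarrow> conf option" where
  "prep Gar (Some (k, q, \<sigma>)) = Some (Suc k, q, \<sigma>)"
| "prep (St ks) (Some (0, None, \<sigma>)) = Some (0, Some ks, \<sigma>)"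
| "prep (Sym i b) (Some (0, None, \<sigma>)) = Some (0, None, \<sigma>(i := b # \<sigma> i))"
| "prep x c = None"

definition conf_of :: "letter list \<Rightarrow> conf option" where
  "conf_of w = foldr prep w (Some (0, None, \<lambda>_. []))"

lemma prep_None [simp]: "prep x None = None"
  by (cases x) auto

lemma prep_Some:
  "prep x (Some (k, Some ks, \<sigma>)) = (if x = Gar then Some (Suc k, Some ks, \<sigma>) else None)"
  "prep x (Some (Suc k, q, \<sigma>)) = (if x = Gar then Some (Suc (Suc k), q, \<sigma>) else None)"
  by (cases x; cases k; auto)+

lemma prep_step: "step c d \<Longrightarrow> equivclp step (prep x c) (prep x d)"
  by (erule step.cases) (auto simp: prep_Some intro: step.intros r_into_equivclp)

lemma prep_equivclp: "equivclp step c d \<Longrightarrow> equivclp step (prep x c) (prep x d)"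
proof (induction rule: equivclp_induct)
  case (step y z)
  then show ?case by (meson prep_step equivclp_sym equivclp_trans)
qed simp

lemma prep_Zer [simp]: "prep Zer c = None"
  by (cases c) auto

lemma prep_blocked:
  assumes "\<And>\<sigma>. c \<noteq> Some (0, None, \<sigma>)" "x \<noteq> Gar"
  shows "prep x c = None"
proof (cases c)
  case (Some d)
  obtain k q \<sigma> where d: "d = (k, q, \<sigma>)" by (cases d)
  show ?thesis
    using assms unfolding Some d by (cases k; cases q) (auto simp: prep_Some)
qed simp

text \<open>
The two sides of a rule act alike on every configuration, up to computation.  If the
configuration already has garbage or a control letter, both sides kill it; otherwise the rule is a
commutation, a step, or a clash of letters.
\<close>

lemma rule_sound:
  assumes "(u, v) \<in> rules K Q"
  shows "equivclp step (foldr prep u c) (foldr prep v c)"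
proof (cases "\<exists>\<sigma>. c = Some (0, None, \<sigma>)")
  case True
  then obtain \<sigma> where c: "c = Some (0, None, \<sigma>)" by blast
  note upd = step.inc step.die[of "\<sigma>(i := False # \<sigma> i)" i "\<sigma> i" for i]
    step.dec[of "\<sigma>(i := True # \<sigma> i)" i "\<sigma> i" for i, simplified]
    step.loop[of "\<sigma>(i := True # \<sigma> i)" i "\<sigma> i" for i, simplified]
    step.exit[of "\<sigma>(i := False # \<sigma> i)" i "\<sigma> i" for i]
  show ?thesis
    using assms unfolding c
    by cases (auto simp: prep_Some fun_upd_twist intro!: r_into_equivclp intro: upd)
next
  case False
  then have b: "prep x c = None" if "x \<noteq> Gar" for x
    using prep_blocked that by blast
  have g: "prep x (prep Gar c) = None" if "x \<noteq> Gar" for x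
    using that prep_Some(2) by (cases c) auto
  show ?thesis
    using assms by cases (auto simp: b g)
qed

text \<open>
Quantifying over the configuration \<open>c\<close> to the right of the word makes the claim stable under
multiplication.
\<close>

lemma cong_sound:
  assumes "pres_cong X (rules K Q) u v"
  shows "equivclp step (foldr prep u c) (foldr prep v c)"
  using assms
proof (induction arbitrary: c)
  case (rel u v)
  then show ?case by (rule rule_sound)
next
  case (mult u v u' v')
  have "equivclp step (foldr prep x c) (foldr prep x d)" if "equivclp step c d" for x c d
    using that by (induction x) (auto intro: prep_equivclp)
  from this[OF mult.IH(2)] mult.IH(1) show ?case
    by (auto intro: equivclp_trans)
qed (auto intro: equivclp_sym equivclp_trans)

fun conf_size :: "nat \<Rightarrow> conf \<Rightarrow> nat" where
  "conf_size K (k, q, \<sigma>) = k + (if q = None then 0 else 1) + (\<Sum>i<K. length (\<sigma> i))"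

text \<open>
\<open>Q\<close> is a finite set of control lists closed under execution, with registers below \<open>K\<close>.
\<close>

locale counter_program =
  fixes K :: nat and Q :: "cmd list set"
  assumes finQ: "finite Q"
    and Q_Inc: "Inc i # ks \<in> Q \<Longrightarrow> i < K \<and> ks \<in> Q"
    and Q_Dec: "Dec i # ks \<in> Q \<Longrightarrow> i < K \<and> ks \<in> Q"
    and Q_Loop: "Loop i c # ks \<in> Q \<Longrightarrow> i < K \<and> ks \<in> Q \<and> c @ Loop i c # ks \<in> Q"
begin

abbreviation X where "X \<equiv> letters K Q"
abbreviation R where "R \<equiv> rules K Q"
abbreviation cong (infix "\<sim>" 50) where "u \<sim> v \<equiv> pres_cong X R u v"

lemma in_letters:
  "Zer \<in> X" "Gar \<in> X" "St ks \<in> X \<longleftrightarrow> ks \<in> Q" "Sym i b \<in> X \<longleftrightarrow> i < K"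
  by (auto simp: letters_def)

lemma finite_letters: "finite X"
  using finQ by (auto simp: letters_def)

lemma rules_words: "R \<subseteq> {w. set w \<subseteq> X \<and> length w \<le> 2 \<and> w \<noteq> []} \<times> {w. set w \<subseteq> X \<and> length w \<le> 2 \<and> w \<noteq> []}"
proof (intro subrelI)
  fix u v assume "(u, v) \<in> R"
  then show "(u, v) \<in> {w. set w \<subseteq> X \<and> length w \<le> 2 \<and> w \<noteq> []} \<times> {w. set w \<subseteq> X \<and> length w \<le> 2 \<and> w \<noteq> []}"
    by cases (auto simp: in_letters dest: Q_Inc Q_Dec Q_Loop)
qed

lemma finite_rules: "finite R"
proof (rule finite_subset[OF rules_words])
  have "{w. set w \<subseteq> X \<and> length w \<le> 2 \<and> w \<noteq> []} \<subseteq> {w. set w \<subseteq> X \<and> length w \<le> 2}" by auto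
  then have "finite {w. set w \<subseteq> X \<and> length w \<le> 2 \<and> w \<noteq> []}"
    using finite_lists_length_le[OF finite_letters] finite_subset by blast
  then show "finite ({w. set w \<subseteq> X \<and> length w \<le> 2 \<and> w \<noteq> []} \<times> {w. set w \<subseteq> X \<and> length w \<le> 2 \<and> w \<noteq> []})"
    by simp
qed

lemma rules_subset: "R \<subseteq> words X \<times> words X"
proof -
  have "{w. set w \<subseteq> X \<and> length w \<le> 2 \<and> w \<noteq> []} \<subseteq> words X" by (auto simp: words_def)
  with rules_words show ?thesis by blast
qed

fun valid :: "conf option \<Rightarrow> bool" where
  "valid None = True"
| "valid (Some (k, q, \<sigma>)) = ((\<forall>ks. q = Some ks \<longrightarrow> ks \<in> Q) \<and> (\<forall>i\<ge>K. \<sigma> i = []))"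

lemma valid_step: "step c d \<Longrightarrow> valid c \<Longrightarrow> valid d"
  by (erule step.cases) (auto dest: Q_Inc Q_Dec Q_Loop)

lemma valid_steps: "step\<^sup>*\<^sup>* c d \<Longrightarrow> valid c \<Longrightarrow> valid d"
  by (induction rule: rtranclp_induct) (auto intro: valid_step)

lemma sum_length_upd:
  "i < K \<Longrightarrow> (\<Sum>j<K. length ((\<sigma>(i := r)) j)) + length (\<sigma> i) = (\<Sum>j<K. length (\<sigma> j)) + length r"
  by (simp add: sum.remove[of "{..<K}" i])

text \<open>
The size counts letters.  This monotonicity bounds the length of all words in a nonzero class by the size of
the terminal configuration.
\<close>

lemma size_step:
  assumes "step (Some c) (Some d)" "valid (Some c)"
  shows "conf_size K c \<le> conf_size K d"
  using assms(1)
proof cases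
  case (inc k i ks \<sigma>)
  then show ?thesis using assms(2) sum_length_upd[of i \<sigma> "True # \<sigma> i"] by (auto dest: Q_Inc)
next
  case (dec \<sigma> i r k ks)
  then show ?thesis using assms(2) sum_length_upd[of i \<sigma> r] by (auto dest: Q_Dec)
next
  case (loop \<sigma> i r k c ks)
  then show ?thesis using assms(2) sum_length_upd[of i \<sigma> r] by (auto dest: Q_Loop)
qed auto

lemma size_steps:
  assumes "step\<^sup>*\<^sup>* c (Some e)" "valid c"
  shows "\<exists>d. c = Some d \<and> conf_size K d \<le> conf_size K e"
  using assms
proof (induction rule: converse_rtranclp_induct)
  case (step y z)
  then obtain d where d: "z = Some d" "conf_size K d \<le> conf_size K e"
    using valid_step by blast
  obtain c where "y = Some c" using step(1) by (cases rule: step.cases) auto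
  then show ?case using size_step step d by fastforce
qed auto

lemma conf_of_size:
  assumes "set w \<subseteq> X" "conf_of w = Some c"
  shows "conf_size K c = length w \<and> valid (Some c)"
  using assms
proof (induction w arbitrary: c)
  case Nil
  then show ?case by (auto simp: conf_of_def)
next
  case (Cons x w)
  have e: "prep x (conf_of w) = Some c" using Cons.prems by (simp add: conf_of_def)
  then obtain d where d: "conf_of w = Some d" by (cases "conf_of w") auto
  obtain k q \<sigma> where dd: "d = (k, q, \<sigma>)" by (cases d) auto
  have IH: "conf_size K d = length w \<and> valid (Some d)" using Cons d by simp
  show ?case
  proof (cases x)
    case (Sym i b)
    then have "k = 0" "q = None" "i < K"
      using e d dd Cons.prems(1) by (cases k; cases q; auto simp: in_letters prep_Some)+
    then show ?thesis
      using IH e d dd Sym sum_length_upd[of i \<sigma> "b # \<sigma> i"] by auto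
  next
    case (St ks)
    then have "k = 0" "q = None" "ks \<in> Q"
      using e d dd Cons.prems(1) by (cases k; cases q; auto simp: in_letters prep_Some)+
    then show ?thesis using IH e d dd St by auto
  qed (use IH e d dd in auto)
qed

lemma valid_conf_of: "set w \<subseteq> X \<Longrightarrow> valid (conf_of w)"
  using conf_of_size by (cases "conf_of w") auto

end

section \<open>Configurations as canonical words\<close>

context counter_program
begin

text \<open>
The congruence on the free monoid: stacks and contexts may be empty, which \<open>pres_cong\<close> does not
allow.
\<close>

definition cong0 :: "letter list \<Rightarrow> letter list \<Rightarrow> bool" (infix "\<approx>" 50) where
  "u \<approx> v \<longleftrightarrow> u = v \<or> u \<sim> v"

lemma cong0_refl: "u \<approx> u"
  by (simp add: cong0_def)

lemma cong0_sym: "u \<approx> v \<Longrightarrow> v \<approx> u"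
  by (auto simp: cong0_def intro: pres_cong.sym)

lemma cong0_trans [trans]: "u \<approx> v \<Longrightarrow> v \<approx> w \<Longrightarrow> u \<approx> w"
  by (auto simp: cong0_def intro: pres_cong.trans)

lemma cong0_context: "u \<approx> v \<Longrightarrow> set x \<subseteq> X \<Longrightarrow> set y \<subseteq> X \<Longrightarrow> x @ u @ y \<approx> x @ v @ y"
  by (auto simp: cong0_def intro: pres_cong_context)

lemma cong0_rule: "(u, v) \<in> R \<Longrightarrow> set x \<subseteq> X \<Longrightarrow> set y \<subseteq> X \<Longrightarrow> x @ u @ y \<approx> x @ v @ y"
  by (rule cong0_context) (auto simp: cong0_def intro: pres_cong.rel)

lemma cong0_Cons: "u \<approx> v \<Longrightarrow> x \<in> X \<Longrightarrow> x # u \<approx> x # v"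
  using cong0_context[of u v "[x]" "[]"] by simp

lemma zero_absorbs: "set u \<subseteq> X \<Longrightarrow> Zer # u \<approx> [Zer]"
proof (induction u)
  case (Cons x u)
  then have "Zer # x # u \<approx> Zer # u"
    using cong0_rule[OF rules.zero_left, of x "[]" u] by simp
  with Cons show ?case by (auto intro: cong0_trans)
qed (simp add: cong0_refl)

lemma rule_to_zero: "([x, y], [Zer]) \<in> R \<Longrightarrow> set u \<subseteq> X \<Longrightarrow> x # y # u \<approx> [Zer]"
  using cong0_rule[of "[x, y]" "[Zer]" "[]" u] zero_absorbs[of u] by (auto intro: cong0_trans)

definition blocks :: "nat list \<Rightarrow> (nat \<Rightarrow> bool list) \<Rightarrow> letter list" where
  "blocks is \<sigma> = concat (map (\<lambda>i. map (Sym i) (\<sigma> i)) is)"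

lemma blocks_Cons: "blocks (i # is) \<sigma> = map (Sym i) (\<sigma> i) @ blocks is \<sigma>"
  by (simp add: blocks_def)

lemma blocks_letters: "set is \<subseteq> {..<K} \<Longrightarrow> set (blocks is \<sigma>) \<subseteq> X"
  by (auto simp: blocks_def in_letters)

lemma move_past_block:
  assumes "i < K" "j < K" "i \<noteq> j" "set u \<subseteq> X"
  shows "Sym i b # map (Sym j) bs @ u \<approx> map (Sym j) bs @ Sym i b # u"
proof (induction bs)
  case (Cons a bs)
  have "[] @ [Sym i b, Sym j a] @ (map (Sym j) bs @ u) \<approx> [] @ [Sym j a, Sym i b] @ (map (Sym j) bs @ u)"
    by (rule cong0_rule[OF rules.commute]) (use assms in \<open>auto simp: in_letters\<close>)
  also have "\<dots> \<approx> Sym j a # map (Sym j) bs @ Sym i b # u"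
    using cong0_Cons[OF Cons.IH, of "Sym j a"] assms by (simp add: in_letters)
  finally show ?case by simp
qed (simp add: cong0_refl)

text \<open>
A letter moves to the block of its own register past the blocks of the others.
\<close>

lemma push_block:
  assumes "distinct is" "set is \<subseteq> {..<K}" "i \<in> set is"
  shows "Sym i b # blocks is \<sigma> \<approx> blocks is (\<sigma>(i := b # \<sigma> i))"
  using assms
proof (induction "is")
  case (Cons j js)
  show ?case
  proof (cases "i = j")
    case True
    then have "blocks js (\<sigma>(i := b # \<sigma> i)) = blocks js \<sigma>"
      using Cons.prems unfolding blocks_def by (intro arg_cong[where f = concat] map_cong) auto
    then show ?thesis using True by (simp add: blocks_Cons cong0_refl fun_upd_same del: fun_upd_apply)
  next
    case False
    have "Sym i b # blocks (j # js) \<sigma> \<approx> map (Sym j) (\<sigma> j) @ Sym i b # blocks js \<sigma>"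
      unfolding blocks_Cons using Cons.prems False
      by (intro move_past_block blocks_letters) auto
    also have "\<dots> \<approx> map (Sym j) (\<sigma> j) @ blocks js (\<sigma>(i := b # \<sigma> i))"
    proof -
      have "Sym i b # blocks js \<sigma> \<approx> blocks js (\<sigma>(i := b # \<sigma> i))"
        using Cons.prems False by (intro Cons.IH) auto
      moreover have "set (map (Sym j) (\<sigma> j)) \<subseteq> X"
        using Cons.prems by (auto simp: in_letters)
      ultimately show ?thesis using cong0_context[of _ _ _ "[]"] by simp
    qed
    finally show ?thesis using False by (simp add: blocks_Cons fun_upd_other del: fun_upd_apply)
  qed
qed simp

abbreviation stack_word :: "(nat \<Rightarrow> bool list) \<Rightarrow> letter list" where
  "stack_word \<equiv> blocks [0..<K]"

lemma stack_word_letters: "set (stack_word \<sigma>) \<subseteq> X"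
  by (rule blocks_letters) auto

lemma push: "i < K \<Longrightarrow> Sym i b # stack_word \<sigma> \<approx> stack_word (\<sigma>(i := b # \<sigma> i))"
  by (rule push_block) auto

lemma pop: "i < K \<Longrightarrow> \<sigma> i = b # r \<Longrightarrow> stack_word \<sigma> \<approx> Sym i b # stack_word (\<sigma>(i := r))"
  using push[of i b "\<sigma>(i := r)"] by (auto intro: cong0_sym simp: fun_upd_idem)

fun word_of :: "conf option \<Rightarrow> letter list" where
  "word_of None = [Zer]"
| "word_of (Some (k, q, \<sigma>)) =
     replicate k Gar @ (case q of None \<Rightarrow> [] | Some ks \<Rightarrow> [St ks]) @ stack_word \<sigma>"

lemma gars_letters: "set (replicate k Gar) \<subseteq> X"
  by (auto simp: in_letters)

lemma word_of_letters: "valid c \<Longrightarrow> set (word_of c) \<subseteq> X"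
  using stack_word_letters by (cases c rule: word_of.cases) (auto simp: in_letters split: option.splits)

lemma word_of_prep:
  assumes "x \<in> X" "valid c"
  shows "x # word_of c \<approx> word_of (prep x c)"
proof (cases c)
  case None
  have "([x, Zer], [Zer]) \<in> R" using assms(1) by (rule rules.zero_right)
  then show ?thesis using None rule_to_zero[of x Zer "[]"] by simp
next
  case (Some d)
  obtain k q \<sigma> where d: "d = (k, q, \<sigma>)" by (cases d)
  note c = Some[unfolded d]
  have L: "set (word_of c) \<subseteq> X" using assms(2) by (rule word_of_letters)
  show ?thesis
  proof (cases "k = 0 \<and> q = None")
    case True
    then show ?thesis
      using c assms(1) zero_absorbs[OF stack_word_letters] push
      by (cases x) (auto simp: cong0_refl in_letters)
  next
    case False
    show ?thesis
    proof (cases "x = Gar")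
      case True
      then show ?thesis using c by (simp add: cong0_refl)
    next
      case xG: False
      have "prep x c = None" using False xG c by (intro prep_blocked) auto
      moreover obtain y u where yu: "word_of c = y # u" "y = Gar \<or> (\<exists>ks. y = St ks)"
        using False c by (cases k; cases q) auto
      moreover have "([x, y], [Zer]) \<in> R"
        using yu L xG assms(1) by (auto simp: in_letters intro: rules.bad_gar rules.bad_st)
      ultimately show ?thesis using rule_to_zero[of x y u] L by simp
    qed
  qed
qed

text \<open>
Completeness of the canonical words; in particular, a word whose letters clash equals zero.
\<close>

lemma word_of_conf_of:
  assumes "set w \<subseteq> X"
  shows "w \<approx> word_of (conf_of w)"
  using assms
proof (induction w)
  case Nil
  have "stack_word (\<lambda>_. []) = []" by (simp add: blocks_def)
  then show ?case by (simp add: conf_of_def cong0_refl)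
next
  case (Cons x w)
  then have "x # w \<approx> x # word_of (conf_of w)" by (intro cong0_Cons) auto
  also have "\<dots> \<approx> word_of (prep x (conf_of w))"
    using Cons.prems by (intro word_of_prep valid_conf_of) auto
  finally show ?case by (simp add: conf_of_def)
qed

lemma word_of_step:
  assumes "step c d" "valid c"
  shows "word_of c \<approx> word_of d"
  using assms(1)
proof cases
  case (inc k i ks \<sigma>)
  have Q: "Inc i # ks \<in> Q" using assms(2) inc by auto
  then have i: "i < K" "ks \<in> Q" using Q_Inc by auto
  have "replicate k Gar @ [St (Inc i # ks)] @ stack_word \<sigma> \<approx> replicate k Gar @ [St ks, Sym i True] @ stack_word \<sigma>"
    by (rule cong0_rule[OF rules.inc[OF Q]]) (use stack_word_letters in \<open>auto simp: in_letters\<close>)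
  also have "\<dots> \<approx> (replicate k Gar @ [St ks]) @ stack_word (\<sigma>(i := True # \<sigma> i)) @ []"
    using cong0_context[OF push[OF i(1), of True \<sigma>], of "replicate k Gar @ [St ks]" "[]"] i gars_letters
    by (simp add: in_letters)
  finally show ?thesis using inc by simp
next
  case (dec \<sigma> i r k ks)
  have Q: "Dec i # ks \<in> Q" using assms(2) dec by auto
  then have i: "i < K" "ks \<in> Q" using Q_Dec by auto
  have "(replicate k Gar @ [St (Dec i # ks)]) @ stack_word \<sigma> @ [] \<approx>
      (replicate k Gar @ [St (Dec i # ks)]) @ (Sym i True # stack_word (\<sigma>(i := r))) @ []"
    by (rule cong0_context[OF pop]) (use i dec Q in \<open>auto simp: in_letters\<close>)
  also have "\<dots> \<approx> replicate k Gar @ [Gar, St ks] @ stack_word (\<sigma>(i := r))"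
    using cong0_rule[OF rules.dec[OF Q], of "replicate k Gar" "stack_word (\<sigma>(i := r))"]
      stack_word_letters gars_letters by (simp add: in_letters)
  finally show ?thesis using dec by (simp add: replicate_app_Cons_same)
next
  case (loop \<sigma> i r k c ks)
  have Q: "Loop i c # ks \<in> Q" using assms(2) loop by auto
  then have i: "i < K" using Q_Loop by auto
  have "(replicate k Gar @ [St (Loop i c # ks)]) @ stack_word \<sigma> @ [] \<approx>
      (replicate k Gar @ [St (Loop i c # ks)]) @ (Sym i True # stack_word (\<sigma>(i := r))) @ []"
    by (rule cong0_context[OF pop]) (use i loop Q in \<open>auto simp: in_letters\<close>)
  also have "\<dots> \<approx> replicate k Gar @ [Gar, St (c @ Loop i c # ks)] @ stack_word (\<sigma>(i := r))"
    using cong0_rule[OF rules.loop[OF Q], of "replicate k Gar" "stack_word (\<sigma>(i := r))"]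
      stack_word_letters gars_letters by (simp add: in_letters)
  finally show ?thesis using loop by (simp add: replicate_app_Cons_same)
next
  case (die \<sigma> i r k ks)
  have Q: "Dec i # ks \<in> Q" using assms(2) die by auto
  then have i: "i < K" using Q_Dec by auto
  have G: "replicate k Gar @ [Zer] \<approx> [Zer]"
  proof (induction k)
    case (Suc k)
    then have "replicate (Suc k) Gar @ [Zer] \<approx> [Gar, Zer]"
      using cong0_Cons[of "replicate k Gar @ [Zer]" "[Zer]" Gar] by (simp add: in_letters)
    also have "[Gar, Zer] \<approx> [Zer]"
      using rule_to_zero[OF rules.zero_right, of Gar "[]"] by (simp add: in_letters)
    finally show ?case .
  qed (simp add: cong0_refl)
  have "(replicate k Gar @ [St (Dec i # ks)]) @ stack_word \<sigma> @ [] \<approx>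
      (replicate k Gar @ [St (Dec i # ks)]) @ (Sym i False # stack_word (\<sigma>(i := r))) @ []"
    by (rule cong0_context[OF pop]) (use i die Q in \<open>auto simp: in_letters\<close>)
  also have "\<dots> \<approx> replicate k Gar @ [Zer] @ []"
    using cong0_context[OF rule_to_zero[OF rules.die[OF Q] stack_word_letters, of "\<sigma>(i := r)"],
      of "replicate k Gar" "[]"] gars_letters by simp
  also have "\<dots> \<approx> [Zer]" using G by simp
  finally show ?thesis using die by simp
next
  case (exit \<sigma> i r k c ks)
  have Q: "Loop i c # ks \<in> Q" using assms(2) exit by auto
  then have i: "i < K" "ks \<in> Q" using Q_Loop by auto
  have P: "stack_word \<sigma> \<approx> Sym i False # stack_word (\<sigma>(i := r))"
    by (rule pop) (use i exit in auto)
  have "(replicate k Gar @ [St (Loop i c # ks)]) @ stack_word \<sigma> @ [] \<approx>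
      (replicate k Gar @ [St (Loop i c # ks)]) @ (Sym i False # stack_word (\<sigma>(i := r))) @ []"
    by (rule cong0_context[OF P]) (use Q in \<open>auto simp: in_letters\<close>)
  also have "\<dots> \<approx> replicate k Gar @ [St ks, Sym i False] @ stack_word (\<sigma>(i := r))"
    using cong0_rule[OF rules.exit[OF Q], of "replicate k Gar" "stack_word (\<sigma>(i := r))"]
      stack_word_letters gars_letters by (simp add: in_letters)
  also have "\<dots> \<approx> (replicate k Gar @ [St ks]) @ stack_word \<sigma> @ []"
    using cong0_context[OF cong0_sym[OF P], of "replicate k Gar @ [St ks]" "[]"] i
      gars_letters by (simp add: in_letters)
  finally show ?thesis using exit by simp
qed

lemma word_of_steps: "step\<^sup>*\<^sup>* c d \<Longrightarrow> valid c \<Longrightarrow> word_of c \<approx> word_of d"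
proof (induction rule: rtranclp_induct)
  case (step d e)
  then show ?case using word_of_step[of d e] valid_steps cong0_trans by blast
qed (simp add: cong0_refl)

lemma cong_word_of:
  assumes "w \<in> words X" "step\<^sup>*\<^sup>* (conf_of w) d"
  shows "w \<sim> word_of d"
proof -
  have "set w \<subseteq> X" using assms(1) by (simp add: words_iff)
  then have "w \<approx> word_of d"
    using word_of_conf_of word_of_steps[OF assms(2)] valid_conf_of cong0_trans by blast
  then show ?thesis using assms(1) by (auto simp: cong0_def intro: pres_cong.refl)
qed

text \<open>
The word problem against zero is decided by running the machine.
\<close>

lemma cong_iff:
  assumes "w \<in> words X" "step\<^sup>*\<^sup>* (conf_of w) d" "terminal d"
  shows "w \<sim> [Zer] \<longleftrightarrow> d = None"
proof
  assume "w \<sim> [Zer]"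
  then have "equivclp step (conf_of w) None"
    using cong_sound[of X K Q w "[Zer]"] by (simp add: conf_of_def)
  then have "equivclp step None d"
    using steps_equivclp[OF assms(2)] by (meson equivclp_sym equivclp_trans)
  then show "d = None" using equivclp_step_terminal[OF _ assms(3)] terminal_rtranclp[OF terminal_None] by blast
next
  assume "d = None"
  then show "w \<sim> [Zer]" using cong_word_of[OF assms(1,2)] by simp
qed

text \<open>
All words in the class of \<open>w\<close> reach the same terminal configuration, and their lengths are bounded by its
size.
\<close>

lemma finite_nonzero_class:
  assumes halts: "\<And>c. valid c \<Longrightarrow> \<exists>d. step\<^sup>*\<^sup>* c d \<and> terminal d"
    and w: "w \<in> words X" "\<not> w \<sim> [Zer]"
  shows "finite {v. w \<sim> v}"
proof -
  have "valid (conf_of w)" using w valid_conf_of by (auto simp: words_iff)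
  then obtain d where d: "step\<^sup>*\<^sup>* (conf_of w) d" "terminal d" using halts by blast
  then obtain e where e: "d = Some e" using cong_iff w by (cases d) auto
  have "{v. w \<sim> v} \<subseteq> {v. set v \<subseteq> X \<and> length v \<le> conf_size K e}"
  proof
    fix v assume "v \<in> {v. w \<sim> v}"
    then have wv: "w \<sim> v" by simp
    then have v: "set v \<subseteq> X" using pres_cong_words(2)[OF rules_subset] by (auto simp: words_iff)
    have "equivclp step (conf_of v) (conf_of w)"
      unfolding conf_of_def by (rule cong_sound[OF pres_cong.sym[OF wv]])
    moreover have "equivclp step (conf_of w) d" using d(1) by (rule steps_equivclp)
    ultimately have "step\<^sup>*\<^sup>* (conf_of v) d" using equivclp_step_terminal d(2) equivclp_trans by metis
    then obtain c where "conf_of v = Some c" "conf_size K c \<le> conf_size K e"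
      using size_steps valid_conf_of[OF v] e by blast
    then show "v \<in> {v. set v \<subseteq> X \<and> length v \<le> conf_size K e}"
      using conf_of_size[OF v] v by simp
  qed
  then show ?thesis using finite_lists_length_le[OF finite_letters] finite_subset by blast
qed

end

text \<open>
Register contents \<open>s\<close> seen as stacks: \<open>s i\<close> units, then a bottom marker, then arbitrary junk \<open>j i\<close>
which is never inspected.
\<close>

section \<open>Semantics of commands\<close>

definition stacks :: "nat \<Rightarrow> (nat \<Rightarrow> nat) \<Rightarrow> (nat \<Rightarrow> bool list) \<Rightarrow> nat \<Rightarrow> bool list" where
  "stacks K s j i = (if i < K then replicate (s i) True @ False # j i else [])"

definition conf_at :: "nat \<Rightarrow> nat \<Rightarrow> cmd list \<Rightarrow> (nat \<Rightarrow> nat) \<Rightarrow> (nat \<Rightarrow> bool list) \<Rightarrow> conf option" where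
  "conf_at K k ks s j = Some (k, Some ks, stacks K s j)"

lemma stacks_push: "i < K \<Longrightarrow> (stacks K s j)(i := True # stacks K s j i) = stacks K (s(i := Suc (s i))) j"
  by (auto simp: stacks_def fun_eq_iff)

lemma stacks_pop:
  assumes "i < K" "s i = Suc m"
  shows "stacks K s j i = True # stacks K (s(i := m)) j i"
    and "(stacks K s j)(i := stacks K (s(i := m)) j i) = stacks K (s(i := m)) j"
  using assms by (auto simp: stacks_def fun_eq_iff)

text \<open>
Uniform in the garbage and in the junk below the bottom markers, so that only registers matter.
\<close>

definition reach :: "nat \<Rightarrow> cmd list \<Rightarrow> (nat \<Rightarrow> nat) \<Rightarrow> cmd list \<Rightarrow> (nat \<Rightarrow> nat) \<Rightarrow> bool" where
  "reach K ks s ks' s' \<longleftrightarrow> (\<forall>k j. \<exists>k'. step\<^sup>*\<^sup>* (conf_at K k ks s j) (conf_at K k' ks' s' j))"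

definition dies :: "nat \<Rightarrow> cmd list \<Rightarrow> (nat \<Rightarrow> nat) \<Rightarrow> bool" where
  "dies K ks s \<longleftrightarrow> (\<forall>k j. step\<^sup>*\<^sup>* (conf_at K k ks s j) None)"

lemma reach_refl: "reach K ks s ks s"
  unfolding reach_def by blast

lemma reach_trans: "reach K a s b t \<Longrightarrow> reach K b t c u \<Longrightarrow> reach K a s c u"
  unfolding reach_def by (meson rtranclp_trans)

lemma reach_dies: "reach K a s b t \<Longrightarrow> dies K b t \<Longrightarrow> dies K a s"
  unfolding reach_def dies_def by (meson rtranclp_trans)

lemma reach_step:
  assumes "\<And>k j. \<exists>k'. step (conf_at K k a s j) (conf_at K k' b t j)"
  shows "reach K a s b t"
  using assms unfolding reach_def by blast

lemma reach_Inc: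
  assumes "i < K"
  shows "reach K (Inc i # ks) s ks (s(i := Suc (s i)))"
proof (rule reach_step, intro exI)
  fix k j
  show "step (conf_at K k (Inc i # ks) s j) (conf_at K k ks (s(i := Suc (s i))) j)"
    unfolding conf_at_def stacks_push[OF assms, symmetric] by (rule step.inc)
qed

lemma reach_Dec:
  assumes "i < K" "s i = Suc m"
  shows "reach K (Dec i # ks) s ks (s(i := m))"
proof (rule reach_step, intro exI)
  fix k j
  show "step (conf_at K k (Dec i # ks) s j) (conf_at K (Suc k) ks (s(i := m)) j)"
    using step.dec[where \<sigma> = "stacks K s j" and i = i and r = "stacks K (s(i := m)) j i" and k = k and ks = ks, OF stacks_pop(1)[of i K s m j, OF assms]]
    unfolding conf_at_def stacks_pop(2)[of i K s m j, OF assms] .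
qed

lemma reach_Loop:
  assumes "i < K" "s i = Suc m"
  shows "reach K (Loop i c # ks) s (c @ Loop i c # ks) (s(i := m))"
proof (rule reach_step, intro exI)
  fix k j
  show "step (conf_at K k (Loop i c # ks) s j) (conf_at K (Suc k) (c @ Loop i c # ks) (s(i := m)) j)"
    using step.loop[where \<sigma> = "stacks K s j" and i = i and r = "stacks K (s(i := m)) j i" and k = k and ks = ks and c = c, OF stacks_pop(1)[of i K s m j, OF assms]]
    unfolding conf_at_def stacks_pop(2)[of i K s m j, OF assms] .
qed

lemma reach_exit:
  assumes "i < K" "s i = 0"
  shows "reach K (Loop i c # ks) s ks s"
proof (rule reach_step, intro exI)
  fix k j
  show "step (conf_at K k (Loop i c # ks) s j) (conf_at K k ks s j)"
    unfolding conf_at_def using assms by (intro step.exit) (auto simp: stacks_def)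
qed

lemma dies_Dec:
  assumes "i < K" "s i = 0"
  shows "dies K (Dec i # ks) s"
  unfolding dies_def
proof (intro allI r_into_rtranclp)
  fix k j
  show "step (conf_at K k (Dec i # ks) s j) None"
    unfolding conf_at_def using assms by (intro step.die) (auto simp: stacks_def)
qed

text \<open>
The denotation of a command, faithful for loops that are bounded; a fatal decrement is
truncated here, and only \<open>total\<close> commands are free of it.  The map in the last equation is for the sake
of primitive recursion, and \<open>run_Loop\<close> is the readable form.
\<close>

primrec run :: "cmd \<Rightarrow> (nat \<Rightarrow> nat) \<Rightarrow> nat \<Rightarrow> nat" where
  "run (Inc i) = (\<lambda>s. s(i := Suc (s i)))"
| "run (Dec i) = (\<lambda>s. s(i := s i - 1))"
| "run (Loop i c) = (\<lambda>s. (fold id (map run c) ^^ s i) (s(i := 0)))"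

lemma run_Loop [simp]: "run (Loop i c) s = (fold run c ^^ s i) (s(i := 0))"
  by (simp add: fold_map comp_def)

declare run.simps(3) [simp del]

fun regs :: "cmd \<Rightarrow> nat set" where
  "regs (Inc i) = {i}"
| "regs (Dec i) = {i}"
| "regs (Loop i c) = insert i (\<Union>x\<in>set c. regs x)"

fun bounded_loops :: "cmd \<Rightarrow> bool" where
  "bounded_loops (Loop i c) \<longleftrightarrow> (\<forall>x\<in>set c. i \<notin> regs x \<and> bounded_loops x)"
| "bounded_loops _ \<longleftrightarrow> True"

fun total :: "cmd \<Rightarrow> bool" where
  "total (Inc i) \<longleftrightarrow> True"
| "total (Dec i) \<longleftrightarrow> False"
| "total (Loop i c) \<longleftrightarrow> (\<forall>x\<in>set c. total x)"

lemma fold_upd: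
  assumes "\<And>x s. x \<in> set c \<Longrightarrow> run x (s(i := v)) = (run x s)(i := v)"
  shows "fold run c (s(i := v)) = (fold run c s)(i := v)"
  using assms by (induction c arbitrary: s) auto

lemma run_upd: "i \<notin> regs x \<Longrightarrow> run x (s(i := v)) = (run x s)(i := v)"
proof (induction x arbitrary: s)
  case (Loop l c)
  have "fold run c (s(i := v)) = (fold run c s)(i := v)" for s
  proof (rule fold_upd)
    fix x s assume "x \<in> set c"
    then show "run x (s(i := v)) = (run x s)(i := v)" by (rule Loop.IH) (use Loop.prems \<open>x \<in> set c\<close> in auto)
  qed
  then have "(fold run c ^^ n) (s(i := v)) = ((fold run c ^^ n) s)(i := v)" for n s
    by (induction n) auto
  note pow = this
  have "i \<noteq> l" using Loop.prems by simp
  then show ?case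
    using pow[of "s l" "s(l := 0)"]
    by (simp add: fun_upd_twist[of i l] fun_upd_other del: fun_upd_apply)
qed (auto simp: fun_upd_twist)

lemma run_other: "i \<notin> regs x \<Longrightarrow> run x s i = s i"
  by (metis fun_upd_same fun_upd_triv run_upd)

lemma fold_run_other: "\<forall>x\<in>set c. i \<notin> regs x \<Longrightarrow> fold run c s i = s i"
  by (induction c arbitrary: s) (auto simp: run_other)

lemma run_list_reach:
  assumes "\<And>x s ks. x \<in> set c \<Longrightarrow> reach K (x # ks) s ks (run x s) \<or> \<not> total x \<and> dies K (x # ks) s"
  shows "reach K (c @ ks) s ks (fold run c s) \<or> \<not> (\<forall>x\<in>set c. total x) \<and> dies K (c @ ks) s"
  using assms
proof (induction c arbitrary: s)
  case (Cons x c)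
  have "reach K (x # (c @ ks)) s (c @ ks) (run x s) \<or> \<not> total x \<and> dies K (x # (c @ ks)) s"
    using Cons.prems by auto
  moreover have "reach K (c @ ks) (run x s) ks (fold run c (run x s)) \<or>
      \<not> (\<forall>x\<in>set c. total x) \<and> dies K (c @ ks) (run x s)"
    using Cons by auto
  ultimately show ?case using reach_trans reach_dies by fastforce
qed (simp add: reach_refl)

text \<open>
Execution agrees with the denotation, or is cut short by a fatal decrement.  In a bounded loop the
counter register is not touched by the body, so the number of iterations is known in advance: the
denotation sets the counter to zero at once, while execution counts it down, and \<open>run_upd\<close> bridges
the difference.
\<close>

lemma run_reach:
  assumes "bounded_loops x" "regs x \<subseteq> {..<K}"
  shows "reach K (x # ks) s ks (run x s) \<or> \<not> total x \<and> dies K (x # ks) s"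
  using assms
proof (induction x arbitrary: ks s)
  case (Inc i)
  then have "i < K" by simp
  from reach_Inc[OF this] show ?case unfolding run.simps by blast
next
  case (Dec i)
  then have i: "i < K" by simp
  show ?case
  proof (cases "s i")
    case 0
    then show ?thesis using dies_Dec[OF i] by simp
  next
    case (Suc m)
    then have "run (Dec i) s = s(i := m)" by simp
    then show ?thesis using reach_Dec[of i K s m ks, OF i Suc] by metis
  qed
next
  case (Loop i c)
  have i: "i < K" "\<forall>x\<in>set c. i \<notin> regs x" using Loop.prems by auto
  have body: "reach K (c @ ks) s ks (fold run c s) \<or> \<not> (\<forall>x\<in>set c. total x) \<and> dies K (c @ ks) s" for s ks
    using Loop by (intro run_list_reach Loop.IH) auto
  have upd: "fold run c (s(i := v)) = (fold run c s)(i := v)" for s v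
    using i by (intro fold_upd run_upd) auto
  have "reach K (Loop i c # ks) s ks ((fold run c ^^ n) (s(i := 0))) \<or>
      \<not> (\<forall>x\<in>set c. total x) \<and> dies K (Loop i c # ks) s" if "s i = n" for n
    using that
  proof (induction n arbitrary: s)
    case 0
    then show ?case using reach_exit[of i K s c ks] i by (simp add: fun_upd_idem)
  next
    case (Suc n)
    let ?s1 = "s(i := n)" and ?s2 = "fold run c (s(i := n))"
    have 1: "reach K (Loop i c # ks) s (c @ Loop i c # ks) ?s1" using reach_Loop i(1) Suc.prems by blast
    have "?s2 i = n" using fold_run_other[OF i(2)] by simp
    moreover have "(fold run c ^^ n) (?s2(i := 0)) = (fold run c ^^ Suc n) (s(i := 0))"
      using upd[of ?s1 0] by (simp add: funpow_swap1)
    ultimately have "reach K (Loop i c # ks) ?s2 ks ((fold run c ^^ Suc n) (s(i := 0))) \<or>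
      \<not> (\<forall>x\<in>set c. total x) \<and> dies K (Loop i c # ks) ?s2"
      using Suc.IH[of ?s2] by metis
    then show ?case
      using body[of "Loop i c # ks" ?s1] reach_trans[OF 1] reach_dies[OF 1] reach_trans reach_dies by blast
  qed
  then show ?case by simp
qed

lemma run_list:
  assumes "\<forall>x\<in>set c. bounded_loops x \<and> regs x \<subseteq> {..<K}"
  shows "reach K (c @ ks) s ks (fold run c s) \<or> \<not> (\<forall>x\<in>set c. total x) \<and> dies K (c @ ks) s"
  using assms run_reach by (intro run_list_reach) auto

definition terminates :: "nat \<Rightarrow> cmd list \<Rightarrow> (nat \<Rightarrow> nat) \<Rightarrow> bool" where
  "terminates K ks s \<longleftrightarrow> dies K ks s \<or> (\<exists>s'. reach K ks s [] s')"

lemma reach_terminates: "reach K a s b t \<Longrightarrow> terminates K b t \<Longrightarrow> terminates K a s"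
  unfolding terminates_def using reach_dies reach_trans by blast

lemma run_list_terminates:
  assumes "\<forall>x\<in>set c. bounded_loops x \<and> regs x \<subseteq> {..<K}" "\<And>s. terminates K ks s"
  shows "terminates K (c @ ks) s"
  using run_list[OF assms(1), of ks s]
proof
  assume "reach K (c @ ks) s ks (fold run c s)"
  then show ?thesis using assms(2) by (rule reach_terminates)
qed (simp add: terminates_def)

context counter_program
begin

text \<open>
Arbitrary words may lack bottom markers.  Adding a marker below every stack gives a
configuration of the form \<open>conf_at\<close>, and every step of the original one remains possible; so the
original computation halts no later, possibly stuck at an empty stack.
\<close>

definition pad_stacks :: "(nat \<Rightarrow> bool list) \<Rightarrow> nat \<Rightarrow> bool list" where
  "pad_stacks \<sigma> i = (if i < K then \<sigma> i @ [False] else \<sigma> i)"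

definition pad :: "conf option \<Rightarrow> conf option" where
  "pad = map_option (\<lambda>(k, q, \<sigma>). (k, q, pad_stacks \<sigma>))"

lemma pad_stacks_upd: "i < K \<Longrightarrow> pad_stacks (\<sigma>(i := r)) = (pad_stacks \<sigma>)(i := r @ [False])"
  by (auto simp: pad_stacks_def fun_eq_iff)

lemma pad_stacks_same: "i < K \<Longrightarrow> pad_stacks \<sigma> i = \<sigma> i @ [False]"
  by (simp add: pad_stacks_def)

lemma pad_step: 
  assumes "step c d" "valid c"
  shows "step (pad c) (pad d)"
  using assms(1)
proof cases
  case (inc k i ks \<sigma>)
  then have i: "i < K" using assms(2) Q_Inc by auto
  show ?thesis
    using step.inc[of k i ks "pad_stacks \<sigma>"] unfolding inc pad_def
    by (simp add: pad_stacks_upd i pad_stacks_same del: fun_upd_apply)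
next
  case (dec \<sigma> i r k ks)
  then have i: "i < K" using assms(2) Q_Dec by auto
  then show ?thesis
    using step.dec[of "pad_stacks \<sigma>" i "r @ [False]" k ks] dec(3) unfolding dec(1,2) pad_def
    by (simp add: pad_stacks_upd pad_stacks_same del: fun_upd_apply)
next
  case (loop \<sigma> i r k c ks)
  then have i: "i < K" using assms(2) Q_Loop by auto
  then show ?thesis
    using step.loop[of "pad_stacks \<sigma>" i "r @ [False]" k c ks] loop(3) unfolding loop(1,2) pad_def
    by (simp add: pad_stacks_upd pad_stacks_same del: fun_upd_apply)
next
  case (die \<sigma> i r k ks)
  then have i: "i < K" using assms(2) Q_Dec by auto
  then show ?thesis
    using step.die[of "pad_stacks \<sigma>" i "r @ [False]" k ks] die(3) unfolding die(1,2) pad_def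
    by (simp add: pad_stacks_same)
next
  case (exit \<sigma> i r k c ks)
  then have i: "i < K" using assms(2) Q_Loop by auto
  then show ?thesis
    using step.exit[of "pad_stacks \<sigma>" i "r @ [False]" k c ks] exit(3) unfolding exit(1,2) pad_def
    by (simp add: pad_stacks_same)
qed

lemma halts_if_pad_halts:
  assumes "step\<^sup>*\<^sup>* C e" "terminal e" "valid c" "pad c = C"
  shows "\<exists>d. step\<^sup>*\<^sup>* c d \<and> terminal d"
  using assms(1,3,4)
proof (induction arbitrary: c rule: converse_rtranclp_induct)
  case base
  then have "terminal c" using assms(2) pad_step by (auto simp: terminal_def)
  then show ?case by blast
next
  case (step y z)
  show ?case
  proof (cases "terminal c")
    case False
    then obtain c' where c': "step c c'" by (auto simp: terminal_def)
    then have "step y (pad c')" using pad_step step.prems by blast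
    then have "pad c' = z" using step.hyps(1) step_deterministic by blast
    then obtain d where "step\<^sup>*\<^sup>* c' d" "terminal d" using step.IH valid_step[OF c' step.prems(1)] by blast
    with c' show ?thesis by (meson converse_rtranclp_into_rtranclp)
  qed blast
qed

lemma pad_is_conf_at:
  assumes "valid (Some (k, Some ks, \<sigma>))"
  shows "\<exists>s j. pad (Some (k, Some ks, \<sigma>)) = conf_at K k ks s j"
proof -
  have "\<exists>n r. bs @ [False] = replicate n True @ False # r" for bs
  proof (induction bs)
    case (Cons b bs)
    then obtain n r where nr: "bs @ [False] = replicate n True @ False # r" by blast
    show ?case
    proof (cases b)
      case True
      then show ?thesis using nr by (intro exI[of _ "Suc n"]) auto
    next
      case False
      then show ?thesis by (intro exI[of _ 0]) auto
    qed
  qed (auto intro: exI[of _ 0])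
  then have "\<forall>i. \<exists>p. \<sigma> i @ [False] = replicate (fst p) True @ False # snd p" by simp
  from choice[OF this] obtain p where p: "\<forall>i. \<sigma> i @ [False] = replicate (fst (p i)) True @ False # snd (p i)" ..
  have "pad_stacks \<sigma> = stacks K (\<lambda>i. fst (p i)) (\<lambda>i. snd (p i))"
  proof
    fix i
    show "pad_stacks \<sigma> i = stacks K (\<lambda>i. fst (p i)) (\<lambda>i. snd (p i)) i"
      using assms p[rule_format, of i] by (simp add: pad_stacks_def stacks_def)
  qed
  then have "pad (Some (k, Some ks, \<sigma>)) = conf_at K k ks (\<lambda>i. fst (p i)) (\<lambda>i. snd (p i))"
    by (simp add: pad_def conf_at_def)
  then show ?thesis by blast
qed

lemma halts_if_terminates:
  assumes T: "\<And>ks s. ks \<in> Q \<Longrightarrow> terminates K ks s" and v: "valid c"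
  shows "\<exists>d. step\<^sup>*\<^sup>* c d \<and> terminal d"
proof (cases c)
  case None
  then show ?thesis using terminal_None by blast
next
  case (Some a)
  obtain k q \<sigma> where c: "c = Some (k, q, \<sigma>)" using Some by (cases a) auto
  show ?thesis
  proof (cases q)
    case None
    then show ?thesis using c terminal_stuck by blast
  next
    case q: (Some ks)
    then obtain s j where "pad c = conf_at K k ks s j" using pad_is_conf_at v c by blast
    moreover have "terminates K ks s" using T v c q by simp
    moreover have "terminal (conf_at K k' [] s' j)" for k' s' by (simp add: conf_at_def terminal_stuck)
    ultimately have "\<exists>e. step\<^sup>*\<^sup>* (pad c) e \<and> terminal e"
      unfolding terminates_def dies_def reach_def using terminal_None by metis
    then show ?thesis using halts_if_pad_halts v by blast
  qed
qed

end


text \<open>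
Evaluation in which every minimization tries only arguments below \<open>t\<close>.  It fails by returning \<open>None\<close>,
also when the argument list has the wrong length.
\<close>

section \<open>Evaluation with bounded minimization\<close>

fun bounded_eval :: "recf \<Rightarrow> nat \<Rightarrow> nat list \<Rightarrow> nat option" where
  "bounded_eval Zero t xs = Some 0"
| "bounded_eval Succ t xs = (if length xs = 1 then Some (Suc (xs ! 0)) else None)"
| "bounded_eval (Proj i) t xs = (if i < length xs then Some (xs ! i) else None)"
| "bounded_eval (Comp h gs) t xs =
    (if None \<in> set (map (\<lambda>g. bounded_eval g t xs) gs) then None else bounded_eval h t (map (\<lambda>g. the (bounded_eval g t xs)) gs))"
| "bounded_eval (PrimRec f g) t [] = None"
| "bounded_eval (PrimRec f g) t (n # xs) =
    rec_nat (bounded_eval f t xs) (\<lambda>m acc. case acc of None \<Rightarrow> None | Some y \<Rightarrow> bounded_eval g t (m # y # xs)) n"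
| "bounded_eval (Mu f) t xs =
    (if \<exists>n<t. bounded_eval f t (n # xs) = Some 0 \<and> (\<forall>m<n. \<exists>y. bounded_eval f t (m # xs) = Some (Suc y))
     then Some (LEAST n. bounded_eval f t (n # xs) = Some 0) else None)"

lemma bounded_eval_Mu_eq:
  assumes "n < t" "bounded_eval f t (n # xs) = Some 0" "\<forall>m<n. \<exists>y. bounded_eval f t (m # xs) = Some (Suc y)"
  shows "bounded_eval (Mu f) t xs = Some n"
proof -
  have "(LEAST n. bounded_eval f t (n # xs) = Some 0) = n"
  proof (rule Least_equality)
    fix m assume "bounded_eval f t (m # xs) = Some 0"
    then show "n \<le> m" using assms(3) by (metis not_le option.inject nat.distinct(1))
  qed (rule assms(2))
  moreover have "\<exists>n<t. bounded_eval f t (n # xs) = Some 0 \<and> (\<forall>m<n. \<exists>y. bounded_eval f t (m # xs) = Some (Suc y))"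
    using assms by blast
  ultimately show ?thesis by simp
qed

lemma bounded_eval_sound: "bounded_eval r t xs = Some y \<Longrightarrow> rec_eval r xs y"
proof (induction r arbitrary: xs y)
  case Zero
  then show ?case by (auto intro: rec_eval.zero)
next
  case Succ
  then show ?case by (auto simp: length_Suc_conv intro: rec_eval.succ split: if_splits)
next
  case (Proj i)
  then show ?case by (auto intro: rec_eval.proj split: if_splits)
next
  case (Comp h gs)
  then have "None \<notin> set (map (\<lambda>g. bounded_eval g t xs) gs)" and h: "bounded_eval h t (map (\<lambda>g. the (bounded_eval g t xs)) gs) = Some y"
    by (auto split: if_splits)
  then have ne: "\<forall>g\<in>set gs. bounded_eval g t xs \<noteq> None" by (auto simp: image_iff eq_commute[of None])
  have "list_all2 (\<lambda>g y. rec_eval g xs y) gs (map (\<lambda>g. the (bounded_eval g t xs)) gs)"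
    using ne Comp.IH(2) by (auto simp: list_all2_conv_all_nth)
  then show ?case using Comp.IH(1)[OF h] by (rule rec_eval.comp)
next
  case (PrimRec f g)
  obtain n as where xs: "xs = n # as" using PrimRec.prems by (cases xs) auto
  have "bounded_eval (PrimRec f g) t (n # as) = Some y \<Longrightarrow> rec_eval (PrimRec f g) (n # as) y" for n y
  proof (induction n arbitrary: y)
    case 0
    then show ?case using PrimRec.IH(1) by (auto intro: rec_eval.primrec_0)
  next
    case (Suc n)
    then obtain z where z: "bounded_eval (PrimRec f g) t (n # as) = Some z" "bounded_eval g t (n # z # as) = Some y"
      by (auto split: option.splits)
    then show ?case using Suc.IH PrimRec.IH(2) by (blast intro: rec_eval.primrec_Suc)
  qed
  then show ?case using PrimRec.prems xs by blast
next
  case (Mu f)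
  then obtain n where n: "n < t" "bounded_eval f t (n # xs) = Some 0" "\<forall>m<n. \<exists>y. bounded_eval f t (m # xs) = Some (Suc y)"
    by (auto split: if_splits)
  then have "y = n" using bounded_eval_Mu_eq[OF n] Mu.prems by simp
  moreover have "rec_eval (Mu f) xs n"
    using n Mu.IH by (intro rec_eval.mu) blast+
  ultimately show ?case by simp
qed

lemma bounded_eval_complete: "rec_eval r xs y \<Longrightarrow> \<exists>t0. \<forall>t\<ge>t0. bounded_eval r t xs = Some y"
proof (induction rule: rec_eval.induct)
  case (comp xs gs ys h z)
  have "\<exists>t0. \<forall>t\<ge>t0. map (\<lambda>g. bounded_eval g t xs) gs = map Some ys"
    using comp.IH(1)
  proof (induction rule: list_all2_induct)
    case (Cons g gs y ys)
    then obtain t1 t2 where "\<forall>t\<ge>t1. bounded_eval g t xs = Some y" "\<forall>t\<ge>t2. map (\<lambda>g. bounded_eval g t xs) gs = map Some ys" by blast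
    then show ?case by (intro exI[of _ "max t1 t2"]) simp
  qed simp
  then obtain t1 t2 where t1: "\<And>t. t \<ge> t1 \<Longrightarrow> map (\<lambda>g. bounded_eval g t xs) gs = map Some ys"
    and t2: "\<And>t. t \<ge> t2 \<Longrightarrow> bounded_eval h t ys = Some z" using comp.IH(2) by blast
  have "bounded_eval (Comp h gs) t xs = Some z" if t: "t \<ge> max t1 t2" for t
  proof -
    have m: "map (\<lambda>g. bounded_eval g t xs) gs = map Some ys" using t1 t by simp
    have "map (\<lambda>g. the (bounded_eval g t xs)) gs = map the (map (\<lambda>g. bounded_eval g t xs) gs)" by simp
    also have "\<dots> = ys" unfolding m by (simp add: comp_def)
    finally have "map (\<lambda>g. the (bounded_eval g t xs)) gs = ys" .
    moreover have "None \<notin> set (map (\<lambda>g. bounded_eval g t xs) gs)" unfolding m by auto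
    ultimately show ?thesis using t2[of t] t by simp
  qed
  then show ?case by blast
next
  case (primrec_Suc f g n xs y z)
  then obtain t1 t2 where "\<forall>t\<ge>t1. bounded_eval (PrimRec f g) t (n # xs) = Some y" "\<forall>t\<ge>t2. bounded_eval g t (n # y # xs) = Some z"
    by blast
  then show ?case by (intro exI[of _ "max t1 t2"]) simp
next
  case (mu f n xs)
  obtain t1 where t1: "\<And>t. t \<ge> t1 \<Longrightarrow> bounded_eval f t (n # xs) = Some 0" using mu.IH(1) by blast
  have "\<forall>m<n. \<exists>t0. \<forall>t\<ge>t0. \<exists>y. bounded_eval f t (m # xs) = Some (Suc y)" using mu.IH(2) by blast
  then obtain T where T: "\<And>m t. m < n \<Longrightarrow> t \<ge> T m \<Longrightarrow> \<exists>y. bounded_eval f t (m # xs) = Some (Suc y)" by metis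
  define t0 where "t0 = Max ({t1, Suc n} \<union> T ` {..<n})"
  have t0: "t1 \<le> t0" "Suc n \<le> t0" "\<And>m. m < n \<Longrightarrow> T m \<le> t0"
    unfolding t0_def by (rule Max_ge; force)+
  have "bounded_eval (Mu f) t xs = Some n" if "t \<ge> t0" for t
  proof (rule bounded_eval_Mu_eq)
    show "\<forall>m<n. \<exists>y. bounded_eval f t (m # xs) = Some (Suc y)"
      using T t0(3) that by (meson order_trans)
  qed (use that t0 t1 in auto)
  then show ?case by blast
qed auto


text \<open>
Loops consume their counter, so copying \<open>x\<close> to \<open>y\<close> restores \<open>x\<close> from the auxiliary register \<open>z\<close>.
\<close>

section \<open>Compilation to loop programs\<close>

definition copy :: "nat \<Rightarrow> nat \<Rightarrow> nat \<Rightarrow> cmd list" where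
  "copy x y z = [Loop y [], Loop z [], Loop x [Inc y, Inc z], Loop z [Inc x]]"

lemma run_clear: "run (Loop i []) s = s(i := 0)"
proof -
  have "(fold run [] ^^ n) s = s" for n and s :: "nat \<Rightarrow> nat" by (induction n) auto
  then show ?thesis by (simp del: fun_upd_apply)
qed

lemma pow_Inc: "(fold run [Inc y] ^^ n) s = s(y := s y + n)"
  by (induction n) auto

lemma pow_Inc2: "y \<noteq> z \<Longrightarrow> (fold run [Inc y, Inc z] ^^ n) s = s(y := s y + n, z := s z + n)"
  by (induction n) (auto simp: fun_eq_iff)

lemma run_Loop_Inc: "run (Loop x [Inc y]) s = (s(x := 0))(y := (s(x := 0)) y + s x)"
  unfolding run_Loop pow_Inc ..

lemma run_Loop_Inc2: "y \<noteq> z \<Longrightarrow> run (Loop x [Inc y, Inc z]) s =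
    (s(x := 0))(y := (s(x := 0)) y + s x, z := (s(x := 0)) z + s x)"
  unfolding run_Loop by (rule pow_Inc2)

lemma run_copy:
  assumes "x \<noteq> y" "x \<noteq> z" "y \<noteq> z"
  shows "fold run (copy x y z) s = s(y := s x, z := 0)"
  unfolding copy_def using assms
  by (simp add: run_clear run_Loop_Inc run_Loop_Inc2 del: run_Loop) (auto simp: fun_eq_iff)

text \<open>
Register 1 holds the bound \<open>t\<close> and register 3 counts failures; \<open>as\<close> lists the argument registers, the
result goes to register \<open>b\<close>, and all registers from \<open>b\<close> on are scratch space.

For \<open>PrimRec\<close>, register \<open>b\<close> accumulates the value, \<open>b + 1\<close> the recursion argument, and
\<open>b + 2\<close> the number of iterations left.  For \<open>Mu\<close>, register \<open>b\<close> is the current candidate and \<open>b + 1\<close>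
is \<open>1\<close> as long as the search goes on; the body of the loop on \<open>b + 1\<close> must not write to it, so the new
value is prepared in \<open>b + 2\<close>.  A search still going on at the end is a failure.
\<close>

fun compile :: "recf \<Rightarrow> nat list \<Rightarrow> nat \<Rightarrow> cmd list"
  and compile_all :: "recf list \<Rightarrow> nat list \<Rightarrow> nat \<Rightarrow> cmd list" where
  "compile Zero as b = [Loop b []]"
| "compile Succ as b = (if length as = 1 then copy (as ! 0) b (b + 1) @ [Inc b] else [Inc 3])"
| "compile (Proj i) as b = (if i < length as then copy (as ! i) b (b + 1) else [Inc 3])"
| "compile (Comp h gs) as b =
    (let l = length gs in
     compile_all gs as (b + 1) @ compile h [b + 1..<b + 1 + l] (b + 1 + l) @ copy (b + 1 + l) b (b + 2 + l))"
| "compile (PrimRec f g) [] b = [Inc 3]"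
| "compile (PrimRec f g) (x # as) b =
    compile f as (b + 3) @ copy (b + 3) b (b + 4) @ [Loop (b + 1) []] @ copy x (b + 2) (b + 3) @
    [Loop (b + 2) (compile g ((b + 1) # b # as) (b + 3) @ copy (b + 3) b (b + 4) @ [Inc (b + 1)])]"
| "compile (Mu f) as b =
    [Loop b [], Loop (b + 1) [], Inc (b + 1)] @ copy 1 (b + 3) (b + 4) @
    [Loop (b + 3)
      [Loop (b + 2) [],
       Loop (b + 1) (compile f (b # as) (b + 4) @ [Loop (b + 4) [Loop (b + 2) [], Inc (b + 2)]]),
       Loop (b + 2) [Inc (b + 1), Inc b]],
     Loop (b + 1) [Inc 3]]"
| "compile_all [] as b = []"
| "compile_all (g # gs) as b = compile g as b @ compile_all gs as (b + 1)"

definition ok_cmds :: "nat set \<Rightarrow> cmd list \<Rightarrow> bool" where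
  "ok_cmds V c \<longleftrightarrow> (\<forall>x\<in>set c. bounded_loops x \<and> total x \<and> regs x \<subseteq> V)"

lemma ok_cmds_simps:
  "ok_cmds V []" "ok_cmds V (x # c) \<longleftrightarrow> bounded_loops x \<and> total x \<and> regs x \<subseteq> V \<and> ok_cmds V c"
  "ok_cmds V (c @ d) \<longleftrightarrow> ok_cmds V c \<and> ok_cmds V d"
  by (auto simp: ok_cmds_def)

lemma ok_cmds_mono: "ok_cmds V c \<Longrightarrow> V \<subseteq> W \<Longrightarrow> ok_cmds W c"
  by (auto simp: ok_cmds_def)

lemma ok_Loop:
  assumes "ok_cmds W c" "i \<notin> W" "W \<subseteq> V" "i \<in> V"
  shows "bounded_loops (Loop i c) \<and> total (Loop i c) \<and> regs (Loop i c) \<subseteq> V"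
  using assms by (auto simp: ok_cmds_def)

lemma ok_copy: "x \<noteq> y \<Longrightarrow> y \<noteq> z \<Longrightarrow> x \<noteq> z \<Longrightarrow> {x, y, z} \<subseteq> V \<Longrightarrow> ok_cmds V (copy x y z)"
  by (auto simp: ok_cmds_def copy_def)

text \<open>
Arguments are the input register 0 or lie in the scratch space; in particular, the special registers 1 to 3
are not among them.
\<close>

definition arg_regs :: "nat list \<Rightarrow> nat \<Rightarrow> bool" where
  "arg_regs as b \<longleftrightarrow> b \<ge> 4 \<and> set as \<subseteq> {0} \<union> {4..<b}"

lemma arg_regs_less: "arg_regs as b \<Longrightarrow> x \<in> set as \<Longrightarrow> x < b \<and> x \<noteq> 1 \<and> x \<noteq> 3"
  by (auto simp: arg_regs_def)

abbreviation workspace :: "nat list \<Rightarrow> nat \<Rightarrow> nat set" where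
  "workspace as b \<equiv> {1, 3} \<union> set as \<union> {b..}"

lemma ok_compile:
  shows "arg_regs as b \<Longrightarrow> ok_cmds (workspace as b) (compile r as b)"
    and "arg_regs as b \<Longrightarrow> ok_cmds (workspace as b) (compile_all gs as b)"
proof (induction r as b and gs as b rule: compile_compile_all.induct)
  case (1 as b)
  then show ?case by (auto simp: ok_cmds_def)
next
  case (2 as b)
  then have "as ! 0 < b \<and> as ! 0 \<in> set as" if "length as = 1"
    using that by (cases as) (auto simp: arg_regs_def)
  then show ?case by (auto simp: ok_cmds_simps intro!: ok_copy)
next
  case (3 i as b)
  then have "as ! i < b \<and> as ! i \<in> set as" if "i < length as"
    using that arg_regs_less[OF 3 nth_mem[OF that]] by simp
  then show ?case by (auto simp: ok_cmds_simps intro!: ok_copy)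
next
  case (4 h gs as b)
  let ?l = "length gs"
  have "arg_regs as (b + 1)" "arg_regs [b + 1..<b + 1 + ?l] (b + 1 + ?l)"
    using 4(3) by (auto simp: arg_regs_def)
  then have "ok_cmds (workspace as (b + 1)) (compile_all gs as (b + 1))"
    "ok_cmds (workspace [b + 1..<b + 1 + ?l] (b + 1 + ?l)) (compile h [b + 1..<b + 1 + ?l] (b + 1 + ?l))"
    using 4(1,2) by simp_all
  then show ?case
    by (auto simp: ok_cmds_simps Let_def intro!: ok_copy elim!: ok_cmds_mono)
next
  case (5 f g b)
  then show ?case by (auto simp: ok_cmds_def)
next
  case (6 f g x as b)
  have "arg_regs as (b + 3)" "arg_regs ((b + 1) # b # as) (b + 3)" and x: "x < b"
    using 6(3) by (auto simp: arg_regs_def)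
  then have f: "ok_cmds (workspace as (b + 3)) (compile f as (b + 3))"
    and g: "ok_cmds (workspace ((b + 1) # b # as) (b + 3)) (compile g ((b + 1) # b # as) (b + 3))"
    using 6(1,2) by simp_all
  have as: "\<forall>i\<in>set as. i < b" "b \<ge> 4" using 6(3) by (auto simp: arg_regs_def)
  have "bounded_loops (Loop (b + 2) (compile g ((b + 1) # b # as) (b + 3) @ copy (b + 3) b (b + 4) @ [Inc (b + 1)])) \<and>
     total (Loop (b + 2) (compile g ((b + 1) # b # as) (b + 3) @ copy (b + 3) b (b + 4) @ [Inc (b + 1)])) \<and>
     regs (Loop (b + 2) (compile g ((b + 1) # b # as) (b + 3) @ copy (b + 3) b (b + 4) @ [Inc (b + 1)])) \<subseteq> workspace (x # as) b"
    by (rule ok_Loop[of "workspace ((b + 1) # b # as) (b + 3)"])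
      (use g as in \<open>auto simp: ok_cmds_simps intro!: ok_copy\<close>)
  moreover have "ok_cmds (workspace (x # as) b) (compile f as (b + 3))"
    using f by (rule ok_cmds_mono) auto
  ultimately show ?case using x
    by (auto simp: ok_cmds_simps intro!: ok_copy)
next
  case (7 f as b)
  have "arg_regs (b # as) (b + 4)" using 7(2) by (auto simp: arg_regs_def)
  then have f: "ok_cmds (workspace (b # as) (b + 4)) (compile f (b # as) (b + 4))" using 7(1) by simp
  have as: "\<forall>i\<in>set as. i < b" "b \<ge> 4" using 7(2) by (auto simp: arg_regs_def)
  let ?c1 = "compile f (b # as) (b + 4) @ [Loop (b + 4) [Loop (b + 2) [], Inc (b + 2)]]"
  let ?W1 = "workspace (b # as) (b + 4) \<union> {b + 2}"
  have "ok_cmds ?W1 (compile f (b # as) (b + 4))" using f by (rule ok_cmds_mono) auto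
  then have "ok_cmds ?W1 ?c1" by (auto simp: ok_cmds_simps)
  then have "bounded_loops (Loop (b + 1) ?c1) \<and> total (Loop (b + 1) ?c1) \<and> regs (Loop (b + 1) ?c1) \<subseteq> insert (b + 1) ?W1"
    by (rule ok_Loop) (use as in auto)
  then have "ok_cmds (insert (b + 1) ?W1) [Loop (b + 2) [], Loop (b + 1) ?c1, Loop (b + 2) [Inc (b + 1), Inc b]]"
    by (auto simp: ok_cmds_simps)
  then have "bounded_loops (Loop (b + 3) [Loop (b + 2) [], Loop (b + 1) ?c1, Loop (b + 2) [Inc (b + 1), Inc b]]) \<and>
     total (Loop (b + 3) [Loop (b + 2) [], Loop (b + 1) ?c1, Loop (b + 2) [Inc (b + 1), Inc b]]) \<and>
     regs (Loop (b + 3) [Loop (b + 2) [], Loop (b + 1) ?c1, Loop (b + 2) [Inc (b + 1), Inc b]]) \<subseteq> workspace as b"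
    by (rule ok_Loop) (use as in auto)
  then show ?case using as
    by (auto simp: ok_cmds_simps intro!: ok_copy)
next
  case (8 as b)
  then show ?case by (simp add: ok_cmds_simps)
next
  case (9 g gs as b)
  have "arg_regs as (b + 1)" using 9(3) by (auto simp: arg_regs_def)
  then have "ok_cmds (workspace as (b + 1)) (compile_all gs as (b + 1))" using 9 by simp
  then have "ok_cmds (workspace as b) (compile_all gs as (b + 1))" by (rule ok_cmds_mono) auto
  then show ?case using 9 by (simp add: ok_cmds_simps)
qed


text \<open>
After a failure the registers from \<open>b\<close> on are arbitrary.  Failures are only counted up, so later code
cannot undo them.
\<close>

definition outcome :: "nat \<Rightarrow> (nat \<Rightarrow> nat) \<Rightarrow> nat option \<Rightarrow> (nat \<Rightarrow> nat) \<Rightarrow> bool" where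
  "outcome b s v s' \<longleftrightarrow> (\<forall>i<b. i \<noteq> 3 \<longrightarrow> s' i = s i) \<and>
     (case v of Some y \<Rightarrow> s' 3 = s 3 \<and> s' b = y | None \<Rightarrow> s' 3 > s 3)"

lemma outcome_mono: "outcome b s v s' \<Longrightarrow> s 3 \<le> s' 3"
  by (auto simp: outcome_def split: option.splits)

lemma outcome_other: "outcome b s v s' \<Longrightarrow> i < b \<Longrightarrow> i \<noteq> 3 \<Longrightarrow> s' i = s i"
  by (simp add: outcome_def)

lemma outcome_args:
  assumes "outcome b' s v s'" "arg_regs as b" "b \<le> b'"
  shows "map s' as = map s as"
proof (rule map_cong[OF HOL.refl])
  fix x assume "x \<in> set as"
  then show "s' x = s x"
    using arg_regs_less[OF assms(2)] assms(3) by (intro outcome_other[OF assms(1)]) (auto intro: less_le_trans)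
qed

lemma arg_regs_mono: "arg_regs as b \<Longrightarrow> b \<le> c \<Longrightarrow> arg_regs as c"
  by (auto simp: arg_regs_def)

definition correct :: "recf \<Rightarrow> bool" where
  "correct r \<longleftrightarrow> (\<forall>as b s. arg_regs as b \<longrightarrow>
     outcome b s (bounded_eval r (s 1) (map s as)) (fold run (compile r as b) s))"

lemma correct_simple: "correct Zero" "correct Succ" "correct (Proj i)"
proof -
  show "correct Zero"
    by (auto simp: correct_def outcome_def run_clear arg_regs_def simp del: run_Loop)
  have F: "b \<noteq> 3" if "arg_regs as b" for as b using that by (simp add: arg_regs_def)
  have A: "as ! i < b" if "arg_regs as b" "i < length as" for as b i
    using arg_regs_less[OF that(1) nth_mem[OF that(2)]] by simp
  show "correct Succ"
    unfolding correct_def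
  proof (intro allI impI)
    fix as b s assume a: "arg_regs as b"
    show "outcome b s (bounded_eval Succ (s 1) (map s as)) (fold run (compile Succ as b) s)"
    proof (cases "length as = 1")
      case True
      then have "as ! 0 < b" using A[OF a] by simp
      then show ?thesis using True a
        by (auto simp: outcome_def run_copy arg_regs_def)
    next
      case False
      then show ?thesis using a by (auto simp: outcome_def)
    qed
  qed
  show "correct (Proj i)"
    unfolding correct_def
  proof (intro allI impI)
    fix as b s assume a: "arg_regs as b"
    show "outcome b s (bounded_eval (Proj i) (s 1) (map s as)) (fold run (compile (Proj i) as b) s)"
    proof (cases "i < length as")
      case True
      then have "as ! i < b" using A[OF a] by simp
      then show ?thesis using True a
        by (auto simp: outcome_def run_copy arg_regs_def)
    next
      case False
      then show ?thesis using a by (auto simp: outcome_def)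
    qed
  qed
qed

lemma compile_all_correct:
  assumes "\<And>g. g \<in> set gs \<Longrightarrow> correct g" "arg_regs as b"
  defines "vs \<equiv> \<lambda>s. map (\<lambda>g. bounded_eval g (s 1) (map s as)) gs"
  shows "(\<forall>i<b. i \<noteq> 3 \<longrightarrow> fold run (compile_all gs as b) s i = s i) \<and>
    (if None \<in> set (vs s) then fold run (compile_all gs as b) s 3 > s 3
     else fold run (compile_all gs as b) s 3 = s 3 \<and>
       map Some (map (fold run (compile_all gs as b) s) [b..<b + length gs]) = vs s)"
  using assms(1,2) unfolding vs_def
proof (induction gs arbitrary: b s)
  case (Cons g gs)
  let ?s1 = "fold run (compile g as b) s"
  let ?s2 = "fold run (compile_all gs as (b + 1)) ?s1"
  have o: "outcome b s (bounded_eval g (s 1) (map s as)) ?s1"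
    using Cons.prems by (simp add: correct_def)
  have b: "1 < b" "3 < b" using Cons.prems(2) by (auto simp: arg_regs_def)
  have s1: "?s1 1 = s 1" "map ?s1 as = map s as"
    using outcome_other[OF o] outcome_args[OF o Cons.prems(2)] b by auto
  have a: "arg_regs as (b + 1)" using arg_regs_mono[OF Cons.prems(2)] by simp
  note IH = Cons.IH[of "b + 1" ?s1, OF _ a, unfolded s1]
  have fr: "\<forall>i<b. i \<noteq> 3 \<longrightarrow> ?s2 i = s i" "?s2 b = ?s1 b"
    using IH outcome_other[OF o] Cons.prems(1) b by auto
  show ?case
  proof (cases "bounded_eval g (s 1) (map s as)")
    case None
    then have "?s1 3 > s 3" using o by (simp add: outcome_def)
    moreover have "?s2 3 \<ge> ?s1 3" using IH Cons.prems(1) by (auto split: if_splits)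
    ultimately show ?thesis using fr None by simp
  next
    case (Some y)
    then have "?s1 3 = s 3" "?s1 b = y" using o by (auto simp: outcome_def)
    moreover have "[b..<b + length (g # gs)] = b # [b + 1..<b + 1 + length gs]"
      by (simp add: upt_rec)
    ultimately show ?thesis using fr Some IH Cons.prems(1) by (auto split: if_splits)
  qed
qed auto

lemma correct_Comp:
  assumes "correct h" "\<And>g. g \<in> set gs \<Longrightarrow> correct g"
  shows "correct (Comp h gs)"
  unfolding correct_def
proof (intro allI impI)
  fix as b s assume a: "arg_regs as b"
  let ?l = "length gs" and ?vs = "map (\<lambda>g. bounded_eval g (s 1) (map s as)) gs"
  define as' where "as' = [b + 1..<b + 1 + ?l]"
  define s1 where "s1 = fold run (compile_all gs as (b + 1)) s"
  define s2 where "s2 = fold run (compile h as' (b + 1 + ?l)) s1"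
  define s3 where "s3 = s2(b := s2 (b + 1 + ?l), b + 2 + ?l := 0)"
  have b: "4 \<le> b" using a by (simp add: arg_regs_def)
  have run: "fold run (compile (Comp h gs) as b) s = s3"
    by (simp add: Let_def run_copy s1_def s2_def s3_def as'_def)
  have c: "(\<forall>i<b + 1. i \<noteq> 3 \<longrightarrow> s1 i = s i) \<and>
    (if None \<in> set ?vs then s1 3 > s 3 else s1 3 = s 3 \<and> map Some (map s1 as') = ?vs)"
    unfolding s1_def as'_def
    by (rule compile_all_correct[OF assms(2)]) (use arg_regs_mono[OF a] in auto)
  have "arg_regs as' (b + 1 + ?l)" using b by (auto simp: arg_regs_def as'_def)
  then have o: "outcome (b + 1 + ?l) s1 (bounded_eval h (s1 1) (map s1 as')) s2"
    using assms(1) unfolding correct_def s2_def by blast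
  have fr: "\<forall>i<b. i \<noteq> 3 \<longrightarrow> s3 i = s i" using c outcome_other[OF o] by (auto simp: s3_def)
  have s1: "s1 1 = s 1" using c b by simp
  have s3: "s3 3 = s2 3" "s3 b = s2 (b + 1 + ?l)" using b by (auto simp: s3_def)
  show "outcome b s (bounded_eval (Comp h gs) (s 1) (map s as)) (fold run (compile (Comp h gs) as b) s)"
  proof (cases "None \<in> set ?vs")
    case True
    then have "s1 3 > s 3" using c by simp
    then have "s3 3 > s 3" using outcome_mono[OF o] s3 by simp
    then show ?thesis unfolding run outcome_def using fr True by simp
  next
    case False
    then have m: "s1 3 = s 3" "map Some (map s1 as') = ?vs" using c by auto
    have "map (\<lambda>g. the (bounded_eval g (s 1) (map s as))) gs = map the ?vs" by simp
    also have "\<dots> = map s1 as'" unfolding m(2)[symmetric] by (simp add: comp_def)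
    finally have "bounded_eval (Comp h gs) (s 1) (map s as) = bounded_eval h (s 1) (map s1 as')" using False by simp
    then show ?thesis unfolding run using o fr m(1) s1 s3
      by (auto simp: outcome_def split: option.splits)
  qed
qed

lemma correct_PrimRec:
  assumes "correct f" "correct g"
  shows "correct (PrimRec f g)"
  unfolding correct_def
proof (intro allI impI)
  fix as' b s assume a': "arg_regs as' b"
  have b: "4 \<le> b" using a' by (simp add: arg_regs_def)
  show "outcome b s (bounded_eval (PrimRec f g) (s 1) (map s as')) (fold run (compile (PrimRec f g) as' b) s)"
  proof (cases as')
    case Nil
    then show ?thesis using b by (auto simp: outcome_def)
  next
    case (Cons x as)
    have a: "arg_regs as b" "x < b" "x \<noteq> 3" using a' by (auto simp: arg_regs_def Cons)
    define e where "e n = bounded_eval (PrimRec f g) (s 1) (n # map s as)" for n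
    have e_Suc: "e (Suc n) = (case e n of None \<Rightarrow> None | Some y \<Rightarrow> bounded_eval g (s 1) (n # y # map s as))" for n
      by (simp add: e_def del: One_nat_def)
    define s1 where "s1 = fold run (compile f as (b + 3)) s"
    define s2 where "s2 = s1(b := s1 (b + 3), b + 4 := 0, b + 1 := 0, b + 2 := 0, b + 3 := 0)"
    let ?c = "compile g ((b + 1) # b # as) (b + 3) @ copy (b + 3) b (b + 4) @ [Inc (b + 1)]"
    have o1: "outcome (b + 3) s (bounded_eval f (s 1) (map s as)) s1"
      using assms(1) arg_regs_mono[OF a(1), of "b + 3"] unfolding correct_def s1_def by simp
    have s1: "s1 x = s x" using outcome_other[OF o1] a by simp
    define s' where "s' = s1(b := s1 (b + 3), b + 4 := 0)"
    have s': "s'(b + 1 := 0, b + 2 := s x, b + 3 := 0, b + 2 := 0) = s2"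
      unfolding s'_def s2_def by (auto simp: fun_eq_iff)
    have run: "fold run (compile (PrimRec f g) as' b) s = (fold run ?c ^^ s x) s2"
    proof -
      have "fold run (compile (PrimRec f g) as' b) s =
          run (Loop (b + 2) ?c) (fold run (copy x (b + 2) (b + 3)) (run (Loop (b + 1) []) (fold run (copy (b + 3) b (b + 4)) s1)))"
        by (simp add: Cons s1_def del: run_Loop)
      also have "fold run (copy (b + 3) b (b + 4)) s1 = s'" unfolding s'_def by (rule run_copy) auto
      also have "run (Loop (b + 1) []) s' = s'(b + 1 := 0)" by (rule run_clear)
      also have "fold run (copy x (b + 2) (b + 3)) (s'(b + 1 := 0)) = s'(b + 1 := 0, b + 2 := s x, b + 3 := 0)"
        using a s1 by (subst run_copy) (auto simp: s'_def fun_eq_iff)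
      also have "run (Loop (b + 2) ?c) \<dots> = (fold run ?c ^^ s x) (s'(b + 1 := 0, b + 2 := s x, b + 3 := 0, b + 2 := 0))"
        unfolding run_Loop by simp
      finally show ?thesis unfolding s' .
    qed
    have inv: "let t = (fold run ?c ^^ n) s2 in outcome b s (e n) t \<and> t (b + 1) = n" for n
    proof (induction n)
      case 0
      have "outcome b s (e 0) s2"
        using o1 b unfolding e_def by (auto simp: outcome_def s2_def split: option.splits)
      moreover have "s2 (b + 1) = 0" by (simp add: s2_def)
      ultimately show ?case by simp
    next
      case (Suc n)
      define t where "t = (fold run ?c ^^ n) s2"
      define u where "u = fold run (compile g ((b + 1) # b # as) (b + 3)) t"
      have IH: "outcome b s (e n) t" "t (b + 1) = n" using Suc unfolding Let_def t_def by blast+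
      have t: "t 1 = s 1" "map t as = map s as"
        using outcome_other[OF IH(1)] outcome_args[OF IH(1) a(1)] b by auto
      have "arg_regs ((b + 1) # b # as) (b + 3)" using a b by (auto simp: arg_regs_def)
      then have o: "outcome (b + 3) t (bounded_eval g (t 1) (map t ((b + 1) # b # as))) u"
        using assms(2) unfolding correct_def u_def by blast
      have "map t ((b + 1) # b # as) = n # t b # map s as" using IH(2) t(2) by simp
      note o = o[unfolded this t(1)]
      have "(fold run ?c ^^ Suc n) s2 = run (Inc (b + 1)) (fold run (copy (b + 3) b (b + 4)) u)"
        by (simp add: u_def t_def)
      also have "\<dots> = (u(b := u (b + 3), b + 4 := 0))(b + 1 := Suc (u (b + 1)))"
        by (subst run_copy) auto
      finally have v: "(fold run ?c ^^ Suc n) s2 = u(b := u (b + 3), b + 4 := 0, b + 1 := Suc (u (b + 1)))" .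
      have "u (b + 1) = n" using outcome_other[OF o, of "b + 1"] IH(2) b by simp
      moreover have "outcome b s (e (Suc n)) (u(b := u (b + 3), b + 4 := 0, b + 1 := Suc (u (b + 1))))"
        using o IH(1) b e_Suc[of n] by (auto simp: outcome_def split: option.splits)
      ultimately show ?case unfolding v Let_def by simp
    qed
    have "outcome b s (e (s x)) ((fold run ?c ^^ s x) s2)" using inv[of "s x"] by (simp add: Let_def)
    then show ?thesis unfolding run by (simp add: Cons e_def)
  qed
qed

text \<open>
The invariant of the search loop has three cases: still searching, found, or failed because an
evaluation before the first zero failed.  Evaluations beyond the first zero never take place, so they cannot
cause a failure.
\<close>

lemma correct_Mu:
  assumes "correct f"
  shows "correct (Mu f)"
  unfolding correct_def
proof (intro allI impI)
  fix as b s assume a: "arg_regs as b"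
  have b: "4 \<le> b" using a by (simp add: arg_regs_def)
  define e where "e n = bounded_eval f (s 1) (n # map s as)" for n
  define going where "going n \<longleftrightarrow> (\<forall>m<n. \<exists>y. e m = Some (Suc y))" for n
  let ?d = "[Loop (b + 4) [Loop (b + 2) [], Inc (b + 2)]]"
  let ?c1 = "compile f (b # as) (b + 4) @ ?d"
  let ?c = "[Loop (b + 2) [], Loop (b + 1) ?c1, Loop (b + 2) [Inc (b + 1), Inc b]]"
  define s0 where "s0 = s(b := 0, b + 1 := 1, b + 3 := 0, b + 4 := 0)"
  have run: "fold run (compile (Mu f) as b) s = run (Loop (b + 1) [Inc 3]) ((fold run ?c ^^ s 1) s0)"
  proof -
    have "fold run (compile (Mu f) as b) s =
      run (Loop (b + 1) [Inc 3]) (run (Loop (b + 3) ?c) (fold run (copy 1 (b + 3) (b + 4))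
        (run (Inc (b + 1)) (run (Loop (b + 1) []) (run (Loop b []) s)))))"
      by (simp del: run_Loop)
    also have "run (Inc (b + 1)) (run (Loop (b + 1) []) (run (Loop b []) s)) = s(b := 0, b + 1 := 1)"
      by (simp add: run_clear del: run_Loop)
    also have "fold run (copy 1 (b + 3) (b + 4)) (s(b := 0, b + 1 := 1)) =
       s(b := 0, b + 1 := 1, b + 3 := s 1, b + 4 := 0)"
      using b by (subst run_copy) auto
    also have "run (Loop (b + 3) ?c) (s(b := 0, b + 1 := 1, b + 3 := s 1, b + 4 := 0)) = (fold run ?c ^^ s 1) s0"
    proof -
      have "s(b := 0, b + 1 := 1, b + 3 := s 1, b + 4 := 0, b + 3 := 0) = s0"
        by (auto simp: s0_def fun_eq_iff)
      then show ?thesis unfolding run_Loop by simp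
    qed
    finally show ?thesis .
  qed
  have d: "fold run ?d u = u(b + 4 := 0, b + 2 := if u (b + 4) = 0 then u (b + 2) else 1)" for u
  proof -
    have p: "(fold run [Loop (b + 2) [], Inc (b + 2)] ^^ n) v = (if n = 0 then v else v(b + 2 := 1))" for n v
      by (induction n) (auto simp: run_clear simp del: run_Loop)
    have "fold run ?d u = (fold run [Loop (b + 2) [], Inc (b + 2)] ^^ u (b + 4)) (u(b + 4 := 0))"
      by simp
    then show ?thesis unfolding p by (auto simp: fun_eq_iff)
  qed
  have idle: "fold run ?c t = t(b + 2 := 0)" if "t (b + 1) = 0" for t
  proof -
    have "fold run ?c t = run (Loop (b + 2) [Inc (b + 1), Inc b]) (run (Loop (b + 1) ?c1) (t(b + 2 := 0)))"
      by (simp add: run_clear del: run_Loop)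
    also have "run (Loop (b + 1) ?c1) (t(b + 2 := 0)) = t(b + 2 := 0)"
      unfolding run_Loop using that by (simp add: fun_upd_idem)
    also have "run (Loop (b + 2) [Inc (b + 1), Inc b]) (t(b + 2 := 0)) = t(b + 2 := 0)"
      unfolding run_Loop by simp
    finally show ?thesis .
  qed
  have busy: "\<exists>u. outcome (b + 4) (t(b + 2 := 0, b + 1 := 0)) (bounded_eval f (t 1) (t b # map t as)) u \<and>
      fold run ?c t = u(b + 4 := 0, b + 2 := 0, b + 1 := (if u (b + 4) = 0 then 0 else 1),
        b := (if u (b + 4) = 0 then t b else Suc (t b)))" if t: "t (b + 1) = 1" for t
  proof -
    let ?t = "t(b + 2 := 0, b + 1 := 0)"
    define u where "u = fold run (compile f (b # as) (b + 4)) ?t"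
    have ab: "arg_regs (b # as) (b + 4)" using a b by (auto simp: arg_regs_def)
    then have o: "outcome (b + 4) ?t (bounded_eval f (?t 1) (map ?t (b # as))) u"
      using assms unfolding correct_def u_def by blast
    have "\<forall>i\<in>set as. i < b" using a b by (auto simp: arg_regs_def)
    then have "map ?t (b # as) = t b # map t as" "?t 1 = t 1" using b by auto
    note o' = o[unfolded this]
    have u: "u b = t b" "u (b + 1) = 0" "u (b + 2) = 0" using outcome_other[OF o] b by auto
    have "fold run ?c t = run (Loop (b + 2) [Inc (b + 1), Inc b]) (run (Loop (b + 1) ?c1) (t(b + 2 := 0)))"
      by (simp add: run_clear del: run_Loop)
    also have "run (Loop (b + 1) ?c1) (t(b + 2 := 0)) = fold run ?d u"
      unfolding run_Loop u_def using t by simp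
    also have "run (Loop (b + 2) [Inc (b + 1), Inc b]) (fold run ?d u) =
        u(b + 4 := 0, b + 2 := 0, b + 1 := (if u (b + 4) = 0 then 0 else 1),
          b := (if u (b + 4) = 0 then t b else Suc (t b)))"
      unfolding d using u by (subst run_Loop_Inc2) (auto simp: fun_eq_iff)
    finally show ?thesis using o' by blast
  qed
  have inv: "let t = (fold run ?c ^^ j) s0 in (\<forall>i<b. i \<noteq> 3 \<longrightarrow> t i = s i) \<and>
     (t (b + 1) = 1 \<and> t b = j \<and> going j \<and> t 3 = s 3 \<or>
      t (b + 1) = 0 \<and> t b < j \<and> going (t b) \<and> e (t b) = Some 0 \<and> t 3 = s 3 \<or>
      t (b + 1) \<le> 1 \<and> t 3 > s 3 \<and> (\<exists>n<j. going n \<and> e n = None))" for j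
  proof (induction j)
    case 0
    then show ?case using b by (auto simp: s0_def going_def)
  next
    case (Suc j)
    define t where "t = (fold run ?c ^^ j) s0"
    define t' where "t' = fold run ?c t"
    have t': "(fold run ?c ^^ Suc j) s0 = t'" by (simp add: t'_def t_def)
    have fr: "\<forall>i<b. i \<noteq> 3 \<longrightarrow> t i = s i" and
      cs: "t (b + 1) = 1 \<and> t b = j \<and> going j \<and> t 3 = s 3 \<or>
      t (b + 1) = 0 \<and> t b < j \<and> going (t b) \<and> e (t b) = Some 0 \<and> t 3 = s 3 \<or>
      t (b + 1) \<le> 1 \<and> t 3 > s 3 \<and> (\<exists>n<j. going n \<and> e n = None)"
      using Suc unfolding t_def[symmetric] Let_def by blast+
    have t: "map t as = map s as" "t 1 = s 1"
      using fr b arg_regs_less[OF a] by (auto intro!: map_cong)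
    have bounded_eval: "bounded_eval f (t 1) (t b # map t as) = e (t b)" unfolding t e_def ..
    consider (zero) "t (b + 1) = 0" | (one) "t (b + 1) = 1" using cs by linarith
    then have "(\<forall>i<b. i \<noteq> 3 \<longrightarrow> t' i = s i) \<and>
     (t' (b + 1) = 1 \<and> t' b = Suc j \<and> going (Suc j) \<and> t' 3 = s 3 \<or>
      t' (b + 1) = 0 \<and> t' b < Suc j \<and> going (t' b) \<and> e (t' b) = Some 0 \<and> t' 3 = s 3 \<or>
      t' (b + 1) \<le> 1 \<and> t' 3 > s 3 \<and> (\<exists>n<Suc j. going n \<and> e n = None))"
    proof cases
      case zero
      have "t' = t(b + 2 := 0)" unfolding t'_def using zero by (rule idle)
      then have eqs: "t' b = t b" "t' (b + 1) = 0" "\<forall>i<b. t' i = t i" "t' 3 = t 3"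
        using b zero by auto
      from cs zero consider (found) "t b < j" "going (t b)" "e (t b) = Some 0" "t 3 = s 3"
        | (fail) n where "t 3 > s 3" "n < j" "going n" "e n = None" by auto
      then show ?thesis
      proof cases
        case found
        then show ?thesis using eqs fr by simp
      next
        case fail
        then have "\<exists>n<Suc j. going n \<and> e n = None" using less_SucI by blast
        then show ?thesis using eqs fr fail(1) by simp
      qed
    next
      case one
      obtain u where o: "outcome (b + 4) (t(b + 2 := 0, b + 1 := 0)) (e (t b)) u"
        and u: "t' = u(b + 4 := 0, b + 2 := 0, b + 1 := (if u (b + 4) = 0 then 0 else 1),
          b := (if u (b + 4) = 0 then t b else Suc (t b)))"
        using busy[of t, OF one] unfolding t'_def[symmetric] bounded_eval by blast
      have fr': "\<forall>i<b. i \<noteq> 3 \<longrightarrow> t' i = s i"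
        using fr outcome_other[OF o] by (auto simp: u)
      have t'3: "t' 3 = u 3" and t'1: "t' (b + 1) = (if u (b + 4) = 0 then 0 else 1)"
        and t'b: "t' b = (if u (b + 4) = 0 then t b else Suc (t b))"
        using b by (auto simp: u)
      have le: "t 3 \<le> t' 3" using outcome_mono[OF o] b t'3 by simp
      from cs one consider (go) "t b = j" "going j" "t 3 = s 3"
        | (fail) n where "t 3 > s 3" "n < j" "going n" "e n = None" by auto
      then show ?thesis
      proof cases
        case fail
        then have "\<exists>n<Suc j. going n \<and> e n = None" using less_SucI by blast
        then show ?thesis using fr' le t'1 fail(1) by simp
      next
        case go
        show ?thesis
        proof (cases "e j")
          case None
          then have "t' 3 > s 3" using o go b t'3 by (simp add: outcome_def)
          then show ?thesis using fr' None go t'1 by auto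
        next
          case (Some y)
          then have "t' 3 = s 3" "u (b + 4) = y" using o go b t'3 by (auto simp: outcome_def)
          moreover have "going (Suc j)" if "y \<noteq> 0"
            using go Some that by (auto simp: going_def less_Suc_eq gr0_conv_Suc)
          ultimately show ?thesis using fr' Some go t'1 t'b by (cases "y = 0") auto
        qed
      qed
    qed
    then show ?case unfolding t' Let_def .
  qed
  define t where "t = (fold run ?c ^^ s 1) s0"
  define t' where "t' = run (Loop (b + 1) [Inc 3]) t"
  have fr: "\<forall>i<b. i \<noteq> 3 \<longrightarrow> t i = s i" and
    cs: "t (b + 1) = 1 \<and> t b = s 1 \<and> going (s 1) \<and> t 3 = s 3 \<or>
    t (b + 1) = 0 \<and> t b < s 1 \<and> going (t b) \<and> e (t b) = Some 0 \<and> t 3 = s 3 \<or>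
    t (b + 1) \<le> 1 \<and> t 3 > s 3 \<and> (\<exists>n<s 1. going n \<and> e n = None)"
    using inv[of "s 1"] unfolding t_def[symmetric] Let_def by blast+
  have "t' = t(b + 1 := 0, 3 := t 3 + t (b + 1))"
    unfolding t'_def run_Loop_Inc using b by simp
  then have t': "\<forall>i<b. i \<noteq> 3 \<longrightarrow> t' i = s i" "t' 3 = t 3 + t (b + 1)" "t' b = t b"
    using fr b by auto
  let ?v = "bounded_eval (Mu f) (s 1) (map s as)"
  have none: "?v = None" if "\<And>n. n < s 1 \<Longrightarrow> e n = Some 0 \<Longrightarrow> \<not> going n"
    using that unfolding e_def going_def by (auto split: if_splits)
  from cs consider (unbounded) "t (b + 1) = 1" "going (s 1)" "t 3 = s 3"
    | (found) "t (b + 1) = 0" "t b < s 1" "going (t b)" "e (t b) = Some 0" "t 3 = s 3"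
    | (failed) n where "t 3 > s 3" "n < s 1" "going n" "e n = None" by auto
  then have "outcome b s ?v t'"
  proof cases
    case unbounded
    then have "?v = None" by (intro none) (fastforce simp: going_def)
    then show ?thesis using t' unbounded by (simp add: outcome_def)
  next
    case found
    have "?v = Some (t b)"
      using found unfolding going_def e_def by (intro bounded_eval_Mu_eq) auto
    then show ?thesis using t' found by (simp add: outcome_def)
  next
    case failed
    have "?v = None"
    proof (rule none)
      fix m assume m: "e m = Some 0"
      show "\<not> going m"
      proof
        assume g: "going m"
        consider "m < n" | "m = n" | "m > n" by linarith
        then show False using m g failed(3,4) unfolding going_def by cases fastforce+
      qed
    qed
    then show ?thesis using t' failed by (simp add: outcome_def)
  qed
  then show "outcome b s ?v (fold run (compile (Mu f) as b) s)"
    unfolding run t'_def t_def .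
qed

lemma compile_correct: "correct r"
  by (induction r) (auto intro: correct_simple correct_Comp correct_PrimRec correct_Mu)


text \<open>
One round of the search: increase the bound, evaluate at the input in register 0, and set register 2 to
\<open>1\<close> if the evaluation failed and to \<open>0\<close> otherwise.
\<close>

section \<open>Unbounded search that halts everywhere\<close>

definition body :: "recf \<Rightarrow> cmd list" where
  "body r = [Inc 1, Loop 3 []] @ compile r [0] 4 @ [Loop 2 [], Loop 3 [Loop 2 [], Inc 2]]"

text \<open>
The loop on register 2 is unbounded, since its body writes to register 2.
\<close>

definition search :: "recf \<Rightarrow> cmd list \<Rightarrow> cmd list" where
  "search r ep = Inc 2 # Loop 2 (body r) # ep"

lemma ok_body: "ok_cmds UNIV (body r)"
proof -
  have "ok_cmds UNIV (compile r [0] 4)"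
    by (rule ok_cmds_mono[OF ok_compile(1)]) (auto simp: arg_regs_def)
  then show ?thesis by (auto simp: body_def ok_cmds_simps)
qed

lemma run_body:
  fixes r :: recf and s :: "nat \<Rightarrow> nat"
  defines "v \<equiv> \<lambda>s. bounded_eval r (Suc (s 1)) [s 0]"
  shows "fold run (body r) s 0 = s 0" "fold run (body r) s 1 = Suc (s 1)"
    "fold run (body r) s 2 = (if v s = None then 1 else 0)"
    "v s = Some y \<Longrightarrow> fold run (body r) s 4 = y"
proof -
  define s1 where "s1 = s(1 := Suc (s 1), 3 := 0)"
  define s2 where "s2 = fold run (compile r [0] 4) s1"
  have "outcome 4 s1 (bounded_eval r (s1 1) (map s1 [0])) s2"
  proof -
    have "arg_regs [0] 4" by (simp add: arg_regs_def)
    then show ?thesis using compile_correct[of r] unfolding correct_def s2_def by blast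
  qed
  then have o: "outcome 4 s1 (v s) s2" by (simp add: s1_def v_def)
  have p: "(fold run [Loop 2 [], Inc 2] ^^ n) u = (if n = 0 then u else u(2 := 1))" for n and u
    by (induction n) (auto simp: run_clear simp del: run_Loop)
  have "fold run (body r) s = run (Loop 3 [Loop 2 [], Inc 2]) (run (Loop 2 []) s2)"
    by (simp add: body_def run_clear s2_def s1_def del: run_Loop)
  also have "run (Loop 2 []) s2 = s2(2 := 0)" by (rule run_clear)
  also have "run (Loop 3 [Loop 2 [], Inc 2]) (s2(2 := 0)) = s2(3 := 0, 2 := if s2 3 = 0 then 0 else 1)"
    unfolding run_Loop p by (auto simp: fun_eq_iff)
  finally have eq: "fold run (body r) s = s2(3 := 0, 2 := if s2 3 = 0 then 0 else 1)" .
  show "fold run (body r) s 0 = s 0" "fold run (body r) s 1 = Suc (s 1)"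
    unfolding eq using outcome_other[OF o] by (simp_all add: s1_def)
  show "fold run (body r) s 2 = (if v s = None then 1 else 0)"
    unfolding eq using o by (auto simp: outcome_def s1_def split: option.splits)
  show "fold run (body r) s 4 = y" if "v s = Some y"
    unfolding eq using o that by (simp add: outcome_def)
qed

lemma body_reach:
  assumes "\<forall>x\<in>set (body r). regs x \<subseteq> {..<K}"
  shows "reach K (body r @ ks) s ks (fold run (body r) s)"
  using run_list[of "body r" K ks s] assms ok_body[of r] by (auto simp: ok_cmds_def)

definition computes :: "recf \<Rightarrow> (nat \<Rightarrow> nat) \<Rightarrow> bool" where
  "computes r f \<longleftrightarrow> (\<forall>n y. rec_eval r [n] y \<longleftrightarrow> y = f n)"

text \<open>
The register of the bound grows by one in each round and the input is preserved, so the bound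
eventually reaches one at which evaluation succeeds, whatever the other registers contain.
\<close>

lemma search_loop:
  assumes r: "computes r f" and K: "2 < K" "\<forall>x\<in>set (body r). regs x \<subseteq> {..<K}"
    and s: "s 2 \<noteq> 0"
  shows "\<exists>s'. reach K (Loop 2 (body r) # ep) s ep s' \<and> s' 4 = f (s 0)"
proof -
  have "rec_eval r [s 0] (f (s 0))" using r by (simp add: computes_def)
  then obtain t0 where t0: "\<And>t. t \<ge> t0 \<Longrightarrow> bounded_eval r t [s 0] = Some (f (s 0))"
    using bounded_eval_complete by blast
  have sound: "y = f (s 0)" if "bounded_eval r t [s 0] = Some y" for t y
    using bounded_eval_sound[OF that] r by (simp add: computes_def)
  have "\<exists>s'. reach K (Loop 2 (body r) # ep) s1 ep s' \<and> s' 4 = f (s 0)"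
    if "s1 0 = s 0" "s1 2 \<noteq> 0" for s1
    using that
  proof (induction "t0 - s1 1" arbitrary: s1 rule: less_induct)
    case less
    obtain m where m: "s1 2 = Suc m" using less.prems(2) not0_implies_Suc by blast
    let ?s = "s1(2 := m)"
    let ?s2 = "fold run (body r) ?s"
    have step: "reach K (Loop 2 (body r) # ep) s1 (Loop 2 (body r) # ep) ?s2"
      using reach_Loop[where i = 2 and K = K and s = s1 and m = m, OF K(1) m] body_reach[OF K(2)] by (rule reach_trans)
    have v: "?s2 0 = s 0" "?s2 1 = Suc (s1 1)"
      "?s2 2 = (if bounded_eval r (Suc (s1 1)) [s 0] = None then 1 else 0)"
      "\<And>y. bounded_eval r (Suc (s1 1)) [s 0] = Some y \<Longrightarrow> ?s2 4 = y"
      using run_body[of r ?s] less.prems(1) by simp_all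
    show ?case
    proof (cases "bounded_eval r (Suc (s1 1)) [s 0]")
      case None
      then have "\<not> t0 \<le> Suc (s1 1)" using t0 by fastforce
      then have "t0 - ?s2 1 < t0 - s1 1" using v(2) by simp
      then obtain s' where "reach K (Loop 2 (body r) # ep) ?s2 ep s'" "s' 4 = f (s 0)"
        using less.hyps[of ?s2] v(1,3) None by auto
      then show ?thesis using reach_trans[OF step] by blast
    next
      case (Some y)
      then have "reach K (Loop 2 (body r) # ep) ?s2 ep ?s2"
        using v(3) K(1) by (intro reach_exit) auto
      moreover have "?s2 4 = f (s 0)" using v(4) Some sound by blast
      ultimately show ?thesis using reach_trans[OF step] by blast
    qed
  qed
  then show ?thesis using s by blast
qed

text \<open>
The control lists that occur while \<open>cs\<close> is executed in front of \<open>ks\<close>; this is a finite set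
because a loop returns to the same list after each iteration.
\<close>

fun continuations :: "cmd list \<Rightarrow> cmd list \<Rightarrow> cmd list set" where
  "continuations [] ks = {ks}"
| "continuations (Inc i # cs) ks = insert (Inc i # cs @ ks) (continuations cs ks)"
| "continuations (Dec i # cs) ks = insert (Dec i # cs @ ks) (continuations cs ks)"
| "continuations (Loop i c # cs) ks =
    insert (Loop i c # cs @ ks) (continuations c (Loop i c # cs @ ks) \<union> continuations cs ks)"

lemma finite_conts: "finite (continuations cs ks)"
  by (induction cs ks rule: continuations.induct) auto

lemma continuations_self: "cs @ ks \<in> continuations cs ks"
  by (cases "(cs, ks)" rule: continuations.cases) auto

lemma continuations_closed:
  assumes "x # xs \<in> continuations cs ks"
  shows "x # xs = ks \<or>
    (case x of Inc i \<Rightarrow> xs \<in> continuations cs ks | Dec i \<Rightarrow> xs \<in> continuations cs ks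
     | Loop i c \<Rightarrow> xs \<in> continuations cs ks \<and> c @ x # xs \<in> continuations cs ks)"
  using assms
proof (induction cs ks rule: continuations.induct)
  case (4 i c cs ks)
  from 4(3) consider "x # xs = Loop i c # cs @ ks"
    | "x # xs \<in> continuations c (Loop i c # cs @ ks)" | "x # xs \<in> continuations cs ks" by auto
  then show ?case
  proof cases
    case 1
    then show ?thesis using continuations_self[of cs ks] continuations_self[of c "Loop i c # cs @ ks"] by auto
  next
    case 2
    then show ?thesis using 4(1)[OF 2] continuations_self[of cs ks] continuations_self[of c "Loop i c # cs @ ks"]
      by (auto split: cmd.splits)
  next
    case 3
    then show ?thesis using 4(2)[OF 3] by (auto split: cmd.splits)
  qed
qed (auto simp: continuations_self split: cmd.splits)

lemma continuations_suffix:
  assumes "ks' \<in> continuations cs ks" "\<forall>x\<in>set cs. P x"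
    and P: "\<And>i c x. P (Loop i c) \<Longrightarrow> x \<in> set c \<Longrightarrow> P x"
  shows "\<exists>c. ks' = c @ ks \<and> (\<forall>x\<in>set c. P x)"
  using assms(1,2)
proof (induction cs ks rule: continuations.induct)
  case (1 ks)
  then show ?case by (intro exI[of _ "[]"]) auto
next
  case (2 i cs ks)
  then show ?case by (auto intro: exI[of _ "Inc i # cs"])
next
  case (3 i cs ks)
  then show ?case by (auto intro: exI[of _ "Dec i # cs"])
next
  case (4 i c cs ks)
  from 4(3) consider "ks' = Loop i c # cs @ ks"
    | "ks' \<in> continuations c (Loop i c # cs @ ks)" | "ks' \<in> continuations cs ks" by auto
  then show ?case
  proof cases
    case 1
    then show ?thesis using 4(4) by (intro exI[of _ "Loop i c # cs"]) auto
  next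
    case 2
    have "\<forall>x\<in>set c. P x" using 4(4) P[of i c] by simp
    then obtain d where "ks' = d @ Loop i c # cs @ ks" "\<forall>x\<in>set d. P x"
      using 4(1)[OF 2] by blast
    then show ?thesis using 4(4) by (intro exI[of _ "d @ Loop i c # cs"]) auto
  next
    case 3
    then show ?thesis using 4(2,4) by auto
  qed
qed

lemma continuations_suffix_bounded:
  assumes "ks' \<in> continuations cs ks" "\<forall>x\<in>set cs. bounded_loops x \<and> regs x \<subseteq> V"
  shows "\<exists>c. ks' = c @ ks \<and> (\<forall>x\<in>set c. bounded_loops x \<and> regs x \<subseteq> V)"
  by (rule continuations_suffix[OF assms]) (auto simp: UN_subset_iff)

text \<open>
Execution may start in the middle of the body with arbitrary registers.  The rest of the body has only
bounded loops and ends; then either the loop is left or full rounds follow, with whatever is then in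
register 0 as the input.
\<close>

lemma search_terminates:
  assumes r: "computes r f" and K: "2 < K" "\<forall>x\<in>set (body r @ ep). regs x \<subseteq> {..<K}"
    and ep: "\<forall>x\<in>set ep. bounded_loops x"
    and ks: "ks \<in> continuations (search r ep) []"
  shows "terminates K ks s"
proof -
  have E: "terminates K e s" if e: "e \<in> continuations ep []" for e s
  proof -
    obtain c where "e = c @ []" "\<forall>x\<in>set c. bounded_loops x \<and> regs x \<subseteq> {..<K}"
      using continuations_suffix_bounded[OF e, of "{..<K}"] K ep by auto
    moreover have "terminates K [] s" for s using reach_refl by (auto simp: terminates_def)
    ultimately show ?thesis using run_list_terminates[of c K "[]" s] by simp
  qed
  have W: "terminates K (Loop 2 (body r) # ep) s" for s
  proof (cases "s 2 = 0")
    case True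
    then show ?thesis using reach_terminates[OF reach_exit[OF K(1)]] E[OF continuations_self[of ep "[]", simplified]] by blast
  next
    case False
    then show ?thesis using search_loop[OF r K(1), of s ep] K(2) reach_terminates
      E[OF continuations_self[of ep "[]", simplified]] by fastforce
  qed
  from ks consider "ks = Inc 2 # Loop 2 (body r) # ep" | "ks = Loop 2 (body r) # ep"
    | "ks \<in> continuations (body r) (Loop 2 (body r) # ep)" | "ks \<in> continuations ep []"
    by (auto simp: search_def)
  then show ?thesis
  proof cases
    case 1
    then show ?thesis using reach_terminates[OF reach_Inc[OF K(1)]] W by blast
  next
    case 2
    then show ?thesis using W by simp
  next
    case 3
    then obtain c where c: "ks = c @ Loop 2 (body r) # ep"
      "\<forall>x\<in>set c. bounded_loops x \<and> regs x \<subseteq> {..<K}"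
      using continuations_suffix_bounded[OF 3, of "{..<K}"] K ok_body[of r] by (auto simp: ok_cmds_def)
    then show ?thesis using run_list_terminates[OF c(2) W] by simp
  next
    case 4
    then show ?thesis by (rule E)
  qed
qed

lemma finite_regs: "finite (regs x)"
  by (induction x) auto

lemma continuations_regs:
  assumes "ks' \<in> continuations cs []" "\<forall>x\<in>set cs. regs x \<subseteq> V"
  shows "\<forall>x\<in>set ks'. regs x \<subseteq> V"
  using continuations_suffix[where P = "\<lambda>x. regs x \<subseteq> V", OF assms] by (auto simp: UN_subset_iff)

lemma continuations_counter_program:
  assumes "\<forall>x\<in>set P \<union> set P'. regs x \<subseteq> {..<K}"
  shows "counter_program K (continuations P [] \<union> continuations P' [])"
proof
  show "finite (continuations P [] \<union> continuations P' [])" by (simp add: finite_conts)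
  fix i ks
  have R: "\<forall>x\<in>set ks'. regs x \<subseteq> {..<K}" if "ks' \<in> continuations P [] \<union> continuations P' []" for ks'
  proof -
    from that consider "ks' \<in> continuations P []" | "ks' \<in> continuations P' []" by blast
    then show ?thesis
      by cases (rule continuations_regs, assumption, use assms in simp)+
  qed
  show "i < K \<and> ks \<in> continuations P [] \<union> continuations P' []" if "Inc i # ks \<in> continuations P [] \<union> continuations P' []"
    using that R[OF that] continuations_closed[of "Inc i" ks _ "[]"] by auto
  show "i < K \<and> ks \<in> continuations P [] \<union> continuations P' []" if "Dec i # ks \<in> continuations P [] \<union> continuations P' []"
    using that R[OF that] continuations_closed[of "Dec i" ks _ "[]"] by auto
  show "i < K \<and> ks \<in> continuations P [] \<union> continuations P' [] \<and> c @ Loop i c # ks \<in> continuations P [] \<union> continuations P' []"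
    if "Loop i c # ks \<in> continuations P [] \<union> continuations P' []" for c
    using that R[OF that] continuations_closed[of "Loop i c" ks _ "[]"] by auto
qed


text \<open>
Dies exactly if register 5 exceeds register 6.
\<close>

section \<open>Acting on the computed value\<close>

definition compare :: "cmd list" where
  "compare = [Loop 5 [Dec 6]]"

text \<open>
Puts the successor of the computed value into the registers 5 and 6; the successor makes the power
in the pumping argument larger than \<open>f n\<close>.
\<close>

definition magnify :: "cmd list" where
  "magnify = [Loop 5 [], Loop 6 [], Loop 4 [Inc 5, Inc 6], Inc 5, Inc 6]"

text \<open>
Dies exactly if the computed value is positive.
\<close>

definition reject :: "cmd list" where
  "reject = [Loop 5 [], Loop 4 [Dec 5]]"

lemma compare_equal:
  assumes K: "6 < K"
  shows "s 5 = s 6 \<Longrightarrow> \<exists>s'. reach K compare s [] s'"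
proof (induction "s 5" arbitrary: s)
  case 0
  then show ?case using reach_exit[of 5 K s "[Dec 6]" "[]"] K unfolding compare_def by auto
next
  case (Suc m)
  have "reach K (Loop 5 [Dec 6] # []) s ([Dec 6] @ Loop 5 [Dec 6] # []) (s(5 := m))"
    using K Suc.hyps(2) by (intro reach_Loop) auto
  moreover have "reach K (Dec 6 # Loop 5 [Dec 6] # []) (s(5 := m)) (Loop 5 [Dec 6] # []) (s(5 := m, 6 := m))"
    using K Suc.hyps(2) Suc.prems by (intro reach_Dec) auto
  ultimately have "reach K compare s compare (s(5 := m, 6 := m))"
    unfolding compare_def by (simp add: reach_trans del: fun_upd_apply)
  moreover obtain s' where "reach K compare (s(5 := m, 6 := m)) [] s'"
    using Suc.hyps(1)[of "s(5 := m, 6 := m)"] by auto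
  ultimately show ?case using reach_trans by blast
qed

lemma compare_greater:
  assumes K: "6 < K"
  shows "s 5 > s 6 \<Longrightarrow> dies K compare s"
proof (induction "s 6" arbitrary: s)
  case 0
  have "reach K (Loop 5 [Dec 6] # []) s ([Dec 6] @ Loop 5 [Dec 6] # []) (s(5 := s 5 - 1))"
    using K 0 by (intro reach_Loop) auto
  moreover have "dies K (Dec 6 # Loop 5 [Dec 6] # []) (s(5 := s 5 - 1))"
    using K 0 by (intro dies_Dec) auto
  ultimately show ?case unfolding compare_def by (simp add: reach_dies del: fun_upd_apply)
next
  case (Suc m)
  have "reach K (Loop 5 [Dec 6] # []) s ([Dec 6] @ Loop 5 [Dec 6] # []) (s(5 := s 5 - 1))"
    using K Suc.prems by (intro reach_Loop) auto
  moreover have "reach K (Dec 6 # Loop 5 [Dec 6] # []) (s(5 := s 5 - 1)) (Loop 5 [Dec 6] # []) (s(5 := s 5 - 1, 6 := m))"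
    using K Suc.hyps(2) by (intro reach_Dec) auto
  ultimately have "reach K compare s compare (s(5 := s 5 - 1, 6 := m))"
    unfolding compare_def by (simp add: reach_trans del: fun_upd_apply)
  moreover have "dies K compare (s(5 := s 5 - 1, 6 := m))"
    using Suc.hyps(1)[of "s(5 := s 5 - 1, 6 := m)"] Suc.hyps(2) Suc.prems by auto
  ultimately show ?case using reach_dies by blast
qed

lemma magnify_reach:
  assumes K: "6 < K"
  shows "\<exists>s'. reach K (magnify @ ks) s ks s' \<and> s' 5 = Suc (s 4) \<and> s' 6 = Suc (s 4)"
proof -
  have "reach K (magnify @ ks) s ks (fold run magnify s)"
    using run_list[of magnify K ks s] K by (auto simp: magnify_def)
  moreover have "fold run magnify s 5 = Suc (s 4)" "fold run magnify s 6 = Suc (s 4)"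
    by (simp_all add: magnify_def run_clear run_Loop_Inc2 del: run_Loop)
  ultimately show ?thesis by blast
qed

lemma reject_zero:
  assumes K: "6 < K" and "s 4 = 0"
  shows "\<exists>s'. reach K reject s [] s'"
proof -
  have "reach K (Loop 5 [] # [Loop 4 [Dec 5]]) s [Loop 4 [Dec 5]] (s(5 := 0))"
    using run_reach[of "Loop 5 []" K "[Loop 4 [Dec 5]]" s] K by (auto simp: run_clear simp del: run_Loop fun_upd_apply)
  moreover have "reach K (Loop 4 [Dec 5] # []) (s(5 := 0)) [] (s(5 := 0))"
    using K assms(2) by (intro reach_exit) auto
  ultimately show ?thesis unfolding reject_def using reach_trans by blast
qed

lemma reject_pos:
  assumes K: "6 < K" and "s 4 > 0"
  shows "dies K reject s"
proof -
  have "reach K (Loop 5 [] # [Loop 4 [Dec 5]]) s [Loop 4 [Dec 5]] (s(5 := 0))"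
    using run_reach[of "Loop 5 []" K "[Loop 4 [Dec 5]]" s] K by (auto simp: run_clear simp del: run_Loop fun_upd_apply)
  moreover have "reach K (Loop 4 [Dec 5] # []) (s(5 := 0)) ([Dec 5] @ Loop 4 [Dec 5] # []) (s(5 := 0, 4 := s 4 - 1))"
    using K assms(2) by (intro reach_Loop) auto
  moreover have "dies K (Dec 5 # Loop 4 [Dec 5] # []) (s(5 := 0, 4 := s 4 - 1))"
    using K by (intro dies_Dec) auto
  ultimately show ?thesis unfolding reject_def using reach_trans reach_dies
    by (metis append_Cons append_Nil)
qed

section \<open>The semigroup\<close>

definition start :: "nat \<Rightarrow> nat \<Rightarrow> nat" where
  "start n = (\<lambda>_. 0)(0 := n)"

text \<open>
Register 0 comes first, so its \<open>n\<close> units form a power in the middle of the word.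
\<close>

definition start_word :: "nat \<Rightarrow> cmd list \<Rightarrow> nat \<Rightarrow> letter list" where
  "start_word K p n = [St p] @ concat (replicate n [Sym 0 True]) @ map (\<lambda>i. Sym i False) [0..<K]"

lemma conf_of_ends:
  "distinct is \<Longrightarrow> conf_of (map (\<lambda>i. Sym i False) is) = Some (0, None, \<lambda>i. if i \<in> set is then [False] else [])"
  unfolding conf_of_def by (induction "is") (auto simp: fun_eq_iff)

lemma foldr_prep_replicate:
  "foldr prep (replicate n (Sym i True)) (Some (0, None, \<sigma>)) = Some (0, None, \<sigma>(i := replicate n True @ \<sigma> i))"
  by (induction n) auto

lemma conf_of_start_word:
  assumes "0 < K"
  shows "conf_of (start_word K p n) = conf_at K 0 p (start n) (\<lambda>_. [])"
proof -
  let ?\<sigma> = "\<lambda>i. if i \<in> set [0..<K] then [False] else []"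
  have "concat (replicate n [Sym 0 True]) = replicate n (Sym 0 True)" by (induction n) auto
  then have "conf_of (start_word K p n) =
      prep (St p) (foldr prep (replicate n (Sym 0 True)) (conf_of (map (\<lambda>i. Sym i False) [0..<K])))"
    by (simp add: start_word_def conf_of_def)
  also have "\<dots> = Some (0, Some p, ?\<sigma>(0 := replicate n True @ ?\<sigma> 0))"
    unfolding conf_of_ends[OF distinct_upt] foldr_prep_replicate by simp
  also have "?\<sigma>(0 := replicate n True @ ?\<sigma> 0) = stacks K (start n) (\<lambda>_. [])"
    using assms by (auto simp: stacks_def start_def fun_eq_iff)
  finally show ?thesis by (simp add: conf_at_def)
qed

lemma search_reach:
  assumes r: "computes r f" and K: "2 < K" "\<forall>x\<in>set (body r). regs x \<subseteq> {..<K}"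
  shows "\<exists>s. reach K (search r ep) (start n) ep s \<and> s 4 = f n"
proof -
  let ?s = "(start n)(2 := Suc (start n 2))"
  have 1: "reach K (search r ep) (start n) (Loop 2 (body r) # ep) ?s"
    unfolding search_def by (rule reach_Inc[OF K(1)])
  have "?s 2 \<noteq> 0" "?s 0 = n" by (simp_all add: start_def)
  then obtain s where "reach K (Loop 2 (body r) # ep) ?s ep s" "s 4 = f n"
    using search_loop[OF r K, of ?s ep] by metis
  then show ?thesis using reach_trans[OF 1] by blast
qed

context counter_program
begin

lemma cong_if_cong0: "u \<approx> v \<Longrightarrow> u \<in> words X \<Longrightarrow> u \<sim> v"
  by (auto simp: cong0_def intro: pres_cong.refl)

lemma push_replicate:
  "i < K \<Longrightarrow> replicate m (Sym i True) @ stack_word \<sigma> \<approx> stack_word (\<sigma>(i := replicate m True @ \<sigma> i))"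
proof (induction m)
  case 0
  then show ?case by (simp add: cong0_refl)
next
  case (Suc m)
  let ?\<sigma> = "\<sigma>(i := replicate m True @ \<sigma> i)"
  have "Sym i True # replicate m (Sym i True) @ stack_word \<sigma> \<approx> Sym i True # stack_word ?\<sigma>"
    using Suc.IH[OF Suc.prems] by (rule cong0_Cons) (use Suc.prems in \<open>simp add: in_letters\<close>)
  also have "\<dots> \<approx> stack_word (?\<sigma>(i := True # ?\<sigma> i))" by (rule push[OF Suc.prems])
  also have "?\<sigma>(i := True # ?\<sigma> i) = \<sigma>(i := replicate (Suc m) True @ \<sigma> i)" by simp
  finally show ?case by simp
qed

lemma word_of_conf_at_factor:
  fixes k :: nat and s :: "nat \<Rightarrow> nat" and j :: "nat \<Rightarrow> bool list"
  assumes i: "i < K" and p: "p \<in> Q"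
  defines "u \<equiv> replicate k Gar @ [St p]"
    and "v \<equiv> stack_word ((stacks K s j)(i := False # j i))"
  shows "u @ concat (replicate m [Sym i True]) @ v \<approx> word_of (conf_at K k p (s(i := m)) j)"
    and "u \<in> words X" "v \<in> words X"
proof -
  let ?\<sigma> = "(stacks K s j)(i := False # j i)"
  have c: "concat (replicate m [Sym i True]) = replicate m (Sym i True)" by (induction m) auto
  have "?\<sigma>(i := replicate m True @ ?\<sigma> i) = stacks K (s(i := m)) j"
    using i by (auto simp: stacks_def fun_eq_iff)
  then have "replicate m (Sym i True) @ v \<approx> stack_word (stacks K (s(i := m)) j)"
    unfolding v_def using push_replicate[OF i, of m ?\<sigma>] by metis
  moreover have u: "set u \<subseteq> X" using p by (auto simp: u_def in_letters)
  ultimately have "u @ (replicate m (Sym i True) @ v) @ [] \<approx> u @ stack_word (stacks K (s(i := m)) j) @ []"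
    by (intro cong0_context) auto
  then show "u @ concat (replicate m [Sym i True]) @ v \<approx> word_of (conf_at K k p (s(i := m)) j)"
    by (simp add: c u_def conf_at_def)
  have "u \<noteq> []" by (simp add: u_def)
  with u show "u \<in> words X" unfolding words_iff by blast
  have "set v = (\<Union>l\<in>{..<K}. Sym l ` set (?\<sigma> l))" by (auto simp: v_def blocks_def)
  moreover have "Sym i False \<in> Sym i ` set (?\<sigma> i)" by simp
  ultimately have "v \<noteq> []" using i by fastforce
  moreover have "set v \<subseteq> X" unfolding v_def by (rule stack_word_letters)
  ultimately show "v \<in> words X" unfolding words_iff by blast
qed

lemma cong_zero_if_dies:
  assumes "dies K p s" "p \<in> Q" "w \<in> words X" "w \<approx> word_of (conf_at K k p s j)"
  shows "w \<sim> [Zer]"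
proof -
  have "valid (conf_at K k p s j)" using assms(2) by (simp add: conf_at_def stacks_def)
  then have "word_of (conf_at K k p s j) \<approx> word_of None"
    using assms(1) word_of_steps unfolding dies_def by blast
  then have "w \<approx> [Zer]" using assms(4) cong0_trans by simp
  then show ?thesis using assms(3) by (rule cong_if_cong0)
qed

lemma start_word_in_words:
  assumes "0 < K" "p \<in> Q"
  shows "start_word K p n \<in> words X" "{[St p], [Sym 0 True], map (\<lambda>i. Sym i False) [0..<K]} \<subseteq> words X"
  using assms by (auto simp: start_word_def words_iff in_letters)

lemma start_word_dies:
  assumes "0 < K" "p \<in> Q" "dies K p (start n)"
  shows "start_word K p n \<sim> [Zer]"
proof -
  have "step\<^sup>*\<^sup>* (conf_of (start_word K p n)) None"
    using assms(3) unfolding conf_of_start_word[OF assms(1)] dies_def by blast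
  then show ?thesis using cong_iff[OF start_word_in_words(1)[OF assms(1,2)] _ terminal_None] by blast
qed

lemma start_word_survives:
  assumes "0 < K" "p \<in> Q" "reach K p (start n) [] s"
  shows "\<not> start_word K p n \<sim> [Zer]"
proof -
  obtain k where k: "step\<^sup>*\<^sup>* (conf_of (start_word K p n)) (conf_at K k [] s (\<lambda>_. []))"
    using assms(3) unfolding conf_of_start_word[OF assms(1)] reach_def by blast
  moreover have "terminal (conf_at K k [] s (\<lambda>_. []))" by (simp add: conf_at_def terminal_stuck)
  ultimately show ?thesis
    using cong_iff[OF start_word_in_words(1)[OF assms(1,2)], of n "conf_at K k [] s (\<lambda>_. [])"]
    by (simp add: conf_at_def)
qed

text \<open>
At the moment of comparison the registers 5 and 6 agree.  Larger powers of the letter of register 5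
correspond to the same configuration with a larger register 5, on which the comparison is fatal.
\<close>

lemma start_word_pumps:
  assumes K: "6 < K" and pq: "p \<in> Q" "compare \<in> Q"
    and r: "reach K p (start n) compare s" "s 5 = s 6"
  shows "\<exists>u b v. {u, b, v} \<subseteq> words X \<and>
     start_word K p n \<sim> u @ concat (replicate (s 5) b) @ v \<and>
     (\<forall>m>s 5. u @ concat (replicate m b) @ v \<sim> [Zer])"
proof -
  have K0: "0 < K" "5 < K" using K by auto
  obtain k where k: "step\<^sup>*\<^sup>* (conf_of (start_word K p n)) (conf_at K k compare s (\<lambda>_. []))"
    using r(1) unfolding conf_of_start_word[OF K0(1)] reach_def by blast
  define u where "u = replicate k Gar @ [St compare]"
  define v where "v = stack_word ((stacks K s (\<lambda>_. []))(5 := [False]))"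
  have fac: "u @ concat (replicate m [Sym 5 True]) @ v \<approx> word_of (conf_at K k compare (s(5 := m)) (\<lambda>_. []))"
    and uv: "u \<in> words X" "v \<in> words X" for m
    using word_of_conf_at_factor(1)[OF K0(2) pq(2), where j = "\<lambda>_. []" and k = k and s = s]
      word_of_conf_at_factor(2)[OF K0(2) pq(2), where k = k]
      word_of_conf_at_factor(3)[OF K0(2) pq(2), where j = "\<lambda>_. []" and s = s]
    unfolding u_def v_def by auto
  have b: "[Sym 5 True] \<in> words X" using K by (simp add: words_iff in_letters)
  have w: "u @ concat (replicate m [Sym 5 True]) @ v \<in> words X" for m
    using uv b by (induction m) (auto simp: words_iff)
  have "start_word K p n \<sim> word_of (conf_at K k compare s (\<lambda>_. []))"
    using start_word_in_words(1)[OF K0(1) pq(1)] k by (rule cong_word_of)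
  moreover have "word_of (conf_at K k compare s (\<lambda>_. [])) \<approx> u @ concat (replicate (s 5) [Sym 5 True]) @ v"
    using cong0_sym[OF fac[of "s 5"]] by (simp add: fun_upd_idem)
  ultimately have "start_word K p n \<sim> u @ concat (replicate (s 5) [Sym 5 True]) @ v"
    by (meson cong0_def cong0_trans cong_if_cong0 start_word_in_words(1)[OF K0(1) pq(1)])
  moreover have "u @ concat (replicate m [Sym 5 True]) @ v \<sim> [Zer]" if "m > s 5" for m
  proof (rule cong_zero_if_dies[OF _ pq(2) w fac])
    show "dies K compare (s(5 := m))" by (rule compare_greater[OF K]) (use that r(2) in auto)
  qed
  ultimately show ?thesis using uv b by blast
qed

end

theorem theorem3p9:
  fixes f :: "nat \<Rightarrow> nat" and Z :: "nat set"
  assumes "recursive_fun f" and "recursive_set Z"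
  shows "\<exists>S :: nat list set sgrp.
           finitely_presented S \<and> residually_finite S \<and>
           (\<exists>X. finite X \<and> generates S X \<and> (\<forall>n\<ge>1. depth S X n > f n)) \<and>
           word_problem_as_hard_as S Z"
proof -
  let ?\<chi> = "\<lambda>n. if n \<in> Z then 1 else 0 :: nat"
  obtain r r' where r: "computes r f" and r': "computes r' ?\<chi>"
    using assms by (auto simp: recursive_fun_def recursive_set_def computes_def)
  let ?p = "search r (magnify @ compare)" and ?p' = "search r' reject"
  have "finite (\<Union>x\<in>set (?p @ ?p'). regs x)" by (simp add: finite_regs)
  then obtain K0 where bound: "\<forall>i\<in>(\<Union>x\<in>set (?p @ ?p'). regs x). i \<le> K0"
    using finite_nat_set_iff_bounded_le by blast
  have K0: "regs x \<subseteq> {..<K0 + 7}" if "x \<in> set ?p \<union> set ?p'" for x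
  proof
    fix i assume "i \<in> regs x"
    then have "i \<in> (\<Union>x\<in>set (?p @ ?p'). regs x)" using that by auto
    then have "i \<le> K0" by (rule bspec[OF bound])
    then show "i \<in> {..<K0 + 7}" by simp
  qed
  \<comment> \<open>The number 7 makes room for the registers 0 to 6, which occur explicitly in the programs.\<close>
  define K where "K = K0 + 7"
  define Q where "Q = continuations ?p [] \<union> continuations ?p' []"
  have K: "6 < K" "2 < K" "0 < K" by (auto simp: K_def)
  have regs: "\<forall>x\<in>set ?p \<union> set ?p'. regs x \<subseteq> {..<K}" using K0 by (simp add: K_def)
  interpret counter_program K Q
    unfolding Q_def by (rule continuations_counter_program[OF regs])
  have "regs (Loop 2 (body r)) \<subseteq> {..<K}" "regs (Loop 2 (body r')) \<subseteq> {..<K}"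
    using regs by (auto simp: search_def simp del: regs.simps)
  then have body: "\<forall>x\<in>set (body r). regs x \<subseteq> {..<K}" "\<forall>x\<in>set (body r'). regs x \<subseteq> {..<K}"
    by (auto simp: UN_subset_iff)
  have pQ: "?p \<in> Q" "?p' \<in> Q"
    unfolding Q_def using continuations_self[of ?p "[]"] continuations_self[of ?p' "[]"] by auto
  have cQ: "compare \<in> Q"
    by (simp add: Q_def search_def magnify_def compare_def)
  have halts: "\<exists>d. step\<^sup>*\<^sup>* c d \<and> terminal d" if "valid c" for c
  proof (rule halts_if_terminates[OF _ that])
    fix ks s assume "ks \<in> Q"
    then consider "ks \<in> continuations ?p []" | "ks \<in> continuations ?p' []" by (auto simp: Q_def)
    then show "terminates K ks s"
    proof cases
      case 1
      have "\<forall>x\<in>set (magnify @ compare). regs x \<subseteq> {..<K}" "\<forall>x\<in>set (magnify @ compare). bounded_loops x"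
        using K by (simp_all add: magnify_def compare_def)
      then show ?thesis using body(1) by (intro search_terminates[OF r K(2) _ _ 1]) (simp_all only: set_append ball_Un)
    next
      case 2
      have "\<forall>x\<in>set reject. regs x \<subseteq> {..<K}" "\<forall>x\<in>set reject. bounded_loops x"
        using K by (simp_all add: reject_def)
      then show ?thesis using body(2) by (intro search_terminates[OF r' K(2) _ _ 2]) (simp_all only: set_append ball_Un)
    qed
  qed
  have compare: "\<exists>s. reach K ?p (start n) compare s \<and> s 5 = Suc (f n) \<and> s 6 = Suc (f n)" for n
  proof -
    obtain s1 where s1: "reach K ?p (start n) (magnify @ compare) s1" "s1 4 = f n"
      using search_reach[OF r K(2) body(1)] by blast
    obtain s where "reach K (magnify @ compare) s1 compare s" "s 5 = Suc (s1 4)" "s 6 = Suc (s1 4)"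
      using magnify_reach[OF K(1)] by blast
    then show ?thesis using reach_trans[OF s1(1)] s1(2) by auto
  qed
  let ?X = "letters K Q" and ?R = "rules K Q"
  let ?E = "map (\<lambda>i. Sym i False) [0..<K]"
  show ?thesis
  proof (rule hard_semigroup_of_presentation[of ?X ?R Zer "[St ?p]" "[Sym 0 True]"
        ?E "[St ?p']" "[Sym 0 True]" ?E f Z])
    show "finite ?X" by (rule finite_letters)
    show "finite ?R" by (rule finite_rules)
    show "?R \<subseteq> words ?X \<times> words ?X" by (rule rules_subset)
    show "Zer \<in> ?X" by (simp add: in_letters)
    show "finite {v. pres_cong ?X ?R w v}" if "w \<in> words ?X" "\<not> pres_cong ?X ?R w [Zer]" for w
      using halts that by (rule finite_nonzero_class)
    show "{[St ?p], [Sym 0 True], ?E,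
        [St ?p'], [Sym 0 True], ?E} \<subseteq> words ?X"
      using start_word_in_words(2)[OF K(3) pQ(1)] start_word_in_words(2)[OF K(3) pQ(2)] by simp
  next
    fix n
    obtain s where s: "reach K ?p (start n) compare s" "s 5 = Suc (f n)" "s 6 = Suc (f n)"
      using compare by blast
    then obtain s' where "reach K ?p (start n) [] s'"
      using compare_equal[OF K(1), of s] reach_trans[OF s(1)] by auto
    then show "\<not> pres_cong ?X ?R ([St ?p] @ concat (replicate n [Sym 0 True]) @ ?E) [Zer]"
      using start_word_survives[OF K(3) pQ(1)] unfolding start_word_def by blast
    have "s 5 = s 6" using s(2,3) by simp
    then obtain u b v where "{u, b, v} \<subseteq> words ?X"
      "pres_cong ?X ?R (start_word K ?p n) (u @ concat (replicate (s 5) b) @ v)"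
      "\<forall>m>s 5. pres_cong ?X ?R (u @ concat (replicate m b) @ v) [Zer]"
      using start_word_pumps[OF K(1) pQ(1) cQ s(1)] by blast
    moreover have "s 5 > f n" using s(2) by simp
    ultimately show "\<exists>u b v m. {u, b, v} \<subseteq> words ?X \<and> m > f n \<and>
       pres_cong ?X ?R ([St ?p] @ concat (replicate n [Sym 0 True]) @ ?E)
         (u @ concat (replicate m b) @ v) \<and>
       (\<forall>m'>m. pres_cong ?X ?R (u @ concat (replicate m' b) @ v) [Zer])"
      unfolding start_word_def by blast
    obtain t where t: "reach K ?p' (start n) reject t" "t 4 = ?\<chi> n"
      using search_reach[OF r' K(2) body(2)] by blast
    have "n \<in> Z \<longleftrightarrow> pres_cong ?X ?R (start_word K ?p' n) [Zer]"
    proof (cases "n \<in> Z")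
      case True
      then have "dies K ?p' (start n)" using t(2) reject_pos[OF K(1), of t] reach_dies[OF t(1)] by simp
      then show ?thesis using start_word_dies[OF K(3) pQ(2)] True by blast
    next
      case False
      then obtain t' where "reach K ?p' (start n) [] t'"
        using t(2) reject_zero[OF K(1), of t] reach_trans[OF t(1)] by auto
      then show ?thesis using start_word_survives[OF K(3) pQ(2)] False by blast
    qed
    then show "n \<in> Z \<longleftrightarrow> pres_cong ?X ?R ([St ?p'] @ concat (replicate n [Sym 0 True]) @ ?E) [Zer]"
      unfolding start_word_def .
  qed
qed

end
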